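(* Let $\Bbbk$ be an algebraically closed field and let $R=\bigoplus_{i\in\mathbb{N}}R_i$ be a noetherian commutative graded ring with $R_0=\Bbbk$. Assume that $R$ is semi-standard graded, Cohen--Macaulay and an integral domain, and that its $h$-vector is $(h_0,h_1,h_2)$. If $h_2\le h_1$, then $R$ is standard graded.
   Context: Let $\Bbbk[R_1]$ denote the $\Bbbk$-subalgebra of $R$ generated by $R_1$. $R$ is called standard graded if $R=\Bbbk[R_1]$, and semi-standard graded if $R$ is finitely generated as a $\Bbbk[R_1]$-module. If $R$ is semi-standard graded of Krull dimension $d$, its Hilbert series has the form $\sum_{i\in\mathbb{N}}(\dim_\Bbbk R_i)t^i=\frac{h_0+h_1t+\cdots+h_st^s}{(1-t)^d}$ with integers $h_i$, $\sum_{i=0}^s h_i\neq 0$ and $h_s\ne 0$; the vector $(h_0,\dots,h_s)$ is called the $h$-vector of $R$. Thus the hypothesis says $s=2$ (in particular $h_2\neq 0$). *)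

theory Defs
  imports
    "HOL-Algebra.Algebra"
    "HOL-Algebra.Algebraic_Closure"
    "HOL-Computational_Algebra.Computational_Algebra"
    "HOL-Library.Extended_Nat"
begin

section \<open>Graded rings\<close>

text \<open>
  \<open>G i\<close> is the homogeneous component of degree \<open>i\<close>. The last assumption is the direct sum
  decomposition: every element is in exactly one way a sum of homogeneous components, almost all
  of them zero.
\<close>

locale graded_cring = cring R for R (structure) +
  fixes G :: "nat \<Rightarrow> 'a set"
  assumes component_subgroup: "subgroup (G i) (add_monoid R)"
    and component_mult: "\<lbrakk> x \<in> G i; y \<in> G j \<rbrakk> \<Longrightarrow> x \<otimes> y \<in> G (i + j)"
    and decomposition: "x \<in> carrier R \<Longrightarrow>
      \<exists>!f. (\<forall>i. f i \<in> G i) \<and> finite {i. f i \<noteq> \<zero>} \<and> x = finsum R f {i. f i \<noteq> \<zero>}"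

text \<open>
  In the following, the ground field is the degree zero component \<open>G 0\<close>. The subalgebra over it
  generated by \<open>G 1\<close> is the subring generated by both. (The library locale \<open>subalgebra\<close> describes
  subspaces that need not be closed under multiplication.)
\<close>

definition degree_one_subalgebra :: "('a, 'b) ring_scheme \<Rightarrow> (nat \<Rightarrow> 'a set) \<Rightarrow> 'a set" where
  "degree_one_subalgebra R G = generate_ring R (G 0 \<union> G 1)"

definition standard_graded :: "('a, 'b) ring_scheme \<Rightarrow> (nat \<Rightarrow> 'a set) \<Rightarrow> bool" where
  "standard_graded R G \<longleftrightarrow> carrier R = degree_one_subalgebra R G"

definition finitely_generated_over :: "('a, 'b) ring_scheme \<Rightarrow> 'a set \<Rightarrow> bool" where
  "finitely_generated_over R A \<longleftrightarrow>
     (\<exists>B. finite B \<and> B \<subseteq> carrier R \<and>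
        (\<forall>r \<in> carrier R. \<exists>c. c \<in> B \<rightarrow> A \<and> r = (\<Oplus>\<^bsub>R\<^esub>x\<in>B. c x \<otimes>\<^bsub>R\<^esub> x)))"

definition semi_standard_graded :: "('a, 'b) ring_scheme \<Rightarrow> (nat \<Rightarrow> 'a set) \<Rightarrow> bool" where
  "semi_standard_graded R G \<longleftrightarrow> finitely_generated_over R (degree_one_subalgebra R G)"


section \<open>Krull dimension, localization, Cohen--Macaulay rings\<close>

text \<open>The supremum of the lengths of chains of prime ideals, with value 0 for the zero ring.\<close>

definition krull_dim :: "('a, 'b) ring_scheme \<Rightarrow> enat" where
  "krull_dim R =
     Sup {enat n | n. \<exists>P. (\<forall>i\<le>n. primeideal (P i) R) \<and> (\<forall>i<n. P i \<subset> P (Suc i))}"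

text \<open>
  The fraction \<open>a / s\<close> is the equivalence class of \<open>(a, s)\<close>. The operations on classes are unions
  over all representatives, which all contribute the same class.
\<close>

definition fraction :: "('a, 'b) ring_scheme \<Rightarrow> 'a set \<Rightarrow> 'a \<Rightarrow> 'a \<Rightarrow> ('a \<times> 'a) set" where
  "fraction R S a s =
     {(b, t). b \<in> carrier R \<and> t \<in> S \<and>
        (\<exists>u \<in> S. u \<otimes>\<^bsub>R\<^esub> (a \<otimes>\<^bsub>R\<^esub> t \<ominus>\<^bsub>R\<^esub> b \<otimes>\<^bsub>R\<^esub> s) = \<zero>\<^bsub>R\<^esub>)}"

definition localization :: "('a, 'b) ring_scheme \<Rightarrow> 'a set \<Rightarrow> ('a \<times> 'a) set ring" where
  "localization R S =
     \<lparr> carrier = {fraction R S a s | a s. a \<in> carrier R \<and> s \<in> S},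
       monoid.mult = (\<lambda>U V. \<Union>(a, s) \<in> U. \<Union>(b, t) \<in> V.
          fraction R S (a \<otimes>\<^bsub>R\<^esub> b) (s \<otimes>\<^bsub>R\<^esub> t)),
       monoid.one = fraction R S \<one>\<^bsub>R\<^esub> \<one>\<^bsub>R\<^esub>,
       ring.zero = fraction R S \<zero>\<^bsub>R\<^esub> \<one>\<^bsub>R\<^esub>,
       ring.add = (\<lambda>U V. \<Union>(a, s) \<in> U. \<Union>(b, t) \<in> V.
          fraction R S (a \<otimes>\<^bsub>R\<^esub> t \<oplus>\<^bsub>R\<^esub> b \<otimes>\<^bsub>R\<^esub> s) (s \<otimes>\<^bsub>R\<^esub> t)) \<rparr>"

definition localization_at :: "('a, 'b) ring_scheme \<Rightarrow> 'a set \<Rightarrow> ('a \<times> 'a) set ring" where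
  "localization_at R P = localization R (carrier R - P)"

text \<open>
  Each \<open>xs ! i\<close> is a non-zero-divisor on the quotient of \<open>R\<close> by the ideal generated by the
  preceding elements, and the quotient by the whole sequence is not zero.
\<close>

definition regular_sequence :: "('a, 'b) ring_scheme \<Rightarrow> 'a list \<Rightarrow> bool" where
  "regular_sequence R xs \<longleftrightarrow>
     set xs \<subseteq> carrier R \<and>
     genideal R (set xs) \<noteq> carrier R \<and>
     (\<forall>i < length xs. \<forall>a \<in> carrier R.
        xs ! i \<otimes>\<^bsub>R\<^esub> a \<in> genideal R (set (take i xs)) \<longrightarrow> a \<in> genideal R (set (take i xs)))"

text \<open>The depth of a local ring; it is only meaningful if the maximal ideal is unique.\<close>

definition local_depth :: "('a, 'b) ring_scheme \<Rightarrow> enat" where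
  "local_depth R =
     Sup {enat (length xs) | xs. regular_sequence R xs \<and> set xs \<subseteq> (THE M. maximalideal M R)}"

definition cohen_macaulay :: "('a, 'b) ring_scheme \<Rightarrow> bool" where
  "cohen_macaulay R \<longleftrightarrow>
     noetherian_ring R \<and>
     (\<forall>M. maximalideal M R \<longrightarrow>
        local_depth (localization_at R M) = krull_dim (localization_at R M))"


section \<open>Hilbert series and h-vectors\<close>

definition hilbert_series :: "('a, 'b) ring_scheme \<Rightarrow> (nat \<Rightarrow> 'a set) \<Rightarrow> int fps" where
  "hilbert_series R G = Abs_fps (\<lambda>i. int (ring.dim R (G 0) (G i)))"

text \<open>
  The identity \<open>H(t) = h(t) / (1 - t)^d\<close> is written without division;
  \<open>(1 - t)^d\<close> is a unit of the ring of power series over the integers.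
\<close>

definition has_h_vector :: "('a, 'b) ring_scheme \<Rightarrow> (nat \<Rightarrow> 'a set) \<Rightarrow> int list \<Rightarrow> bool" where
  "has_h_vector R G h \<longleftrightarrow>
     h \<noteq> [] \<and> last h \<noteq> 0 \<and> sum_list h \<noteq> 0 \<and>
     (\<exists>d. krull_dim R = enat d \<and>
        hilbert_series R G * (1 - fps_X) ^ d = fps_of_poly (Poly h))"

end

theory Submission
  imports Defs
begin

text \<open>
  Put \<open>d = dim R\<close> and let \<open>x\<^sub>1, \<dots>, x\<^sub>d\<close> in \<open>R\<^sub>1\<close> be a regular sequence, \<open>S = K[x\<^sub>1, \<dots>, x\<^sub>d]\<close>.
  Then \<open>R\<close> is free over \<open>S\<close> with \<open>1\<close>, \<open>h1\<close>, \<open>h2\<close> basis elements in the degrees \<open>0\<close>, \<open>1\<close>, \<open>2\<close>,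
  and \<open>R\<close> is standard graded iff \<open>R\<^sub>1 R\<^sub>1\<close> spans \<open>R\<^sub>2\<close>. If it does not, there is a nonzero \<open>S\<close>-linear map
  \<open>\<psi> : R \<rightarrow> S(-2)\<close> that vanishes on \<open>R\<^sub>1 R\<^sub>1\<close>. Over the field of fractions of the domain \<open>R\<close> the bilinear form
  \<open>\<psi>(ab)\<close> is nondegenerate in dimension \<open>1 + h1 + h2\<close>, and the span of \<open>R\<^sub>1\<close>, of
  dimension \<open>1 + h1\<close>, is isotropic; so \<open>2 (1 + h1) \<le> 1 + h1 + h2\<close>, i.e. \<open>h1 < h2\<close>. The argument below
  counts dimensions of graded pieces instead of working over the field of fractions.

  For the regular sequence: the Cohen--Macaulay property gives a regular sequence in the localization at the
  irrelevant ideal \<open>M\<close>. As \<open>K\<close> is infinite and \<open>R\<^sub>1\<close> generates an ideal with radical \<open>M\<close>,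
  prime avoidance allows to exchange its elements for elements of \<open>R\<^sub>1\<close>. Its length is at least \<open>d\<close>: otherwise
  the quotient by the sequence would have a positive-dimensional Hilbert function, which yields a chain of primes
  that is too long for the localization.
\<close>

section \<open>Ideals in Noetherian rings\<close>

text \<open>The definitions speak of localizations, the argument of forms of degree one. The gap is
  bridged without forming quotient rings or modules: regularity is expressed inside \<open>R\<close>
  by the contracted ideals \<open>satur M J\<close>, for which elements outside \<open>M\<close> act
  like units. For a homogeneous ideal this contraction adds no homogeneous elements
  (\<open>satur_homogeneous\<close>), so a local regular sequence in \<open>G 1\<close> gives exact
  counts in every degree. That the sequence has full length rests on h0 + h1 + h2 being nonzero:
  multiplying the Hilbert series by (1 - t)^r with r < d leaves a pole at t = 1, so the quotient
  does not vanish in large degrees and there is room for one more prime below \<open>M\<close>. In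
  the final count the rank of a module over S is read off from the growth of dimensions. A shift of
  the degree by a constant changes the number of forms by a factor tending to 1, so an inequality of
  ranks becomes a strict inequality of dimensions in some large degree, whatever shifts the
  multiplications cause.\<close>

context cring
begin

text \<open>This is the ideal J + Ry. Adjoining one generator at a time makes statements about
  sequences inductions along the list.\<close>

definition adjoin :: "'a set \<Rightarrow> 'a \<Rightarrow> 'a set" where
  "adjoin J y = {j \<oplus> c \<otimes> y | j c. j \<in> J \<and> c \<in> carrier R}"

abbreviation adjoins :: "'a set \<Rightarrow> 'a list \<Rightarrow> 'a set" where
  "adjoins \<equiv> foldl adjoin"

lemma adjoinI: "\<lbrakk> j \<in> J; c \<in> carrier R; r = j \<oplus> c \<otimes> y \<rbrakk> \<Longrightarrow> r \<in> adjoin J y"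
  unfolding adjoin_def by blast

lemma adjoinE:
  assumes "r \<in> adjoin J y" obtains j c where "j \<in> J" "c \<in> carrier R" "r = j \<oplus> c \<otimes> y"
  using assms unfolding adjoin_def by blast

lemma adjoin_ideal:
  assumes "ideal J R" "y \<in> carrier R" shows "ideal (adjoin J y) R"
proof -
  have "adjoin J y = J <+> PIdl y"
    unfolding adjoin_def set_add_def' cgenideal_def by auto
  thus ?thesis using add_ideals[OF assms(1) cgenideal_ideal[OF assms(2)]] by simp
qed

lemma ideal_closed:
  assumes "ideal J R"
  shows "\<And>x. x \<in> J \<Longrightarrow> x \<in> carrier R" "\<zero> \<in> J"
    "\<And>x y. \<lbrakk> x \<in> J; y \<in> J \<rbrakk> \<Longrightarrow> x \<oplus> y \<in> J"
    "\<And>x y. \<lbrakk> x \<in> J; y \<in> J \<rbrakk> \<Longrightarrow> x \<ominus> y \<in> J"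
    "\<And>x. x \<in> J \<Longrightarrow> \<ominus> x \<in> J"
    "\<And>x r. \<lbrakk> x \<in> J; r \<in> carrier R \<rbrakk> \<Longrightarrow> r \<otimes> x \<in> J"
    "\<And>x r. \<lbrakk> x \<in> J; r \<in> carrier R \<rbrakk> \<Longrightarrow> x \<otimes> r \<in> J"
proof -
  interpret ideal J R by fact
  show "\<And>x. x \<in> J \<Longrightarrow> x \<in> carrier R" "\<zero> \<in> J"
    "\<And>x y. \<lbrakk> x \<in> J; y \<in> J \<rbrakk> \<Longrightarrow> x \<oplus> y \<in> J"
    "\<And>x. x \<in> J \<Longrightarrow> \<ominus> x \<in> J"
    "\<And>x r. \<lbrakk> x \<in> J; r \<in> carrier R \<rbrakk> \<Longrightarrow> r \<otimes> x \<in> J"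
    "\<And>x r. \<lbrakk> x \<in> J; r \<in> carrier R \<rbrakk> \<Longrightarrow> x \<otimes> r \<in> J"
    by (auto simp: I_l_closed I_r_closed a_inv_closed)
  show "\<And>x y. \<lbrakk> x \<in> J; y \<in> J \<rbrakk> \<Longrightarrow> x \<ominus> y \<in> J"
    by (simp add: a_minus_def)
qed

lemma ideal_cancel:
  assumes "ideal J R" "x \<in> carrier R" "y \<in> J"
  shows "x \<oplus> y \<in> J \<longleftrightarrow> x \<in> J" "x \<ominus> y \<in> J \<longleftrightarrow> x \<in> J" "y \<oplus> x \<in> J \<longleftrightarrow> x \<in> J"
proof -
  note I = ideal_closed[OF assms(1)]
  have y: "y \<in> carrier R" using assms I by auto
  have 1: "x = (x \<oplus> y) \<ominus> y" "x = (x \<ominus> y) \<oplus> y" "x = (y \<oplus> x) \<ominus> y"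
    using assms(2) y by algebra+
  show "x \<oplus> y \<in> J \<longleftrightarrow> x \<in> J" "x \<ominus> y \<in> J \<longleftrightarrow> x \<in> J" "y \<oplus> x \<in> J \<longleftrightarrow> x \<in> J"
    using 1 I(3,4) assms(3) by metis+
qed

lemma adjoin_incl:
  assumes "ideal J R" "y \<in> carrier R"
  shows "J \<subseteq> adjoin J y" "y \<in> adjoin J y"
proof -
  note I = ideal_closed[OF assms(1)]
  show "J \<subseteq> adjoin J y"
  proof
    fix j assume "j \<in> J"
    moreover have "j = j \<oplus> \<zero> \<otimes> y" using I(1)[OF calculation] assms by algebra
    ultimately show "j \<in> adjoin J y" by (intro adjoinI[of j J \<zero>]) auto
  qed
  show "y \<in> adjoin J y"
    using assms I(2) by (intro adjoinI[of \<zero> J \<one>]) auto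
qed

lemma adjoin_least:
  assumes "ideal I R" "J \<subseteq> I" "y \<in> I" shows "adjoin J y \<subseteq> I"
  using assms ideal_closed[OF assms(1)] by (auto elim!: adjoinE)

lemma adjoin_commute:
  assumes "ideal J R" "a \<in> carrier R" "b \<in> carrier R"
  shows "adjoin (adjoin J a) b = adjoin (adjoin J b) a"
proof -
  have *: "adjoin (adjoin J a) b \<subseteq> adjoin (adjoin J b) a" if "a \<in> carrier R" "b \<in> carrier R" for a b
  proof -
    note 1 = adjoin_incl[OF assms(1) that(2)] adjoin_incl[OF adjoin_ideal[OF assms(1) that(2)] that(1)]
    have 2: "ideal (adjoin (adjoin J b) a) R" by (intro adjoin_ideal assms that)
    have "adjoin J a \<subseteq> adjoin (adjoin J b) a" using 1 by (intro adjoin_least 2) auto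
    thus ?thesis using 1 by (intro adjoin_least 2) auto
  qed
  show ?thesis using * assms by blast
qed

lemma adjoins_ideal:
  assumes "ideal J R" "set ys \<subseteq> carrier R" shows "ideal (adjoins J ys) R"
  using assms by (induction ys arbitrary: J) (auto simp: adjoin_ideal)

lemma adjoins_incl:
  assumes "ideal J R" "set ys \<subseteq> carrier R" shows "J \<subseteq> adjoins J ys" "set ys \<subseteq> adjoins J ys"
proof -
  have "J \<subseteq> adjoins J ys \<and> set ys \<subseteq> adjoins J ys"
    using assms
  proof (induction ys arbitrary: J)
    case (Cons y ys)
    have "adjoin J y \<subseteq> adjoins (adjoin J y) ys" "set ys \<subseteq> adjoins (adjoin J y) ys"
      using Cons.IH[of "adjoin J y"] Cons.prems by (auto simp: adjoin_ideal)
    thus ?case using adjoin_incl[of J y] Cons.prems by auto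
  qed auto
  thus "J \<subseteq> adjoins J ys" "set ys \<subseteq> adjoins J ys" by auto
qed

lemma adjoins_least:
  assumes "ideal I R" "J \<subseteq> I" "set ys \<subseteq> I" shows "adjoins J ys \<subseteq> I"
  using assms by (induction ys arbitrary: J) (auto simp: adjoin_least)

text \<open>The contraction to \<open>R\<close> of the extension of \<open>J\<close> to the localization at \<open>M\<close>.\<close>

definition satur :: "'a set \<Rightarrow> 'a set \<Rightarrow> 'a set" where
  "satur M J = {r \<in> carrier R. \<exists>s \<in> carrier R - M. s \<otimes> r \<in> J}"

lemma saturI: "\<lbrakk> r \<in> carrier R; s \<in> carrier R; s \<notin> M; s \<otimes> r \<in> J \<rbrakk> \<Longrightarrow> r \<in> satur M J"
  unfolding satur_def by blast

lemma saturE: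
  assumes "r \<in> satur M J" obtains s where "r \<in> carrier R" "s \<in> carrier R" "s \<notin> M" "s \<otimes> r \<in> J"
  using assms unfolding satur_def by blast

lemma satur_mono: "J \<subseteq> J' \<Longrightarrow> satur M J \<subseteq> satur M J'"
  unfolding satur_def by blast

lemma primeideal_one: "primeideal M R \<Longrightarrow> \<one> \<notin> M"
  by (metis ideal.one_imp_carrier primeideal.I_notcarr primeideal.axioms(1))

lemma primeideal_mult:
  "\<lbrakk> primeideal M R; a \<in> carrier R; b \<in> carrier R; a \<notin> M; b \<notin> M \<rbrakk> \<Longrightarrow> a \<otimes> b \<notin> M"
  by (metis primeideal.I_prime)

lemma satur_ideal:
  assumes "primeideal M R" "ideal J R" shows "ideal (satur M J) R"
proof -
  note I = ideal_closed[OF assms(2)]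
  show ?thesis
  proof (intro idealI ring_axioms)
    show "subgroup (satur M J) (add_monoid R)"
    proof (rule add.subgroupI, goal_cases)
      case 1 show ?case unfolding satur_def by auto
      case 2 show ?case using primeideal_one[OF assms(1)] I(2) saturI[of \<zero> \<one> M J] by auto
    next
      case (3 a)
      then obtain s where s: "a \<in> carrier R" "s \<in> carrier R" "s \<notin> M" "s \<otimes> a \<in> J" by (elim saturE)
      have "s \<otimes> (\<ominus> a) = \<ominus> (s \<otimes> a)" using s by algebra
      thus ?case using s I(5) by (intro saturI[of _ s]) (auto simp: a_inv_def[symmetric])
    next
      case (4 a b)
      then obtain s t where s: "a \<in> carrier R" "s \<in> carrier R" "s \<notin> M" "s \<otimes> a \<in> J"
        and t: "b \<in> carrier R" "t \<in> carrier R" "t \<notin> M" "t \<otimes> b \<in> J" by (elim saturE)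
      have "(s \<otimes> t) \<otimes> (a \<oplus> b) = t \<otimes> (s \<otimes> a) \<oplus> s \<otimes> (t \<otimes> b)" using s t by algebra
      hence "(s \<otimes> t) \<otimes> (a \<oplus> b) \<in> J" using s t I by auto
      thus ?case using s t primeideal_mult[OF assms(1)] by (intro saturI[of _ "s \<otimes> t"]) auto
    qed
  next
    fix a x assume ax: "a \<in> satur M J" "x \<in> carrier R"
    then obtain s where s: "a \<in> carrier R" "s \<in> carrier R" "s \<notin> M" "s \<otimes> a \<in> J" by (elim saturE)
    have "s \<otimes> (x \<otimes> a) = x \<otimes> (s \<otimes> a)" using s ax(2) by algebra
    thus "x \<otimes> a \<in> satur M J" using s ax I by (intro saturI[of _ s]) auto
    thus "a \<otimes> x \<in> satur M J" using m_comm s ax by auto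
  qed
qed

lemma satur_incl:
  assumes "primeideal M R" "ideal J R" shows "J \<subseteq> satur M J"
proof
  fix r assume "r \<in> J"
  thus "r \<in> satur M J"
    using primeideal_one[OF assms(1)] ideal_closed(1)[OF assms(2)] by (intro saturI[of r \<one>]) auto
qed

lemma satur_satur:
  assumes "primeideal M R" "ideal J R" "s \<in> carrier R" "s \<notin> M" "r \<in> carrier R"
    "s \<otimes> r \<in> satur M J"
  shows "r \<in> satur M J"
proof -
  obtain t where t: "t \<in> carrier R" "t \<notin> M" "t \<otimes> (s \<otimes> r) \<in> J" using assms(6) by (elim saturE)
  have "(t \<otimes> s) \<otimes> r \<in> J" using t assms m_assoc by auto
  thus ?thesis using t assms primeideal_mult[OF assms(1)] by (intro saturI[of _ "t \<otimes> s"]) auto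
qed

lemma satur_subset_prime:
  assumes "primeideal Q R" "Q \<subseteq> M" "J \<subseteq> Q" shows "satur M J \<subseteq> Q"
  using assms primeideal.I_prime[OF assms(1)] by (auto elim!: saturE)

lemma satur_adjoinI:
  assumes "primeideal M R" "ideal J R" "r \<in> carrier R" "j \<in> satur M J" "c \<in> carrier R"
    "y \<in> carrier R" "r = j \<oplus> c \<otimes> y"
  shows "r \<in> satur M (adjoin J y)"
proof -
  obtain s where s: "j \<in> carrier R" "s \<in> carrier R" "s \<notin> M" "s \<otimes> j \<in> J" using assms(4) by (elim saturE)
  have "s \<otimes> r = s \<otimes> j \<oplus> (s \<otimes> c) \<otimes> y" using s assms(3,5,6,7) by algebra
  thus ?thesis using s assms by (intro saturI[of _ s] adjoinI) auto
qed

text \<open>Regular sequences in the localization at \<open>M\<close> of the quotient by \<open>J\<close>.\<close>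

primrec lreg :: "'a set \<Rightarrow> 'a set \<Rightarrow> 'a list \<Rightarrow> bool" where
  "lreg M J [] = True"
| "lreg M J (y # ys) \<longleftrightarrow>
     (\<forall>r \<in> carrier R. y \<otimes> r \<in> satur M J \<longrightarrow> r \<in> satur M J) \<and> lreg M (adjoin J y) ys"

lemma lreg_append:
  "lreg M J (xs @ ys) \<longleftrightarrow> lreg M J xs \<and> lreg M (adjoins J xs) ys"
  by (induction xs arbitrary: J) auto

end

section \<open>Noetherian induction and the construction of primes\<close>

context noetherian_ring
begin

text \<open>The union of a nonempty chain of ideals in a Noetherian ring is a member of the chain,
  so Zorn's lemma applies to an arbitrary predicate, without closure assumptions.\<close>

lemma exists_maximal_ideal:
  assumes "ideal I R" "P I"
  obtains J where "ideal J R" "I \<subseteq> J" "P J" "\<forall>J'. ideal J' R \<and> J \<subseteq> J' \<and> P J' \<longrightarrow> J' = J"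
proof -
  define F where "F = {J. ideal J R \<and> I \<subseteq> J \<and> P J}"
  have "\<exists>M \<in> F. \<forall>Y \<in> F. M \<subseteq> Y \<longrightarrow> Y = M"
  proof (rule subset_Zorn)
    fix C assume C: "subset.chain F C"
    show "\<exists>U \<in> F. \<forall>Y \<in> C. Y \<subseteq> U"
    proof (cases "C = {}")
      case True thus ?thesis using assms F_def by auto
    next
      case False
      have "subset.chain {I. ideal I R} C" using C unfolding pred_on.chain_def F_def by auto
      hence "\<Union>C \<in> C" using ideal_chain_is_trivial[OF False] by simp
      moreover have "C \<subseteq> F" using C unfolding pred_on.chain_def by simp
      ultimately show ?thesis by (intro bexI[of _ "\<Union>C"]) (auto simp: Union_upper)
    qed
  qed
  then obtain M where M: "M \<in> F" "\<And>Y. \<lbrakk> Y \<in> F; M \<subseteq> Y \<rbrakk> \<Longrightarrow> Y = M" by metis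
  show thesis
  proof (rule that[of M])
    show "ideal M R" "I \<subseteq> M" "P M" using M(1) F_def by auto
    show "\<forall>J'. ideal J' R \<and> M \<subseteq> J' \<and> P J' \<longrightarrow> J' = M"
      using \<open>I \<subseteq> M\<close> by (intro allI impI M(2)) (auto simp: F_def)
  qed
qed

lemma ideal_sequence_stabilizes:
  fixes f :: "nat \<Rightarrow> 'a set"
  assumes "\<And>n. ideal (f n) R" "\<And>n. f n \<subseteq> f (Suc n)"
  obtains n where "f (Suc n) = f n"
proof -
  obtain J where J: "ideal J R" "f 0 \<subseteq> J" "J \<in> range f"
      "\<forall>J'. ideal J' R \<and> J \<subseteq> J' \<and> J' \<in> range f \<longrightarrow> J' = J"
    by (rule exists_maximal_ideal[of "f 0" "\<lambda>J. J \<in> range f", OF assms(1) rangeI])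
  then obtain n where "J = f n" by auto
  thus thesis using that[of n] J(4)[rule_format, of "f (Suc n)"] assms by auto
qed

end

locale noetherian_cring = noetherian_ring R + cring R for R (structure)

text \<open>Let Q be maximal among the ideals that are not bad. If a b lies in Q with a and b
  outside, both enlargements of Q are bad, and the closure hypothesis makes Q bad. Two choices of
  \<open>bad\<close> below yield the primes of the dimension argument.\<close>

lemma (in noetherian_cring) exists_prime_not_bad:
  assumes "ideal I R" "\<not> bad I" "bad (carrier R)"
    and bad: "\<And>J a b. \<lbrakk> ideal J R; a \<in> carrier R; b \<in> carrier R; a \<otimes> b \<in> J;
      bad (adjoin J a); bad (adjoin J b) \<rbrakk> \<Longrightarrow> bad J"
  obtains Q where "primeideal Q R" "I \<subseteq> Q" "\<not> bad Q"
proof -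
  obtain Q where Q: "ideal Q R" "I \<subseteq> Q" "\<not> bad Q"
    and mx: "\<forall>J'. ideal J' R \<and> Q \<subseteq> J' \<and> \<not> bad J' \<longrightarrow> J' = Q"
    by (rule exists_maximal_ideal[of I "\<lambda>J. \<not> bad J", OF assms(1,2)])
  have "primeideal Q R"
  proof (rule primeidealI[OF Q(1) cring_axioms])
    show "carrier R \<noteq> Q" using Q(3) assms(3) by auto
    fix a b assume ab: "a \<in> carrier R" "b \<in> carrier R" "a \<otimes> b \<in> Q"
    show "a \<in> Q \<or> b \<in> Q"
    proof (rule ccontr)
      assume n: "\<not> (a \<in> Q \<or> b \<in> Q)"
      have "bad (adjoin Q c)" if "c \<in> carrier R" "c \<notin> Q" for c
        using mx[rule_format, of "adjoin Q c"] adjoin_ideal[OF Q(1) that(1)] adjoin_incl[OF Q(1) that(1)] that by blast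
      thus False using bad[OF Q(1) ab] n ab Q(3) by blast
    qed
  qed
  thus thesis using that Q by blast
qed

context noetherian_cring
begin

text \<open>As (J + Ra)(J + Rb) lies in J + Rab, this verifies the closure hypothesis of
  \<open>exists_prime_not_bad\<close> in both applications.\<close>

lemma adjoin_mult:
  assumes "ideal J R" "a \<in> carrier R" "b \<in> carrier R" "a \<otimes> b \<in> J" "u \<in> adjoin J a" "v \<in> adjoin J b"
  shows "u \<otimes> v \<in> J"
proof -
  note I = ideal_closed[OF assms(1)]
  obtain j c where 1: "j \<in> J" "c \<in> carrier R" "u = j \<oplus> c \<otimes> a" using assms(5) by (elim adjoinE)
  obtain i e where 2: "i \<in> J" "e \<in> carrier R" "v = i \<oplus> e \<otimes> b" using assms(6) by (elim adjoinE)
  have c: "j \<in> carrier R" "i \<in> carrier R" using 1 2 I by auto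
  have "u \<otimes> v = (j \<otimes> (i \<oplus> e \<otimes> b) \<oplus> (c \<otimes> a) \<otimes> i) \<oplus> (c \<otimes> e) \<otimes> (a \<otimes> b)"
    unfolding 1 2 using c 1(2) 2(2) assms(2,3) by algebra
  thus ?thesis using 1 2 c assms by (auto intro!: I(3-5) intro: I(6,7))
qed

definition nzd :: "'a set \<Rightarrow> 'a \<Rightarrow> bool" where
  "nzd I y \<longleftrightarrow> (\<forall>r \<in> carrier R. y \<otimes> r \<in> I \<longrightarrow> r \<in> I)"

lemma nzdD: "\<lbrakk> nzd I y; r \<in> carrier R; y \<otimes> r \<in> I \<rbrakk> \<Longrightarrow> r \<in> I"
  unfolding nzd_def by blast

lemma lreg_Cons: "lreg M J (y # ys) \<longleftrightarrow> nzd (satur M J) y \<and> lreg M (adjoin J y) ys"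
  unfolding nzd_def by simp

text \<open>Every \<open>r\<close> annihilated by \<open>b\<close> modulo \<open>J\<close> is locally \<open>a\<close> times another such element; Nakayama's
  lemma is replaced by choosing \<open>r\<close> such that the ideal generated by \<open>J\<close> and \<open>r\<close> is maximal.\<close>

lemma nzd_swap:
  assumes M: "primeideal M R" and J: "ideal J R" and a: "a \<in> M" and b: "b \<in> carrier R"
    and na: "nzd (satur M J) a" and nb: "nzd (satur M (adjoin J a)) b"
  shows "nzd (satur M J) b" "nzd (satur M (adjoin J b)) a"
proof -
  have ac: "a \<in> carrier R" using a M ideal_closed(1) primeideal.axioms(1) by blast
  define S where "S = satur M J"
  have S: "ideal S R" unfolding S_def by (rule satur_ideal[OF M J])
  note I = ideal_closed[OF S]
  have JS: "J \<subseteq> S" unfolding S_def by (rule satur_incl[OF M J])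
  note IM = ideal_closed[OF primeideal.axioms(1)[OF M]]
  define f where "f c = satur M (adjoin J c)" for c
  have fI: "ideal (f c) R" if "c \<in> carrier R" for c
    unfolding f_def by (intro satur_ideal M adjoin_ideal J that)
  have fin: "c \<in> f c" if "c \<in> carrier R" for c
    unfolding f_def using satur_incl[OF M adjoin_ideal[OF J that]] adjoin_incl[OF J that] by blast
  show b_nzd: "nzd (satur M J) b"
  proof (rule ccontr)
    assume "\<not> nzd (satur M J) b"
    then obtain z where z: "z \<in> carrier R" "z \<notin> S" "b \<otimes> z \<in> S" unfolding nzd_def S_def by blast
    obtain F where F: "ideal F R" "f z \<subseteq> F" "\<exists>c \<in> carrier R. c \<notin> S \<and> b \<otimes> c \<in> S \<and> F = f c"
      and mx: "\<forall>J'. ideal J' R \<and> F \<subseteq> J' \<and> (\<exists>c \<in> carrier R. c \<notin> S \<and> b \<otimes> c \<in> S \<and> J' = f c) \<longrightarrow> J' = F"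
      using z by (rule_tac exists_maximal_ideal[of "f z" "\<lambda>F. \<exists>c \<in> carrier R. c \<notin> S \<and> b \<otimes> c \<in> S \<and> F = f c", OF fI]) auto
    then obtain r where r: "r \<in> carrier R" "r \<notin> S" "b \<otimes> r \<in> S" "F = f r" by blast
    have "b \<otimes> r \<in> satur M (adjoin J a)"
      using r(3) satur_mono[OF adjoin_incl(1)[OF J ac]] unfolding S_def by blast
    hence "r \<in> satur M (adjoin J a)" using nzdD[OF nb r(1)] by blast
    then obtain s where s: "s \<in> carrier R" "s \<notin> M" "s \<otimes> r \<in> adjoin J a" by (elim saturE)
    then obtain j c where c: "j \<in> J" "c \<in> carrier R" "s \<otimes> r = j \<oplus> c \<otimes> a" by (elim adjoinE)
    have jc: "j \<in> carrier R" using c(1) J ideal_closed(1) by blast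
    \<comment> \<open>The aim is that b annihilates c modulo S, so that c competes with r for
      maximality; \<open>na\<close> cancels the factor a.\<close>
    have "a \<otimes> (b \<otimes> c) = s \<otimes> (b \<otimes> r) \<ominus> b \<otimes> j"
    proof -
      have "a \<otimes> (b \<otimes> c) = b \<otimes> (j \<oplus> c \<otimes> a) \<ominus> b \<otimes> j" using ac b c(2) jc by algebra
      also have "\<dots> = b \<otimes> (s \<otimes> r) \<ominus> b \<otimes> j" using c(3) by simp
      also have "\<dots> = s \<otimes> (b \<otimes> r) \<ominus> b \<otimes> j" using ac b jc s r by algebra
      finally show ?thesis .
    qed
    moreover have "\<dots> \<in> S" using s r c b jc JS by (auto intro!: I(3-5) intro: I(6,7))
    ultimately have "a \<otimes> (b \<otimes> c) \<in> S" by simp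
    hence bc: "b \<otimes> c \<in> S" using nzdD[OF na, of "b \<otimes> c"] b c(2) unfolding S_def by auto
    have sat: "x \<in> S" if "x \<in> carrier R" "t \<in> carrier R" "t \<notin> M" "t \<otimes> x \<in> S" for x t
      using satur_satur[OF M J that(2,3,1)] that(4) unfolding S_def by simp
    have cS: "c \<notin> S"
    proof
      assume "c \<in> S"
      hence "s \<otimes> r \<in> S" unfolding c(3) using c JS ac by (auto intro!: I(3-5) intro: I(6,7))
      thus False using sat[OF r(1) s(1,2)] r(2) by simp
    qed
    have "r \<in> f c"
      unfolding f_def
    proof (rule saturI[of r s])
      show "s \<otimes> r \<in> adjoin J c"
        using c ac m_comm by (intro adjoinI[of j J a]) auto
    qed (use r s in auto)
    have "adjoin J r \<subseteq> f c"
    proof (rule adjoin_least[OF fI[OF c(2)] _ \<open>r \<in> f c\<close>])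
      show "J \<subseteq> f c" unfolding f_def
        using satur_incl[OF M adjoin_ideal[OF J c(2)]] adjoin_incl[OF J c(2)] by blast
    qed
    hence "f r \<subseteq> f c"
      using satur_satur[OF M adjoin_ideal[OF J c(2)]] unfolding f_def by (auto elim!: saturE)
    hence "f c = f r" using mx fI[OF c(2)] c(2) cS bc r(4) by blast
    hence "c \<in> f r" using fin[OF c(2)] by simp
    then obtain t where t: "t \<in> carrier R" "t \<notin> M" "t \<otimes> c \<in> adjoin J r" unfolding f_def by (elim saturE)
    then obtain i e where e: "i \<in> J" "e \<in> carrier R" "t \<otimes> c = i \<oplus> e \<otimes> r" by (elim adjoinE)
    have ic: "i \<in> carrier R" using e(1) J ideal_closed(1) by blast
    \<comment> \<open>This eliminates r from t c = i + e r and s r = j + c a. The coefficient s t -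
      e a is outside M because a is in M, so it acts as a unit and forces c into S: the Nakayama
      step.\<close>
    have "(s \<otimes> t \<ominus> e \<otimes> a) \<otimes> c = s \<otimes> i \<oplus> e \<otimes> j"
    proof -
      have "(s \<otimes> t \<ominus> e \<otimes> a) \<otimes> c = s \<otimes> (t \<otimes> c) \<ominus> e \<otimes> (a \<otimes> c)"
        using s(1) t(1) e(2) c(2) ac by algebra
      also have "\<dots> = s \<otimes> i \<oplus> e \<otimes> (s \<otimes> r) \<ominus> e \<otimes> (a \<otimes> c)"
        unfolding e(3) using s(1) ic e(2) c(2) ac r(1) by (simp add: a_minus_def r_distr m_ac a_ac)
      also have "\<dots> = s \<otimes> i \<oplus> e \<otimes> j"
        unfolding c(3) using s(1) ic e(2) c(2) ac r(1) jc by algebra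
      finally show ?thesis .
    qed
    moreover have "\<dots> \<in> S" using s e jc ic c JS by (auto intro!: I(3-5) intro: I(6,7))
    moreover have "s \<otimes> t \<ominus> e \<otimes> a \<notin> M"
      using ideal_cancel(2)[OF primeideal.axioms(1)[OF M], of "s \<otimes> t" "e \<otimes> a"]
        primeideal_mult[OF M s(1) t(1) s(2) t(2)] s t e a IM by auto
    ultimately have "c \<in> S" using sat[of c "s \<otimes> t \<ominus> e \<otimes> a"] s t e ac c by auto
    thus False using cS by simp
  qed
  show "nzd (satur M (adjoin J b)) a"
    unfolding nzd_def
  proof (intro ballI impI)
    fix r assume r: "r \<in> carrier R" "a \<otimes> r \<in> satur M (adjoin J b)"
    then obtain s where s: "s \<in> carrier R" "s \<notin> M" "s \<otimes> (a \<otimes> r) \<in> adjoin J b" by (elim saturE)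
    then obtain j c where c: "j \<in> J" "c \<in> carrier R" "s \<otimes> (a \<otimes> r) = j \<oplus> c \<otimes> b" by (elim adjoinE)
    have jc: "j \<in> carrier R" using c(1) J ideal_closed(1) by blast
    \<comment> \<open>Read modulo (J, a), the relation says that b annihilates c, so regularity of b
      puts c locally into (J, a).\<close>
    have "b \<otimes> c = \<ominus> j \<oplus> (s \<otimes> r) \<otimes> a"
    proof -
      have "b \<otimes> c = (j \<oplus> c \<otimes> b) \<ominus> j" using b c(2) jc by algebra
      also have "\<dots> = s \<otimes> (a \<otimes> r) \<ominus> j" using c(3) by simp
      also have "\<dots> = \<ominus> j \<oplus> (s \<otimes> r) \<otimes> a" using s r ac jc by algebra
      finally show ?thesis .
    qed
    hence "b \<otimes> c \<in> adjoin J a"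
      using s r c(1) J ideal_closed by (intro adjoinI[of "\<ominus> j" J "s \<otimes> r"]) auto
    hence "b \<otimes> c \<in> satur M (adjoin J a)" using satur_incl[OF M adjoin_ideal[OF J ac]] by blast
    hence "c \<in> satur M (adjoin J a)" using nzdD[OF nb c(2)] by blast
    then obtain t where t: "t \<in> carrier R" "t \<notin> M" "t \<otimes> c \<in> adjoin J a" by (elim saturE)
    then obtain i e where e: "i \<in> J" "e \<in> carrier R" "t \<otimes> c = i \<oplus> e \<otimes> a" by (elim adjoinE)
    have ic: "i \<in> carrier R" using e(1) J ideal_closed(1) by blast
    \<comment> \<open>Inserting the expression for t c leaves a common factor a modulo S, which
      \<open>na\<close> cancels.\<close>
    have "a \<otimes> ((s \<otimes> t) \<otimes> r \<ominus> e \<otimes> b) = t \<otimes> j \<oplus> b \<otimes> i"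
    proof -
      have "a \<otimes> ((s \<otimes> t) \<otimes> r \<ominus> e \<otimes> b) = t \<otimes> (s \<otimes> (a \<otimes> r)) \<ominus> a \<otimes> (e \<otimes> b)"
        using s t e r b ac by algebra
      also have "\<dots> = t \<otimes> j \<oplus> b \<otimes> (t \<otimes> c) \<ominus> a \<otimes> (e \<otimes> b)"
        unfolding c(3) using t jc c(2) b ac e(2) by algebra
      also have "\<dots> = t \<otimes> j \<oplus> b \<otimes> i"
        unfolding e(3) using t jc ic c(2) b ac e(2) by algebra
      finally show ?thesis .
    qed
    moreover have "\<dots> \<in> S" using t c e b jc ic JS by (auto intro!: I(3-5) intro: I(6,7))
    ultimately have "(s \<otimes> t) \<otimes> r \<ominus> e \<otimes> b \<in> S"
      using nzdD[OF na, of "(s \<otimes> t) \<otimes> r \<ominus> e \<otimes> b"] s t r e b unfolding S_def by auto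
    hence "(s \<otimes> t) \<otimes> r \<in> satur M (adjoin J b)"
      unfolding S_def using s t r e b
      by (intro satur_adjoinI[OF M J, of _ "(s \<otimes> t) \<otimes> r \<ominus> e \<otimes> b" e]) (auto, algebra)
    thus "r \<in> satur M (adjoin J b)"
      using satur_satur[OF M adjoin_ideal[OF J b] _ _ r(1), of "s \<otimes> t"] s t primeideal_mult[OF M] by auto
  qed
qed

text \<open>Repeated use of \<open>nzd_swap\<close> carries x past the entries of ys, the last one
  first. Each entry that is passed must lie in M, whereas x may be any element of R.\<close>

lemma lreg_last_to_front:
  assumes "primeideal M R" "ideal J R" "set ys \<subseteq> M" "x \<in> carrier R" "lreg M J (ys @ [x])"
  shows "lreg M J (x # ys)"
  using assms(2,3,5)
proof (induction ys arbitrary: J)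
  case (Cons y ys)
  have y: "y \<in> M" "y \<in> carrier R"
    using Cons.prems(2) ideal_closed(1)[OF primeideal.axioms(1)[OF assms(1)]] by auto
  have 1: "nzd (satur M J) y" "lreg M (adjoin J y) (ys @ [x])" using Cons.prems(3) by (simp_all add: nzd_def)
  hence "lreg M (adjoin J y) (x # ys)" using Cons y by (intro Cons.IH adjoin_ideal) auto
  hence 2: "nzd (satur M (adjoin J y)) x" "lreg M (adjoin (adjoin J y) x) ys" by (simp_all add: nzd_def)
  note sw = nzd_swap[OF assms(1) Cons.prems(1) y(1) assms(4) 1(1) 2(1)]
  show ?case using sw 2 adjoin_commute[OF Cons.prems(1) y(2) assms(4)] by (simp add: lreg_Cons del: lreg.simps(2))
qed simp

text \<open>The chain is built downwards from Q: as the last entry x is regular modulo the ideal of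
  the earlier ones, some prime over that ideal inside Q misses x, and the induction continues below
  it.\<close>

lemma lreg_prime_chain:
  assumes M: "primeideal M R" and J: "ideal J R" and xs: "set xs \<subseteq> carrier R"
    and "primeideal Q R" "Q \<subseteq> M" "adjoins J xs \<subseteq> Q" "lreg M J xs"
  obtains P where "\<And>i. i \<le> length xs \<Longrightarrow> primeideal (P i) R"
    "\<And>i. i < length xs \<Longrightarrow> P i \<subset> P (Suc i)" "P (length xs) = Q"
proof -
  have "\<exists>P. (\<forall>i \<le> length xs. primeideal (P i) R) \<and> (\<forall>i < length xs. P i \<subset> P (Suc i)) \<and> P (length xs) = Q"
    using xs assms(4-7)
  proof (induction xs arbitrary: Q rule: rev_induct)
    case Nil thus ?case by (intro exI[of _ "\<lambda>_. Q"]) auto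
  next
    case (snoc x xs)
    note Q = snoc.prems(2)
    define I where "I = adjoins J xs"
    have x: "x \<in> carrier R" and I: "ideal I R" and nx: "nzd (satur M I) x" and lr: "lreg M J xs"
      using snoc.prems J by (auto simp: lreg_append I_def nzd_def intro!: adjoins_ideal)
    have "adjoin I x \<subseteq> Q" using snoc.prems by (simp add: I_def)
    hence IQ: "I \<subseteq> Q" "x \<in> Q" using adjoin_incl[OF I x] by auto
    \<comment> \<open>An ideal is bad when it meets the multiplicative set of all s x^k with s
      outside Q. A prime that is not bad therefore lies in Q and omits x.\<close>
    define bad where "bad J' \<longleftrightarrow> (\<exists>s \<in> carrier R - Q. \<exists>k::nat. s \<otimes> x [^] k \<in> J')" for J'
    obtain P where P: "primeideal P R" "I \<subseteq> P" "\<not> bad P"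
    proof (rule exists_prime_not_bad[OF I, of bad])
      show "\<not> bad I"
      proof
        assume "bad I"
        then obtain s k where s: "s \<in> carrier R" "s \<notin> Q" "s \<otimes> x [^] (k::nat) \<in> I" unfolding bad_def by blast
        hence "s \<otimes> x [^] k \<in> satur M I" using satur_incl[OF M I] by blast
        \<comment> \<open>The powers of x are cancelled one by one. Then s would lie in Q, because
          the contraction of I stays inside Q.\<close>
        hence "s \<in> satur M I"
        proof (induction k)
          case (Suc k)
          have "s \<otimes> x [^] Suc k = x \<otimes> (s \<otimes> x [^] k)" using s(1) x by (simp add: m_ac)
          thus ?case using Suc nzdD[OF nx, of "s \<otimes> x [^] k"] s(1) x by auto
        qed (use s in auto)
        thus False using satur_subset_prime[OF Q snoc.prems(3) IQ(1)] s(2) by blast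
      qed
      show "bad (carrier R)"
        unfolding bad_def using primeideal_one[OF Q] x by (intro bexI[of _ \<one>] exI[of _ 0]) auto
      fix J' a b assume J': "ideal J' R" "a \<in> carrier R" "b \<in> carrier R" "a \<otimes> b \<in> J'"
        "bad (adjoin J' a)" "bad (adjoin J' b)"
      then obtain s k t l where s: "s \<in> carrier R - Q" "s \<otimes> x [^] (k::nat) \<in> adjoin J' a"
        and t: "t \<in> carrier R - Q" "t \<otimes> x [^] (l::nat) \<in> adjoin J' b" unfolding bad_def by blast
      have "(s \<otimes> x [^] k) \<otimes> (t \<otimes> x [^] l) = (s \<otimes> t) \<otimes> x [^] (k + l)"
        using s(1) t(1) x by (simp add: nat_pow_mult[symmetric] m_ac)
      hence "(s \<otimes> t) \<otimes> x [^] (k + l) \<in> J'" using adjoin_mult[OF J'(1-4) s(2) t(2)] by simp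
      thus "bad J'" unfolding bad_def using s t primeideal_mult[OF Q]
        by (intro bexI[of _ "s \<otimes> t"] exI[of _ "k + l"]) auto
    qed
    note PC = ideal_closed[OF primeideal.axioms(1)[OF P(1)]]
    have "P \<subseteq> Q"
    proof
      fix p assume p: "p \<in> P"
      show "p \<in> Q"
      proof (rule ccontr)
        assume "p \<notin> Q"
        hence "bad P" unfolding bad_def using p PC by (intro bexI[of _ p] exI[of _ 0]) auto
        thus False using P(3) by simp
      qed
    qed
    moreover have "x \<notin> P"
    proof
      assume "x \<in> P"
      hence "bad P" unfolding bad_def using x primeideal_one[OF Q] by (intro bexI[of _ \<one>] exI[of _ 1]) auto
      thus False using P(3) by simp
    qed
    ultimately have PQ: "P \<subset> Q" using IQ(2) by blast
    have "\<exists>P'. (\<forall>i \<le> length xs. primeideal (P' i) R) \<and> (\<forall>i < length xs. P' i \<subset> P' (Suc i)) \<and> P' (length xs) = P"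
      using snoc.prems PQ P lr by (intro snoc.IH) (auto simp: I_def)
    then obtain P' where P': "\<forall>i \<le> length xs. primeideal (P' i) R" "\<forall>i < length xs. P' i \<subset> P' (Suc i)" "P' (length xs) = P"
      by blast
    define P'' where "P'' i = (if i \<le> length xs then P' i else Q)" for i
    show ?case
    proof (rule exI[of _ P''], intro conjI allI impI)
      show "primeideal (P'' i) R" for i using P' Q unfolding P''_def by auto
      show "P'' i \<subset> P'' (Suc i)" if "i < length (xs @ [x])" for i
        using that P' PQ unfolding P''_def by (cases "i = length xs") auto
    qed (auto simp: P''_def)
  qed
  thus thesis using that by blast
qed

text \<open>\<open>col m\<close> is the annihilator of the class of m in R/I. Finiteness: once
  \<open>m k\<close> lies in the ideal generated by I and the earlier \<open>m i\<close>, an element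
  of all earlier annihilators outside the k-th one would still annihilate \<open>m k\<close>.
  Covering: every annihilator of a nonzero class lies in a maximal one, and maximal ones are
  prime.\<close>

lemma finite_maximal_annihilators:
  assumes I: "ideal I R"
  defines "col \<equiv> \<lambda>m. {x \<in> carrier R. m \<otimes> x \<in> I}"
  defines "A \<equiv> {P. primeideal P R \<and> (\<exists>m \<in> carrier R - I. P = col m) \<and>
    (\<forall>m \<in> carrier R - I. P \<subseteq> col m \<longrightarrow> col m = P)}"
  shows "finite A" "\<And>x r. \<lbrakk> x \<in> carrier R; r \<in> carrier R; r \<notin> I; x \<otimes> r \<in> I \<rbrakk> \<Longrightarrow> \<exists>P \<in> A. x \<in> P"
proof -
  note IC = ideal_closed[OF I]
  have colI: "ideal (col m) R" if "m \<in> carrier R" for m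
    unfolding col_def by (rule ideal.helper_max_prime[OF I cring_axioms that])
  show "finite A"
  proof (rule ccontr)
    assume "infinite A"
    then obtain p :: "nat \<Rightarrow> 'a set" where p: "inj p" "range p \<subseteq> A" using infinite_countable_subset by blast
    hence "\<forall>k. \<exists>m \<in> carrier R - I. p k = col m" unfolding A_def by blast
    then obtain m where m: "\<And>k. m k \<in> carrier R - I" "\<And>k. p k = col (m k)" by metis
    have pr: "primeideal (p k) R" for k using p unfolding A_def by auto
    \<comment> \<open>Maximality makes distinct members incomparable, so the element z below can
      avoid the k-th prime.\<close>
    have inc: "i = k" if "p i \<subseteq> p k" for i k
    proof -
      have "p i \<in> A" using p by auto
      hence "p k = p i" using that m[of k] unfolding A_def by auto
      thus ?thesis using p(1) by (metis injD)
    qed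
    define f where "f k = adjoins I (map m [0..<k])" for k
    have ms: "set (map m [0..<k]) \<subseteq> carrier R" for k using m by auto
    have fI: "ideal (f k) R" for k unfolding f_def by (intro adjoins_ideal I ms)
    have fS: "f (Suc k) = adjoin (f k) (m k)" for k unfolding f_def by simp
    obtain k where "f (Suc k) = f k"
      using ideal_sequence_stabilizes[of f] fI adjoin_incl(1)[OF fI] m(1) fS by (metis DiffD1)
    hence mk: "m k \<in> f k" using adjoin_incl(2)[OF fI, of "m k" k] m(1) fS by auto
    \<comment> \<open>The witness is a product of elements of \<open>p i\<close> outside
      \<open>p k\<close>, one for each i < n.\<close>
    have "\<exists>z \<in> carrier R. z \<notin> p k \<and> (\<forall>i < n. z \<in> p i)" if "n \<le> k" for n
      using that
    proof (induction n)
      case 0 thus ?case using primeideal_one[OF pr] by auto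
    next
      case (Suc n)
      then obtain z where z: "z \<in> carrier R" "z \<notin> p k" "\<forall>i < n. z \<in> p i" by auto
      have "\<not> p n \<subseteq> p k" using inc[of n k] Suc.prems by auto
      then obtain w where w: "w \<in> p n" "w \<notin> p k" by blast
      have wc: "w \<in> carrier R" using w ideal_closed(1)[OF primeideal.axioms(1)[OF pr]] by blast
      have "z \<otimes> w \<in> p i" if "i < Suc n" for i
        using ideal_closed(6,7)[OF primeideal.axioms(1)[OF pr, of i]] that z w wc by (cases "i = n") auto
      thus ?case using primeideal_mult[OF pr z(1) wc z(2) w(2)] z wc by (intro bexI[of _ "z \<otimes> w"]) auto
    qed
    then obtain z where z: "z \<in> carrier R" "z \<notin> p k" "\<forall>i < k. z \<in> p i" by blast
    have "f k \<subseteq> col z"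
      unfolding f_def
    proof (rule adjoins_least[OF colI[OF z(1)]])
      show "I \<subseteq> col z" unfolding col_def using IC z by auto
      have "m i \<in> col z" if "i < k" for i
      proof -
        have "z \<in> col (m i)" using z(3) m(2) that by auto
        thus ?thesis unfolding col_def using m(1)[of i] z(1) m_comm by auto
      qed
      thus "set (map m [0..<k]) \<subseteq> col z" by auto
    qed
    hence "z \<in> col (m k)" using mk m(1)[of k] z(1) m_comm unfolding col_def by auto
    thus False using z(2) m(2) by auto
  qed
  fix x r assume x: "x \<in> carrier R" and r: "r \<in> carrier R" "r \<notin> I" "x \<otimes> r \<in> I"
  obtain P where P: "ideal P R" "col r \<subseteq> P" "\<exists>m \<in> carrier R - I. P = col m"
    and mx: "\<forall>J'. ideal J' R \<and> P \<subseteq> J' \<and> (\<exists>m \<in> carrier R - I. J' = col m) \<longrightarrow> J' = P"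
    using r by (rule_tac exists_maximal_ideal[of "col r" "\<lambda>P. \<exists>m \<in> carrier R - I. P = col m", OF colI]) auto
  then obtain m where m: "m \<in> carrier R" "m \<notin> I" "P = col m" by blast
  have mx': "col n = P" if "n \<in> carrier R - I" "P \<subseteq> col n" for n
    using mx that colI by blast
  have "primeideal P R"
  proof (rule primeidealI[OF P(1) cring_axioms])
    have "\<one> \<notin> col m" using m unfolding col_def by simp
    thus "carrier R \<noteq> P" using m(3) by auto
    fix a b assume ab: "a \<in> carrier R" "b \<in> carrier R" "a \<otimes> b \<in> P"
    show "a \<in> P \<or> b \<in> P"
    proof (rule disjCI)
      assume "b \<notin> P"
      hence mb: "m \<otimes> b \<in> carrier R - I" using m ab unfolding col_def by auto
      have "y \<in> col (m \<otimes> b)" if "y \<in> col m" for y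
      proof -
        have y: "y \<in> carrier R" "m \<otimes> y \<in> I" using that unfolding col_def by auto
        have "(m \<otimes> b) \<otimes> y = b \<otimes> (m \<otimes> y)" using m ab y by algebra
        thus ?thesis unfolding col_def using y IC ab by auto
      qed
      hence "P = col (m \<otimes> b)" using mx'[OF mb] m(3) by blast
      moreover have "(m \<otimes> b) \<otimes> a = m \<otimes> (a \<otimes> b)" using m ab by algebra
      hence "a \<in> col (m \<otimes> b)" using ab m(3) unfolding col_def by auto
      ultimately show "a \<in> P" by simp
    qed
  qed
  hence "P \<in> A" unfolding A_def using m mx' by auto
  moreover have "x \<in> P" using P(2) x r m_comm unfolding col_def by auto
  ultimately show "\<exists>P \<in> A. x \<in> P" by blast
qed

lemma subspace_in_finite_union:
  assumes K: "subfield K R" "infinite K" and V: "V \<subseteq> carrier R" "V \<noteq> {}"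
    "\<And>u v c. \<lbrakk> u \<in> V; v \<in> V; c \<in> K \<rbrakk> \<Longrightarrow> v \<oplus> c \<otimes> u \<in> V"
    and "finite F" "\<And>W. W \<in> F \<Longrightarrow> ideal W R" "V \<subseteq> \<Union>F"
  shows "\<exists>W \<in> F. V \<subseteq> W"
  using assms(6-8)
proof (induction F)
  case (insert W F)
  note Kc = subfieldE(3)[OF K(1)]
  have W: "ideal W R" using insert.prems by auto
  show ?case
  proof (cases "V \<subseteq> W")
    case False
    then obtain v where v: "v \<in> V" "v \<notin> W" by blast
    have "V \<subseteq> \<Union>F"
    proof
      fix u assume u: "u \<in> V"
      show "u \<in> \<Union>F"
      proof (cases "u \<in> W")
        case True
        have "\<exists>Y \<in> F. v \<oplus> c \<otimes> u \<in> Y" if c: "c \<in> K" for c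
        proof -
          have cW: "c \<otimes> u \<in> W" using True ideal_closed(6)[OF W] Kc c by auto
          have "v \<oplus> c \<otimes> u \<notin> W" using ideal_cancel(1)[OF W _ cW, of v] v V(1) by auto
          thus ?thesis using V(3)[OF u v(1) c] insert.prems(2) by auto
        qed
        then obtain Y where Y: "\<And>c. c \<in> K \<Longrightarrow> Y c \<in> F" "\<And>c. c \<in> K \<Longrightarrow> v \<oplus> c \<otimes> u \<in> Y c" by metis
        have "finite (Y ` K)" using Y(1) insert.hyps(1) by (meson finite_subset image_subsetI)
        then obtain c0 where c0: "c0 \<in> K" "infinite {c \<in> K. Y c = Y c0}"
          using pigeonhole_infinite[OF K(2)] by blast
        have "{c \<in> K. Y c = Y c0} \<noteq> {c0}" using c0(2) by (metis finite.emptyI finite.insertI)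
        then obtain c where c: "c \<in> K" "Y c = Y c0" "c \<noteq> c0" using c0 by blast
        have I: "ideal (Y c0) R" using insert.prems(1) Y(1)[OF c0(1)] by auto
        note IC = ideal_closed[OF I]
        have cc: "c \<in> carrier R" "c0 \<in> carrier R" "u \<in> carrier R" "v \<in> carrier R" using Kc c c0 u v V by auto
        have d: "c \<ominus> c0 \<in> K - {\<zero>}"
        proof -
          have "c \<ominus> c0 \<in> K"
            using subringE(5,7)[OF subfieldE(1)[OF K(1)]] c(1) c0(1) by (simp add: a_minus_def)
          thus ?thesis using c(3) cc r_right_minus_eq by auto
        qed
        have "(v \<oplus> c \<otimes> u) \<ominus> (v \<oplus> c0 \<otimes> u) = (c \<ominus> c0) \<otimes> u" using cc by algebra
        hence "(c \<ominus> c0) \<otimes> u \<in> Y c0" using IC(4)[of "v \<oplus> c \<otimes> u" "v \<oplus> c0 \<otimes> u"] Y(2)[OF c(1)] Y(2)[OF c0(1)] c(2) by auto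
        moreover have iv: "inv (c \<ominus> c0) \<in> carrier R" "inv (c \<ominus> c0) \<otimes> (c \<ominus> c0) = \<one>"
          using subfield_m_inv[OF K(1) d] Kc by auto
        ultimately have "inv (c \<ominus> c0) \<otimes> ((c \<ominus> c0) \<otimes> u) \<in> Y c0" using IC by auto
        moreover have "inv (c \<ominus> c0) \<otimes> ((c \<ominus> c0) \<otimes> u) = u"
          using iv cc by (simp add: m_assoc[symmetric])
        ultimately show ?thesis using Y(1)[OF c0(1)] by auto
      qed (use u insert.prems in auto)
    qed
    thus ?thesis using insert by auto
  qed auto
qed (use V in auto)

text \<open>If all of V consisted of zero divisors modulo I, it would lie in a single annihilator
  \<open>col m\<close>. Then a power of y would annihilate m modulo I, which is impossible for a
  nonzerodivisor y.\<close>

lemma exists_nzd_in_subspace: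
  assumes K: "subfield K R" "infinite K" and V: "V \<subseteq> carrier R" "V \<noteq> {}"
    "\<And>u v c. \<lbrakk> u \<in> V; v \<in> V; c \<in> K \<rbrakk> \<Longrightarrow> v \<oplus> c \<otimes> u \<in> V"
    and I: "ideal I R" and y: "y \<in> carrier R" "nzd I y" "y [^] (n::nat) \<in> Idl V"
  shows "\<exists>x \<in> V. nzd I x"
proof (rule ccontr)
  assume no: "\<not> ?thesis"
  define col where "col m = {x \<in> carrier R. m \<otimes> x \<in> I}" for m
  define A where "A = {P. primeideal P R \<and> (\<exists>m \<in> carrier R - I. P = col m) \<and>
    (\<forall>m \<in> carrier R - I. P \<subseteq> col m \<longrightarrow> col m = P)}"
  note fma = finite_maximal_annihilators[OF I, folded col_def, folded A_def]
  have "V \<subseteq> \<Union>A"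
  proof
    fix x assume x: "x \<in> V"
    then obtain r where "r \<in> carrier R" "r \<notin> I" "x \<otimes> r \<in> I" using no unfolding nzd_def by blast
    thus "x \<in> \<Union>A" using fma(2)[of x r] x V(1) by blast
  qed
  hence "\<exists>P \<in> A. V \<subseteq> P"
    by (intro subspace_in_finite_union[OF K V fma(1)]) (auto simp: A_def dest: primeideal.axioms(1))
  then obtain P where P: "P \<in> A" "V \<subseteq> P" by blast
  from P(1) obtain m where m: "m \<in> carrier R" "m \<notin> I" "P = col m" and "primeideal P R"
    unfolding A_def by auto
  hence PI: "ideal P R" by (intro primeideal.axioms(1))
  have "y [^] n \<in> col m" using genideal_minimal[OF PI P(2)] y(3) m(3) by blast
  hence "y [^] n \<otimes> m \<in> I" using m y m_comm unfolding col_def by auto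
  hence "m \<in> I"
  proof (induction n)
    case (Suc n)
    have "y [^] Suc n \<otimes> m = y \<otimes> (y [^] n \<otimes> m)" using y(1) m(1) by (simp add: m_ac)
    thus ?case using Suc nzdD[OF y(2), of "y [^] n \<otimes> m"] y(1) m(1) by auto
  qed (use m in auto)
  thus False using m(2) by simp
qed

text \<open>The last element is replaced by a nonzerodivisor in \<open>V\<close>, which is moved to the front and divided out.\<close>

lemma lreg_in_subspace:
  assumes K: "subfield K R" "infinite K" and V: "V \<subseteq> carrier R" "V \<noteq> {}"
    "\<And>u v c. \<lbrakk> u \<in> V; v \<in> V; c \<in> K \<rbrakk> \<Longrightarrow> v \<oplus> c \<otimes> u \<in> V"
    and M: "primeideal M R" and nil: "\<And>y. y \<in> M \<Longrightarrow> \<exists>n::nat. y [^] n \<in> Idl V"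
    and "ideal J R" "set ys \<subseteq> M" "lreg M J ys"
  shows "\<exists>xs. set xs \<subseteq> V \<and> length xs = length ys \<and> lreg M J xs"
  using assms(8-10)
proof (induction "length ys" arbitrary: J ys)
  case (Suc n)
  note Mc = ideal_closed(1)[OF primeideal.axioms(1)[OF M]]
  obtain zs y where zs: "ys = zs @ [y]" using Suc.hyps(2) by (cases ys rule: rev_cases) auto
  have y: "y \<in> M" "y \<in> carrier R" and zsM: "set zs \<subseteq> M" "set zs \<subseteq> carrier R"
    using Suc.prems(2) Mc unfolding zs by auto
  define I where "I = adjoins J zs"
  have I: "ideal I R" unfolding I_def by (intro adjoins_ideal Suc.prems zsM)
  have ly: "lreg M J zs" "nzd (satur M I) y"
    using Suc.prems(3) unfolding zs lreg_append lreg_Cons I_def by auto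
  obtain k :: nat where k: "y [^] k \<in> Idl V" using nil[OF y(1)] by blast
  obtain x where x: "x \<in> V" "nzd (satur M I) x"
    using exists_nzd_in_subspace[OF K V satur_ideal[OF M I] y(2) ly(2) k] by blast
  have xc: "x \<in> carrier R" using x V by auto
  have "lreg M J (zs @ [x])" using ly x unfolding lreg_append lreg_Cons I_def by auto
  \<comment> \<open>With x in front it stays as first entry, and the shorter sequence zs modulo (J,
    x) is left to the induction.\<close>
  hence 1: "lreg M J (x # zs)" by (rule lreg_last_to_front[OF M Suc.prems(1) zsM(1) xc])
  have "\<exists>xs. set xs \<subseteq> V \<and> length xs = length zs \<and> lreg M (adjoin J x) xs"
    using Suc.hyps(2) zs zsM 1 xc Suc.prems(1) by (intro Suc.hyps(1)) (auto simp: adjoin_ideal)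
  then obtain xs where "set xs \<subseteq> V" "length xs = length zs" "lreg M (adjoin J x) xs" by blast
  thus ?case using 1 x(1) zs by (intro exI[of _ "x # xs"]) auto
qed auto

end

section \<open>Localization of a domain at a prime ideal\<close>

text \<open>Recasts the recursion in the indexed form used by
  \<open>regular_sequence\<close>.\<close>

lemma (in cring) lreg_iff_nth:
  "lreg M J ys \<longleftrightarrow> (\<forall>i < length ys. \<forall>r \<in> carrier R.
     ys ! i \<otimes> r \<in> satur M (adjoins J (take i ys)) \<longrightarrow> r \<in> satur M (adjoins J (take i ys)))"
proof (induction ys arbitrary: J)
  case (Cons y ys)
  show ?case unfolding lreg.simps Cons.IH by (auto simp: less_Suc_eq_0_disj)
qed simp

locale domain_at_prime = domain R for R (structure) +
  fixes M assumes M: "primeideal M R"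
begin

abbreviation S where "S \<equiv> carrier R - M"
abbreviation fr where "fr \<equiv> fraction R S"
abbreviation L where "L \<equiv> localization_at R M"

lemma S_one: "\<one> \<in> S" using primeideal_one[OF M] by simp

lemma S_mult: "\<lbrakk> s \<in> S; t \<in> S \<rbrakk> \<Longrightarrow> s \<otimes> t \<in> S" using primeideal_mult[OF M] by auto

lemma S_nonzero: "s \<in> S \<Longrightarrow> s \<noteq> \<zero>" using ideal_closed(2)[OF primeideal.axioms(1)[OF M]] by auto

lemma S_carrier: "s \<in> S \<Longrightarrow> s \<in> carrier R" by simp

text \<open>In a domain the auxiliary factor u of \<open>fraction\<close> cancels, as elements
  outside M are nonzero.\<close>

lemma fr_eq_set:
  assumes "a \<in> carrier R" "s \<in> S"
  shows "fr a s = {(b, t). b \<in> carrier R \<and> t \<in> S \<and> a \<otimes> t = b \<otimes> s}"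
proof -
  have "(\<exists>u \<in> S. u \<otimes> (a \<otimes> t \<ominus> b \<otimes> s) = \<zero>) \<longleftrightarrow> a \<otimes> t = b \<otimes> s" if "b \<in> carrier R" "t \<in> S" for b t
  proof
    assume "\<exists>u \<in> S. u \<otimes> (a \<otimes> t \<ominus> b \<otimes> s) = \<zero>"
    then obtain u where u: "u \<in> S" "u \<otimes> (a \<otimes> t \<ominus> b \<otimes> s) = \<zero>" by blast
    hence "a \<otimes> t \<ominus> b \<otimes> s = \<zero>" using integral[OF u(2)] S_nonzero[OF u(1)] assms that by auto
    thus "a \<otimes> t = b \<otimes> s" using assms that by auto
  next
    assume "a \<otimes> t = b \<otimes> s"
    hence "\<one> \<otimes> (a \<otimes> t \<ominus> b \<otimes> s) = \<zero>" using assms that by (simp add: r_right_minus_eq)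
    thus "\<exists>u \<in> S. u \<otimes> (a \<otimes> t \<ominus> b \<otimes> s) = \<zero>" using S_one by blast
  qed
  thus ?thesis unfolding fraction_def by blast
qed

lemma fr_eq_iff:
  assumes "a \<in> carrier R" "s \<in> S" "b \<in> carrier R" "t \<in> S"
  shows "fr a s = fr b t \<longleftrightarrow> a \<otimes> t = b \<otimes> s"
proof
  have "(b, t) \<in> fr b t" using assms by (auto simp: fr_eq_set)
  moreover assume "fr a s = fr b t"
  ultimately have "(b, t) \<in> fr a s" by simp
  thus "a \<otimes> t = b \<otimes> s" using assms(1,2) by (auto simp: fr_eq_set)
next
  have *: "c \<otimes> t' = b \<otimes> u"
    if "a \<in> carrier R" "s \<in> S" "b \<in> carrier R" "t' \<in> S" "c \<in> carrier R" "u \<in> S" "a \<otimes> t' = b \<otimes> s" "a \<otimes> u = c \<otimes> s" for a s b t' c u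
  proof -
    have "s \<otimes> (c \<otimes> t') = (c \<otimes> s) \<otimes> t'" using that by (simp add: m_ac)
    also have "\<dots> = (a \<otimes> t') \<otimes> u" unfolding that(8)[symmetric] using that(1-6) by (simp add: m_ac)
    also have "\<dots> = s \<otimes> (b \<otimes> u)" unfolding that(7) using that(1-6) by (simp add: m_ac)
    finally show ?thesis using m_lcancel[OF S_nonzero[OF that(2)]] that(1-6) by auto
  qed
  assume e: "a \<otimes> t = b \<otimes> s"
  have "a \<otimes> u = c \<otimes> s \<longleftrightarrow> b \<otimes> u = c \<otimes> t" if "c \<in> carrier R" "u \<in> S" for c u
  proof
    assume "a \<otimes> u = c \<otimes> s" from *[OF assms that e this] show "b \<otimes> u = c \<otimes> t" by simp
  next
    assume "b \<otimes> u = c \<otimes> t" from *[OF assms(3,4,1,2) that e[symmetric] this] show "a \<otimes> u = c \<otimes> s" by simp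
  qed
  thus "fr a s = fr b t" unfolding fr_eq_set[OF assms(1,2)] fr_eq_set[OF assms(3,4)] by auto
qed

lemma fr_self: "\<lbrakk> a \<in> carrier R; s \<in> S \<rbrakk> \<Longrightarrow> (a, s) \<in> fr a s"
  by (auto simp: fr_eq_set)

lemma L_carrier: "carrier L = {fr a s | a s. a \<in> carrier R \<and> s \<in> S}"
  by (simp add: localization_at_def localization_def)

lemma L_carrierE:
  assumes "x \<in> carrier L" obtains a s where "a \<in> carrier R" "s \<in> S" "x = fr a s"
  using assms unfolding L_carrier by blast

lemma fr_in_L: "\<lbrakk> a \<in> carrier R; s \<in> S \<rbrakk> \<Longrightarrow> fr a s \<in> carrier L"
  unfolding L_carrier by blast

lemma L_one: "\<one>\<^bsub>L\<^esub> = fr \<one> \<one>" and L_zero: "\<zero>\<^bsub>L\<^esub> = fr \<zero> \<one>"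
  by (simp_all add: localization_at_def localization_def)

text \<open>The operations of \<open>localization\<close> are unions over all representatives. When
  each contributes the same set, the union over a nonempty family is this set.\<close>

lemma fr_Union:
  assumes "a \<in> carrier R" "s \<in> S" "b \<in> carrier R" "t \<in> S"
    and "\<And>a' s' b' t'. \<lbrakk> a' \<in> carrier R; s' \<in> S; b' \<in> carrier R; t' \<in> S;
      a \<otimes> s' = a' \<otimes> s; b \<otimes> t' = b' \<otimes> t \<rbrakk> \<Longrightarrow> F a' s' b' t' = F a s b t"
  shows "(\<Union>(a', s') \<in> fr a s. \<Union>(b', t') \<in> fr b t. F a' s' b' t') = F a s b t"
proof -
  have "F a' s' b' t' = F a s b t" if "(a', s') \<in> fr a s" "(b', t') \<in> fr b t" for a' s' b' t'
    using that assms(5)[of a' s' b' t'] unfolding fr_eq_set[OF assms(1,2)] fr_eq_set[OF assms(3,4)] by auto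
  note eq = this
  show ?thesis
  proof (rule Set.set_eqI, rule iffI)
    fix x assume "x \<in> (\<Union>(a', s') \<in> fr a s. \<Union>(b', t') \<in> fr b t. F a' s' b' t')"
    then obtain a' s' b' t' where "(a', s') \<in> fr a s" "(b', t') \<in> fr b t" "x \<in> F a' s' b' t'" by auto
    thus "x \<in> F a s b t" using eq by simp
  next
    fix x assume "x \<in> F a s b t"
    hence 1: "x \<in> (\<Union>(b', t') \<in> fr b t. F a s b' t')"
      by (intro UN_I[of "(b, t)"] fr_self assms(3,4)) (simp only: prod.case)
    show "x \<in> (\<Union>(a', s') \<in> fr a s. \<Union>(b', t') \<in> fr b t. F a' s' b' t')"
      by (intro UN_I[of "(a, s)"] fr_self assms(1,2)) (simp only: prod.case 1)
  qed
qed

lemma L_mult: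
  assumes "a \<in> carrier R" "s \<in> S" "b \<in> carrier R" "t \<in> S"
  shows "fr a s \<otimes>\<^bsub>L\<^esub> fr b t = fr (a \<otimes> b) (s \<otimes> t)"
proof -
  have "(\<Union>(a', s') \<in> fr a s. \<Union>(b', t') \<in> fr b t. fr (a' \<otimes> b') (s' \<otimes> t')) = fr (a \<otimes> b) (s \<otimes> t)"
  proof (rule fr_Union[OF assms])
    fix a' s' b' t' assume h: "a' \<in> carrier R" "s' \<in> S" "b' \<in> carrier R" "t' \<in> S"
      "a \<otimes> s' = a' \<otimes> s" "b \<otimes> t' = b' \<otimes> t"
    have "(a' \<otimes> b') \<otimes> (s \<otimes> t) = (a' \<otimes> s) \<otimes> (b' \<otimes> t)" using h(1-4) assms by (simp add: m_ac)
    also have "\<dots> = (a \<otimes> b) \<otimes> (s' \<otimes> t')" unfolding h(5,6)[symmetric] using h(1-4) assms by (simp add: m_ac)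
    finally show "fr (a' \<otimes> b') (s' \<otimes> t') = fr (a \<otimes> b) (s \<otimes> t)"
      using h(1-4) assms S_mult by (subst fr_eq_iff) auto
  qed
  thus ?thesis by (simp add: localization_at_def localization_def)
qed

lemma L_add:
  assumes "a \<in> carrier R" "s \<in> S" "b \<in> carrier R" "t \<in> S"
  shows "fr a s \<oplus>\<^bsub>L\<^esub> fr b t = fr (a \<otimes> t \<oplus> b \<otimes> s) (s \<otimes> t)"
proof -
  have "(\<Union>(a', s') \<in> fr a s. \<Union>(b', t') \<in> fr b t. fr (a' \<otimes> t' \<oplus> b' \<otimes> s') (s' \<otimes> t')) = fr (a \<otimes> t \<oplus> b \<otimes> s) (s \<otimes> t)"
  proof (rule fr_Union[OF assms])
    fix a' s' b' t' assume h: "a' \<in> carrier R" "s' \<in> S" "b' \<in> carrier R" "t' \<in> S"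
      "a \<otimes> s' = a' \<otimes> s" "b \<otimes> t' = b' \<otimes> t"
    have "(a' \<otimes> t' \<oplus> b' \<otimes> s') \<otimes> (s \<otimes> t) = (a' \<otimes> s) \<otimes> (t \<otimes> t') \<oplus> (b' \<otimes> t) \<otimes> (s \<otimes> s')"
      using h(1-4) assms by (simp add: l_distr r_distr m_ac)
    also have "\<dots> = (a \<otimes> t \<oplus> b \<otimes> s) \<otimes> (s' \<otimes> t')"
      unfolding h(5,6)[symmetric] using h(1-4) assms by (simp add: l_distr r_distr m_ac)
    finally show "fr (a' \<otimes> t' \<oplus> b' \<otimes> s') (s' \<otimes> t') = fr (a \<otimes> t \<oplus> b \<otimes> s) (s \<otimes> t)"
      using h(1-4) assms S_mult by (subst fr_eq_iff) auto
  qed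
  thus ?thesis by (simp add: localization_at_def localization_def)
qed

lemma fr_cancel:
  assumes "a \<in> carrier R" "s \<in> S" "t \<in> S" shows "fr (a \<otimes> t) (s \<otimes> t) = fr a s"
  using assms S_mult by (subst fr_eq_iff) (auto simp: m_ac)

lemma L_cring: "cring L"
proof (rule cringI)
  show "abelian_group L"
  proof (rule abelian_groupI)
    fix x y assume "x \<in> carrier L" "y \<in> carrier L"
    then obtain a s b t where h: "a \<in> carrier R" "s \<in> S" "b \<in> carrier R" "t \<in> S" "x = fr a s" "y = fr b t"
      by (auto elim!: L_carrierE)
    show "x \<oplus>\<^bsub>L\<^esub> y \<in> carrier L" unfolding h(5,6) L_add[OF h(1-4)] using h S_mult by (intro fr_in_L) auto
    show "x \<oplus>\<^bsub>L\<^esub> y = y \<oplus>\<^bsub>L\<^esub> x"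
      unfolding h(5,6) L_add[OF h(1-4)] L_add[OF h(3,4,1,2)] using h(1-4) by (simp add: a_comm m_comm)
    fix z assume "z \<in> carrier L"
    then obtain c u where k: "c \<in> carrier R" "u \<in> S" "z = fr c u" by (auto elim!: L_carrierE)
    show "x \<oplus>\<^bsub>L\<^esub> y \<oplus>\<^bsub>L\<^esub> z = x \<oplus>\<^bsub>L\<^esub> (y \<oplus>\<^bsub>L\<^esub> z)"
      unfolding h(5,6) k(3) using h(1-4) k(1,2) S_mult S_carrier
      by (simp add: L_add l_distr r_distr m_ac a_ac del: Diff_iff)
  next
    show "\<zero>\<^bsub>L\<^esub> \<in> carrier L" unfolding L_zero using S_one by (intro fr_in_L) auto
  next
    fix x assume "x \<in> carrier L"
    then obtain a s where h: "a \<in> carrier R" "s \<in> S" "x = fr a s" by (auto elim!: L_carrierE)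
    show "\<zero>\<^bsub>L\<^esub> \<oplus>\<^bsub>L\<^esub> x = x" unfolding L_zero h(3) using L_add[OF zero_closed S_one h(1,2)] h by simp
    show "\<exists>y \<in> carrier L. y \<oplus>\<^bsub>L\<^esub> x = \<zero>\<^bsub>L\<^esub>"
    proof (rule bexI[of _ "fr (\<ominus> a) s"])
      have "\<ominus> a \<otimes> s \<oplus> a \<otimes> s = \<zero>" using h(1,2) by (simp add: l_minus l_neg)
      thus "fr (\<ominus> a) s \<oplus>\<^bsub>L\<^esub> x = \<zero>\<^bsub>L\<^esub>"
        unfolding h(3) L_zero using L_add[of "\<ominus> a" s a s] h(1,2) S_mult S_one by (simp add: fr_eq_iff)
    qed (use h in \<open>auto intro!: fr_in_L\<close>)
  qed
  show "comm_monoid L"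
  proof (rule comm_monoidI)
    fix x y assume "x \<in> carrier L" "y \<in> carrier L"
    then obtain a s b t where h: "a \<in> carrier R" "s \<in> S" "b \<in> carrier R" "t \<in> S" "x = fr a s" "y = fr b t"
      by (auto elim!: L_carrierE)
    show "x \<otimes>\<^bsub>L\<^esub> y \<in> carrier L" unfolding h(5,6) L_mult[OF h(1-4)] using h S_mult by (intro fr_in_L) auto
    show "x \<otimes>\<^bsub>L\<^esub> y = y \<otimes>\<^bsub>L\<^esub> x"
      unfolding h(5,6) L_mult[OF h(1-4)] L_mult[OF h(3,4,1,2)] using h(1-4) by (simp add: m_comm)
    fix z assume "z \<in> carrier L"
    then obtain c u where k: "c \<in> carrier R" "u \<in> S" "z = fr c u" by (auto elim!: L_carrierE)
    show "x \<otimes>\<^bsub>L\<^esub> y \<otimes>\<^bsub>L\<^esub> z = x \<otimes>\<^bsub>L\<^esub> (y \<otimes>\<^bsub>L\<^esub> z)"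
      unfolding h(5,6) k(3) using h(1-4) k(1,2) S_mult S_carrier by (simp add: L_mult m_ac del: Diff_iff)
  next
    show "\<one>\<^bsub>L\<^esub> \<in> carrier L" unfolding L_one using S_one by (intro fr_in_L) auto
  next
    fix x assume "x \<in> carrier L"
    then obtain a s where h: "a \<in> carrier R" "s \<in> S" "x = fr a s" by (auto elim!: L_carrierE)
    show "\<one>\<^bsub>L\<^esub> \<otimes>\<^bsub>L\<^esub> x = x" unfolding L_one h(3) using L_mult[OF one_closed S_one h(1,2)] h by simp
  qed
  fix x y z assume "x \<in> carrier L" "y \<in> carrier L" "z \<in> carrier L"
  then obtain a s b t c u where h: "a \<in> carrier R" "s \<in> S" "b \<in> carrier R" "t \<in> S" "c \<in> carrier R" "u \<in> S"
    "x = fr a s" "y = fr b t" "z = fr c u"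
    by (auto elim!: L_carrierE)
  have su: "s \<otimes> u \<in> S" "t \<otimes> u \<in> S" "s \<otimes> t \<in> S" using h S_mult by auto
  have "(x \<oplus>\<^bsub>L\<^esub> y) \<otimes>\<^bsub>L\<^esub> z = fr ((a \<otimes> t \<oplus> b \<otimes> s) \<otimes> c) ((s \<otimes> t) \<otimes> u)"
    unfolding h(7-9) L_add[OF h(1-4)] using h(1-6) su by (intro L_mult) auto
  \<comment> \<open>Enlarging the fraction by u turns the denominator s t u into (s u)(t u), as it
    appears on the right-hand side.\<close>
  also have "\<dots> = fr (((a \<otimes> t \<oplus> b \<otimes> s) \<otimes> c) \<otimes> u) (((s \<otimes> t) \<otimes> u) \<otimes> u)"
    using h(1-6) su S_mult by (intro fr_cancel[symmetric]) auto
  also have "\<dots> = fr ((a \<otimes> c) \<otimes> (t \<otimes> u) \<oplus> (b \<otimes> c) \<otimes> (s \<otimes> u)) ((s \<otimes> u) \<otimes> (t \<otimes> u))"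
    using h(1-6) by (simp add: l_distr r_distr m_ac)
  also have "\<dots> = fr (a \<otimes> c) (s \<otimes> u) \<oplus>\<^bsub>L\<^esub> fr (b \<otimes> c) (t \<otimes> u)"
    using h(1-6) su by (intro L_add[symmetric]) auto
  also have "\<dots> = x \<otimes>\<^bsub>L\<^esub> z \<oplus>\<^bsub>L\<^esub> y \<otimes>\<^bsub>L\<^esub> z" unfolding h(7-9) using h(1-6) by (simp add: L_mult)
  finally show "(x \<oplus>\<^bsub>L\<^esub> y) \<otimes>\<^bsub>L\<^esub> z = x \<otimes>\<^bsub>L\<^esub> z \<oplus>\<^bsub>L\<^esub> y \<otimes>\<^bsub>L\<^esub> z" .
qed

sublocale L: cring L by (rule L_cring)

lemma L_minus:
  assumes "a \<in> carrier R" "s \<in> S" shows "\<ominus>\<^bsub>L\<^esub> fr a s = fr (\<ominus> a) s"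
proof -
  have "\<ominus> a \<otimes> s \<oplus> a \<otimes> s = \<zero>" using assms by (simp add: l_minus l_neg)
  hence "fr (\<ominus> a) s \<oplus>\<^bsub>L\<^esub> fr a s = \<zero>\<^bsub>L\<^esub>"
    unfolding L_zero using L_add[of "\<ominus> a" s a s] assms S_mult S_one by (simp add: fr_eq_iff)
  thus ?thesis using assms by (intro L.minus_equality) (auto intro!: fr_in_L)
qed

text \<open>This is the extended ideal. Finite sums are absorbed by passing to a common
  denominator.\<close>

definition ext :: "'a set \<Rightarrow> ('a \<times> 'a) set set" where
  "ext J = {fr r s | r s. r \<in> J \<and> s \<in> S}"

text \<open>Membership of a fraction depends on its numerator alone, which moves questions about
  \<open>L\<close> back to \<open>R\<close>.\<close>

lemma fr_in_ext_iff:
  assumes J: "ideal J R" and "r \<in> carrier R" "s \<in> S"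
  shows "fr r s \<in> ext J \<longleftrightarrow> r \<in> satur M J"
proof
  assume "fr r s \<in> ext J"
  then obtain p t where p: "p \<in> J" "t \<in> S" "fr r s = fr p t" unfolding ext_def by blast
  have "r \<otimes> t = p \<otimes> s" using p assms ideal_closed(1)[OF J] by (simp add: fr_eq_iff)
  thus "r \<in> satur M J"
    using p assms ideal_closed[OF J] m_comm by (intro saturI[of r t]) auto
next
  assume "r \<in> satur M J"
  then obtain t where t: "t \<in> carrier R" "t \<notin> M" "t \<otimes> r \<in> J" by (elim saturE)
  have "fr r s = fr (t \<otimes> r) (t \<otimes> s)" using t assms S_mult[of t s] by (subst fr_eq_iff) (auto simp: m_ac)
  thus "fr r s \<in> ext J" unfolding ext_def using t assms S_mult[of t s] by auto
qed

lemma ext_ideal: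
  assumes J: "ideal J R" shows "ideal (ext J) L"
proof (rule idealI)
  note I = ideal_closed[OF J]
  show "ring L" by (rule L.ring_axioms)
  have in_ext: "fr r s \<in> ext J" if "r \<in> J" "s \<in> S" for r s using that unfolding ext_def by blast
  show "subgroup (ext J) (add_monoid L)"
  proof (rule L.add.subgroupI, goal_cases)
    case 1 show ?case unfolding ext_def using I(1) fr_in_L by auto
    case 2 show ?case using in_ext[OF I(2) S_one] by blast
  next
    case (3 x)
    then obtain r s where r: "r \<in> J" "s \<in> S" "x = fr r s" unfolding ext_def by blast
    show ?case unfolding a_inv_def[symmetric] r(3) L_minus[OF I(1)[OF r(1)] r(2)]
      by (rule in_ext[OF I(5)[OF r(1)] r(2)])
  next
    case (4 x y)
    then obtain r s r' s' where r: "r \<in> J" "s \<in> S" "x = fr r s" "r' \<in> J" "s' \<in> S" "y = fr r' s'"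
      unfolding ext_def by blast
    have "r \<otimes> s' \<oplus> r' \<otimes> s \<in> J" using r I by auto
    thus ?case using in_ext S_mult[OF r(2,5)] L_add[OF I(1)[OF r(1)] r(2) I(1)[OF r(4)] r(5)] r by simp
  qed
  fix x y assume x: "x \<in> ext J" "y \<in> carrier L"
  then obtain r s b t where r: "r \<in> J" "s \<in> S" "x = fr r s" "b \<in> carrier R" "t \<in> S" "y = fr b t"
    unfolding ext_def by (auto elim!: L_carrierE)
  have "b \<otimes> r \<in> J" using r I by auto
  thus "y \<otimes>\<^bsub>L\<^esub> x \<in> ext J"
    using in_ext S_mult[OF r(5,2)] L_mult[OF r(4,5) I(1)[OF r(1)] r(2)] r by simp
  thus "x \<otimes>\<^bsub>L\<^esub> y \<in> ext J" using L.m_comm x(2) r I(1) fr_in_L by auto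
qed

lemma satur_prime_self: "\<lbrakk> primeideal Q R; Q \<subseteq> M \<rbrakk> \<Longrightarrow> satur M Q = Q"
  using satur_subset_prime[of Q M Q] satur_incl[OF M, of Q] primeideal.axioms(1) by blast

lemma ext_prime:
  assumes Q: "primeideal Q R" "Q \<subseteq> M" shows "primeideal (ext Q) L"
proof -
  have QI: "ideal Q R" by (rule primeideal.axioms(1)[OF Q(1)])
  note mem = fr_in_ext_iff[OF QI, unfolded satur_prime_self[OF Q]]
  show ?thesis
  proof (rule primeidealI[OF ext_ideal[OF QI] L.cring_axioms])
    have "fr \<one> \<one> \<notin> ext Q" using mem[of \<one> \<one>] S_one primeideal_one[OF Q(1)] by auto
    thus "carrier L \<noteq> ext Q" using fr_in_L[OF one_closed S_one] by auto
    fix x y assume xy: "x \<in> carrier L" "y \<in> carrier L" "x \<otimes>\<^bsub>L\<^esub> y \<in> ext Q"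
    then obtain a s b t where h: "a \<in> carrier R" "s \<in> S" "b \<in> carrier R" "t \<in> S" "x = fr a s" "y = fr b t"
      by (auto elim!: L_carrierE)
    have "a \<otimes> b \<in> Q" using xy(3) h mem[of "a \<otimes> b" "s \<otimes> t"] S_mult[OF h(2,4)] by (simp add: L_mult)
    thus "x \<in> ext Q \<or> y \<in> ext Q" using primeideal.I_prime[OF Q(1) h(1,3)] mem h by auto
  qed
qed

lemma ext_strict:
  assumes "primeideal Q R" "Q' \<subseteq> M" "primeideal Q' R" "Q \<subset> Q'"
  shows "ext Q \<subset> ext Q'"
proof -
  have QM: "Q \<subseteq> M" using assms by blast
  obtain r where r: "r \<in> Q'" "r \<notin> Q" using assms by blast
  have rc: "r \<in> carrier R" using r(1) ideal_closed(1)[OF primeideal.axioms(1)[OF assms(3)]] by blast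
  have "fr r \<one> \<in> ext Q'" "fr r \<one> \<notin> ext Q"
    using fr_in_ext_iff[OF primeideal.axioms(1)[OF assms(1)] rc S_one] fr_in_ext_iff[OF primeideal.axioms(1)[OF assms(3)] rc S_one]
      satur_prime_self[OF assms(1) QM] satur_prime_self[OF assms(3,2)] r by auto
  moreover have "ext Q \<subseteq> ext Q'" using assms(4) unfolding ext_def by blast
  ultimately show ?thesis by blast
qed

lemma krull_dim_localization_ge:
  assumes "\<And>i. i \<le> n \<Longrightarrow> primeideal (P i) R" "\<And>i. i < n \<Longrightarrow> P i \<subset> P (Suc i)" "P n \<subseteq> M"
  shows "enat n \<le> krull_dim L"
proof -
  have sub: "P i \<subseteq> M" if "i \<le> n" for i
    using that
  proof (induction rule: inc_induct)
    case (step k) thus ?case using assms(2)[of k] by blast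
  qed (rule assms(3))
  have "enat n \<in> {enat n | n. \<exists>P. (\<forall>i\<le>n. primeideal (P i) L) \<and> (\<forall>i<n. P i \<subset> P (Suc i))}"
    using assms(1,2) sub ext_prime ext_strict
    by (intro CollectI exI[of _ n] conjI refl exI[of _ "\<lambda>i. ext (P i)"] allI impI) auto
  thus ?thesis unfolding krull_dim_def by (rule Sup_upper)
qed

text \<open>A fraction outside \<open>ext M\<close> has its numerator outside M and is a unit.
  Uniqueness evaluates the definite description in \<open>local_depth\<close>.\<close>

lemma maximal_localization: "maximalideal I L \<longleftrightarrow> I = ext M"
proof -
  have MI: "ideal M R" by (rule primeideal.axioms(1)[OF M])
  have mx: "I \<subseteq> ext M" if I: "ideal I L" "I \<noteq> carrier L" for I
  proof
    fix x assume x: "x \<in> I"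
    then obtain a s where a: "a \<in> carrier R" "s \<in> S" "x = fr a s"
      using L_carrierE[OF L.ideal_closed(1)[OF I(1) x]] by metis
    show "x \<in> ext M"
    proof (rule ccontr)
      assume "x \<notin> ext M"
      hence aS: "a \<in> S" using a unfolding ext_def by blast
      have "fr s a \<otimes>\<^bsub>L\<^esub> x = fr (s \<otimes> a) (a \<otimes> s)"
        unfolding a(3) using a(1,2) aS by (intro L_mult) auto
      also have "\<dots> = \<one>\<^bsub>L\<^esub>" unfolding L_one using a aS S_mult S_one by (subst fr_eq_iff) (auto simp: m_comm)
      finally have "\<one>\<^bsub>L\<^esub> \<in> I" using L.ideal_closed(6)[OF I(1) x, of "fr s a"] aS a fr_in_L by auto
      thus False using ideal.one_imp_carrier[OF I(1)] I(2) by blast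
    qed
  qed
  have mm: "maximalideal (ext M) L"
  proof (rule maximalidealI[OF ext_ideal[OF MI]])
    show "carrier L \<noteq> ext M" using primeideal.I_notcarr[OF ext_prime[OF M]] by simp
    fix J assume "ideal J L" "ext M \<subseteq> J" "J \<subseteq> carrier L"
    thus "J = ext M \<or> J = carrier L" using mx by blast
  qed
  show ?thesis
  proof
    assume I: "maximalideal I L"
    have "I \<subseteq> ext M" using mx[of I] maximalideal.axioms(1)[OF I] maximalideal.I_notcarr[OF I] by auto
    thus "I = ext M"
      using maximalideal.I_maximal[OF I ext_ideal[OF MI]] maximalideal.I_notcarr[OF mm]
        L.ideal_closed(1)[OF ext_ideal[OF MI]] by blast
  qed (use mm in simp)
qed

text \<open>Denominators are units of \<open>L\<close>, so only numerators matter. The set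
  \<open>C\<close> in the proof is the contraction of the generated ideal, an ideal of
  \<open>R\<close> that contains all numerators.\<close>

lemma genideal_localization:
  assumes "length as = length ss" "set as \<subseteq> carrier R" "set ss \<subseteq> S"
  shows "genideal L (set (map2 fr as ss)) = ext (adjoins {\<zero>} as)"
proof
  have J: "ideal (adjoins {\<zero>} as) R" by (intro adjoins_ideal zeroideal assms)
  have zip: "a \<in> set as \<and> a \<in> carrier R \<and> s \<in> S" if "(a, s) \<in> set (zip as ss)" for a s
    using set_zip_leftD[OF that] set_zip_rightD[OF that] assms(2,3) by blast
  have ys: "set (map2 fr as ss) \<subseteq> carrier L"
    using zip by (auto intro!: fr_in_L)
  show "genideal L (set (map2 fr as ss)) \<subseteq> ext (adjoins {\<zero>} as)"
  proof (rule L.genideal_minimal[OF ext_ideal[OF J]])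
    show "set (map2 fr as ss) \<subseteq> ext (adjoins {\<zero>} as)"
    proof
      fix x assume "x \<in> set (map2 fr as ss)"
      then obtain a s where as: "(a, s) \<in> set (zip as ss)" "x = fr a s" by auto
      thus "x \<in> ext (adjoins {\<zero>} as)"
        using zip[OF as(1)] adjoins_incl(2)[OF zeroideal assms(2)] unfolding ext_def by blast
    qed
  qed
  let ?I = "genideal L (set (map2 fr as ss))"
  have I: "ideal ?I L" by (rule L.genideal_ideal[OF ys])
  note IC = L.ideal_closed[OF I]
  define C where "C = {r \<in> carrier R. fr r \<one> \<in> ?I}"
  have "ideal C R"
  proof (rule idealI[OF ring_axioms])
    show "subgroup C (add_monoid R)"
    proof (rule add.subgroupI, goal_cases)
      case 1 show ?case unfolding C_def by auto
      case 2 show ?case using IC(2) unfolding C_def L_zero by auto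
    next
      case (3 a) thus ?case using IC(5)[of "fr a \<one>"] L_minus[of a \<one>] S_one
        unfolding C_def a_inv_def[symmetric] by auto
    next
      case (4 a b) thus ?case using IC(3)[of "fr a \<one>" "fr b \<one>"] L_add[of a \<one> b \<one>] S_one unfolding C_def by auto
    qed
    fix a x assume ax: "a \<in> C" "x \<in> carrier R"
    thus "x \<otimes> a \<in> C" using IC(6)[of "fr a \<one>" "fr x \<one>"] L_mult[of x \<one> a \<one>] S_one fr_in_L unfolding C_def by auto
    thus "a \<otimes> x \<in> C" using m_comm ax unfolding C_def by auto
  qed
  moreover have "set as \<subseteq> C"
  proof
    fix a assume a: "a \<in> set as"
    then obtain i where i: "i < length as" "a = as ! i" by (metis in_set_conv_nth)
    have "ss ! i \<in> set ss" using assms(1) i by simp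
    hence s: "ss ! i \<in> S" "a \<in> carrier R" using assms a by blast+
    have "map2 fr as ss ! i \<in> set (map2 fr as ss)" using i assms(1) by (intro nth_mem) simp
    hence "fr a (ss ! i) \<in> set (map2 fr as ss)" using i assms(1) by simp
    hence "fr a (ss ! i) \<in> ?I" using L.genideal_self[OF ys] by blast
    hence "fr (ss ! i) \<one> \<otimes>\<^bsub>L\<^esub> fr a (ss ! i) \<in> ?I" using s S_one fr_in_L by (intro IC(6)) auto
    moreover have "fr (ss ! i) \<one> \<otimes>\<^bsub>L\<^esub> fr a (ss ! i) = fr a \<one>"
      using s S_one S_mult by (subst L_mult) (auto simp: fr_eq_iff m_ac)
    ultimately show "a \<in> C" unfolding C_def using s by simp
  qed
  ultimately have C: "adjoins {\<zero>} as \<subseteq> C" using ideal_closed(2) by (intro adjoins_least) auto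
  show "ext (adjoins {\<zero>} as) \<subseteq> ?I"
  proof
    fix x assume "x \<in> ext (adjoins {\<zero>} as)"
    then obtain r s where r: "r \<in> adjoins {\<zero>} as" "s \<in> S" "x = fr r s" unfolding ext_def by blast
    have rc: "r \<in> carrier R" using r(1) C unfolding C_def by blast
    have "fr r \<one> \<in> ?I" using r(1) C unfolding C_def by blast
    hence "fr \<one> s \<otimes>\<^bsub>L\<^esub> fr r \<one> \<in> ?I" using r fr_in_L by (intro IC(6)) auto
    moreover have "fr \<one> s \<otimes>\<^bsub>L\<^esub> fr r \<one> = x" using r(2,3) rc S_one by (subst L_mult) auto
    ultimately show "x \<in> ?I" by simp
  qed
qed

text \<open>Passing to numerators changes neither the ideals generated by initial segments nor the
  conditions on zero divisors, because denominators are units.\<close>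

lemma lreg_of_regular_sequence:
  assumes "regular_sequence L ys" "set ys \<subseteq> ext M"
  shows "\<exists>as. length as = length ys \<and> set as \<subseteq> M \<and> lreg M {\<zero>} as"
proof -
  have MI: "ideal M R" by (rule primeideal.axioms(1)[OF M])
  have "\<forall>y \<in> set ys. \<exists>p. fst p \<in> M \<and> snd p \<in> S \<and> y = fr (fst p) (snd p)"
    using assms(2) unfolding ext_def by fastforce
  then obtain f where f: "\<And>y. y \<in> set ys \<Longrightarrow> fst (f y) \<in> M \<and> snd (f y) \<in> S \<and> y = fr (fst (f y)) (snd (f y))"
    by metis
  define as where "as = map (fst \<circ> f) ys"
  define ss where "ss = map (snd \<circ> f) ys"
  have len: "length as = length ys" "length ss = length ys" unfolding as_def ss_def by auto
  have asM: "set as \<subseteq> M" and ssS: "set ss \<subseteq> S" unfolding as_def ss_def using f by auto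
  have asc: "set as \<subseteq> carrier R" using asM ideal_closed(1)[OF MI] by auto
  have ys: "ys = map2 fr as ss"
  proof (rule nth_equalityI)
    fix i assume i: "i < length ys"
    have "ys ! i = fr (fst (f (ys ! i))) (snd (f (ys ! i)))" using f[OF nth_mem[OF i]] by blast
    thus "ys ! i = map2 fr as ss ! i" using i by (simp add: as_def ss_def split_beta)
  qed (simp add: as_def ss_def)
  have "lreg M {\<zero>} as"
    unfolding lreg_iff_nth
  proof (intro allI impI ballI)
    fix i r assume i: "i < length as" and r: "r \<in> carrier R" and h: "as ! i \<otimes> r \<in> satur M (adjoins {\<zero>} (take i as))"
    have tk: "set (take i as) \<subseteq> carrier R" "set (take i ss) \<subseteq> S" 
      by (rule order_trans[OF set_take_subset asc], rule order_trans[OF set_take_subset ssS])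
    have J: "ideal (adjoins {\<zero>} (take i as)) R" by (intro adjoins_ideal zeroideal tk)
    have g: "genideal L (set (take i ys)) = ext (adjoins {\<zero>} (take i as))"
      unfolding ys using genideal_localization[OF _ tk] len by (simp add: take_map take_zip)
    have "as ! i \<in> set as" "ss ! i \<in> set ss" using i len by simp_all
    hence ai: "as ! i \<in> carrier R" "ss ! i \<in> S" using asc ssS by blast+
    have "ys ! i \<otimes>\<^bsub>L\<^esub> fr r \<one> = fr (as ! i \<otimes> r) (ss ! i)"
      unfolding ys using i len L_mult[OF ai r S_one] ai by simp
    moreover have "\<dots> \<in> ext (adjoins {\<zero>} (take i as))" using fr_in_ext_iff[OF J] h ai r by auto
    ultimately have "ys ! i \<otimes>\<^bsub>L\<^esub> fr r \<one> \<in> genideal L (set (take i ys))" unfolding g by simp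
    moreover have "i < length ys" using i len by simp
    ultimately have "fr r \<one> \<in> genideal L (set (take i ys))"
      using assms(1) fr_in_L[OF r S_one] unfolding regular_sequence_def by blast
    thus "r \<in> satur M (adjoins {\<zero>} (take i as))" unfolding g using fr_in_ext_iff[OF J r S_one] by simp
  qed
  thus ?thesis using len(1) asM by blast
qed

text \<open>The depth is a supremum and may be infinite. If all sequences were shorter than k it
  would be at most k - 1; so one of length at least k exists and can be truncated.\<close>

lemma lreg_of_local_depth:
  assumes "enat k \<le> local_depth L"
  shows "\<exists>as. length as = k \<and> set as \<subseteq> M \<and> lreg M {\<zero>} as"
proof (cases "k = 0")
  case False
  have the: "(THE I. maximalideal I L) = ext M" unfolding maximal_localization by simp
  obtain ys where ys: "regular_sequence L ys" "set ys \<subseteq> ext M" "k \<le> length ys"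
  proof (rule ccontr)
    assume no: "\<not> thesis"
    have "local_depth L \<le> enat (k - 1)"
      unfolding local_depth_def the
    proof (rule Sup_least)
      fix x assume "x \<in> {enat (length xs) | xs. regular_sequence L xs \<and> set xs \<subseteq> ext M}"
      then obtain xs where xs: "x = enat (length xs)" "regular_sequence L xs" "set xs \<subseteq> ext M" by blast
      hence "\<not> k \<le> length xs" using no that by blast
      thus "x \<le> enat (k - 1)" using xs(1) by simp
    qed
    hence "enat k \<le> enat (k - 1)" using assms by (rule order_trans[rotated])
    thus False using False by simp
  qed
  obtain as where as: "length as = length ys" "set as \<subseteq> M" "lreg M {\<zero>} as"
    using lreg_of_regular_sequence[OF ys(1,2)] by blast
  have "lreg M {\<zero>} (take k as)" using as(3) lreg_append[of M "{\<zero>}" "take k as" "drop k as"] by simp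
  thus ?thesis using as ys(3) set_take_subset[of k as] by (intro exI[of _ "take k as"]) auto
qed auto

end

text \<open>The last clause bounds the dimension of the local ring at \<open>M\<close> by the length of \<open>ys\<close> whenever
  \<open>ys\<close> is shorter than \<open>d\<close>.\<close>

lemma (in domain) cohen_macaulay_lreg:
  assumes "cohen_macaulay R" "maximalideal M R"
  obtains ys where "set ys \<subseteq> M" "lreg M {\<zero>} ys" "length ys \<le> d"
    "\<And>n P. \<lbrakk> length ys < d; \<And>i. i \<le> n \<Longrightarrow> primeideal (P i) R; \<And>i. i < n \<Longrightarrow> P i \<subset> P (Suc i); P n \<subseteq> M \<rbrakk>
      \<Longrightarrow> n \<le> length ys"
proof -
  interpret domain_at_prime R M
    by (intro domain_at_prime.intro domain_at_prime_axioms.intro domain_axioms maximalideal_prime assms)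
  have eq: "local_depth L = krull_dim L" using assms(1)[unfolded cohen_macaulay_def] assms(2) by simp
  show thesis
  proof (cases "enat d \<le> krull_dim L")
    \<comment> \<open>This case includes an infinite local dimension. The sequence is cut off at
      length d, and the last clause holds vacuously.\<close>
    case True
    then obtain as where as: "length as = d" "set as \<subseteq> M" "lreg M {\<zero>} as"
      using lreg_of_local_depth[of d] eq by auto
    show thesis by (rule that[OF as(2,3)]) (simp_all add: as(1))
  next
    case False
    then obtain k where k: "krull_dim L = enat k" "k < d" by (cases "krull_dim L") auto
    then obtain as where as: "length as = k" "set as \<subseteq> M" "lreg M {\<zero>} as"
      using lreg_of_local_depth[of k] eq by auto
    show thesis
    proof (rule that[OF as(2,3)])
      show "length as \<le> d" using as k by simp
      fix n P assume "\<And>i. i \<le> n \<Longrightarrow> primeideal (P i) R" "\<And>i. i < n \<Longrightarrow> P i \<subset> P (Suc i)" "P n \<subseteq> M"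
      hence "enat n \<le> krull_dim L" by (rule krull_dim_localization_ge)
      thus "n \<le> length as" using k as by simp
    qed
  qed
qed

section \<open>Growth of polynomial rings\<close>

text \<open>\<open>hilb d m\<close> is the dimension of the forms of degree \<open>m\<close> in \<open>d\<close> variables.\<close>

fun hilb :: "nat \<Rightarrow> nat \<Rightarrow> nat" where
  "hilb 0 0 = 1"
| "hilb 0 (Suc m) = 0"
| "hilb (Suc d) 0 = 1"
| "hilb (Suc d) (Suc m) = hilb d (Suc m) + hilb (Suc d) m"

lemma hilb_zero: "hilb d 0 = 1"
  by (cases d) auto

lemma hilb_binomial: "hilb (Suc d) m = (m + d) choose d"
proof (induction d arbitrary: m)
  case 0 show ?case by (induction m) auto
next
  case (Suc d)
  show ?case
  proof (induction m)
    case (Suc m)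
    have "hilb (Suc (Suc d)) (Suc m) = hilb (Suc d) (Suc m) + hilb (Suc (Suc d)) m" by (rule hilb.simps)
    thus ?case unfolding Suc.IH \<open>\<And>m. hilb (Suc d) m = (m + d) choose d\<close> by simp
  qed simp
qed

lemma hilb_Suc_ratio: "hilb (Suc d) (Suc m) * Suc m = hilb (Suc d) m * (Suc m + d)"
  using binomial_absorb_comp[of "Suc m + d" d] unfolding hilb_binomial by (simp add: mult.commute)

lemma hilb_pos: "hilb (Suc d) m > 0"
  unfolding hilb_binomial by simp

lemma hilb_mono: "m \<le> n \<Longrightarrow> hilb (Suc d) m \<le> hilb (Suc d) n"
  by (induction rule: dec_induct) auto

text \<open>The value at j + 1 is 1 + d / (j + 1) times the value at j. For j = k + i with i < c the
  hypothesis bounds this factor by (M + i + 1) / (M + i), and the product over i telescopes to (M +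
  c) / M.\<close>

lemma hilb_ratio:
  assumes "M > 0" "(M + c) * d \<le> k"
  shows "M * hilb (Suc d) (k + c) \<le> (M + c) * hilb (Suc d) k"
  using assms(2)
proof (induction c)
  case (Suc c)
  define h where "h = hilb (Suc d)"
  have "(M + c) * h (Suc (k + c)) * Suc (k + c) = (M + c) * (h (k + c) * (Suc (k + c) + d))"
    unfolding h_def mult.assoc by (simp only: hilb_Suc_ratio)
  also have "\<dots> = ((M + c) * (Suc (k + c) + d)) * h (k + c)" by (simp only: mult_ac)
  also have "\<dots> \<le> ((M + Suc c) * Suc (k + c)) * h (k + c)"
    using Suc.prems by (intro mult_le_mono1) (simp add: algebra_simps)
  also have "\<dots> = ((M + Suc c) * h (k + c)) * Suc (k + c)" by (simp only: mult_ac)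
  finally have 1: "(M + c) * h (Suc (k + c)) \<le> (M + Suc c) * h (k + c)"
    by (rule mult_right_le_imp_le) simp
  have "(M + c) * d \<le> k" using Suc.prems by (simp add: algebra_simps)
  note 2 = Suc.IH[OF this, folded h_def]
  have "(M + c) * (M * h (Suc (k + c))) = M * ((M + c) * h (Suc (k + c)))" by (simp only: mult_ac)
  also have "\<dots> \<le> M * ((M + Suc c) * h (k + c))" using 1 by (rule mult_le_mono2)
  also have "\<dots> = (M + Suc c) * (M * h (k + c))" by (simp only: mult_ac)
  also have "\<dots> \<le> (M + Suc c) * ((M + c) * h k)" using 2 by (rule mult_le_mono2)
  also have "\<dots> = (M + c) * ((M + Suc c) * h k)" by (simp only: mult_ac)
  finally have "M * h (Suc (k + c)) \<le> (M + Suc c) * h k"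
    by (rule mult_left_le_imp_le) (use assms in simp)
  thus ?case by (simp add: h_def)
qed simp

text \<open>The quotient of the values at k + c and k tends to 1. This lets ranks be compared
  through dimensions in a large degree in spite of a shift by c.\<close>

lemma hilb_growth:
  obtains k where "k0 \<le> k" "N * hilb (Suc d) (k + c) < (N + 1) * hilb (Suc d) k"
proof -
  define h where "h = hilb (Suc d)"
  \<comment> \<open>C exceeds c only to be positive, so that it can be cancelled.
    \<open>hilb_ratio\<close> with M = (N + 1) C bounds the quotient by (N + 2) / (N + 1), and N (N
    + 2) < (N + 1)^2 gives strictness.\<close>
  define C where "C = Suc c"
  define k where "k = k0 + ((N + 1) * C + C) * d"
  have "((N + 1) * C) * h (k + C) \<le> ((N + 1) * C + C) * h k"
    unfolding h_def by (rule hilb_ratio) (simp_all add: C_def k_def)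
  also have "(N + 1) * C * h (k + C) = C * ((N + 1) * h (k + C))" by (simp only: mult_ac)
  also have "((N + 1) * C + C) * h k = C * ((N + 2) * h k)" by (simp add: algebra_simps)
  finally have "(N + 1) * h (k + C) \<le> (N + 2) * h k"
    by (rule mult_left_le_imp_le) (simp add: C_def)
  moreover have "h (k + c) \<le> h (k + C)" unfolding h_def by (rule hilb_mono) (simp add: C_def)
  hence "(N + 1) * h (k + c) \<le> (N + 1) * h (k + C)" by (rule mult_le_mono2)
  ultimately have 1: "(N + 1) * h (k + c) \<le> (N + 2) * h k" by (rule order_trans[rotated])
  have "(N + 1) * (N * h (k + c)) = N * ((N + 1) * h (k + c))" by (simp only: mult_ac)
  also have "\<dots> \<le> N * ((N + 2) * h k)" by (rule mult_le_mono2[OF 1])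
  also have "\<dots> < (N + 1) * ((N + 1) * h k)" using hilb_pos[of d k] by (simp add: algebra_simps h_def[symmetric])
  finally have "N * h (k + c) < (N + 1) * h k" by (metis mult_less_cancel1)
  thus thesis using that[of k] by (simp add: k_def h_def)
qed

section \<open>Finite-dimensional subspaces of a domain\<close>

locale domain_over_field = domain R for R (structure) +
  fixes K assumes K: "subfield K R"
begin

abbreviation sub where "sub E \<equiv> subalgebra K E R"
abbreviation fd where "fd \<equiv> finite_dimension K"
abbreviation vd where "vd \<equiv> dim K"

lemma K_carrier: "K \<subseteq> carrier R" by (rule subfieldE(3)[OF K])

lemma vd_eqI: "dimension n K E \<Longrightarrow> vd E = n"
  using dimI[OF K] by (simp add: over_def)

lemma fd_dimension: "fd E \<Longrightarrow> dimension (vd E) K E"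
  using finite_dimensionE[OF K] by (simp add: over_def)

lemma fd_sub: "fd E \<Longrightarrow> sub E"
  by (rule finite_dimension_imp_subalgebra[OF K])

lemma subD:
  assumes "sub E"
  shows "\<And>x. x \<in> E \<Longrightarrow> x \<in> carrier R" "\<zero> \<in> E" "\<And>x y. \<lbrakk> x \<in> E; y \<in> E \<rbrakk> \<Longrightarrow> x \<oplus> y \<in> E"
    "\<And>x. x \<in> E \<Longrightarrow> \<ominus> x \<in> E" "\<And>k x. \<lbrakk> k \<in> K; x \<in> E \<rbrakk> \<Longrightarrow> k \<otimes> x \<in> E"
proof -
  interpret subalgebra K E R by fact
  show "\<And>x. x \<in> E \<Longrightarrow> x \<in> carrier R" using subset by auto
  show "\<zero> \<in> E" using one_closed by simp
  show "\<And>x y. \<lbrakk> x \<in> E; y \<in> E \<rbrakk> \<Longrightarrow> x \<oplus> y \<in> E" using m_closed by simp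
  show "\<And>x. x \<in> E \<Longrightarrow> \<ominus> x \<in> E" using m_inv_closed by (simp add: a_inv_def)
  show "\<And>k x. \<lbrakk> k \<in> K; x \<in> E \<rbrakk> \<Longrightarrow> k \<otimes> x \<in> E" by (rule smult_closed)
qed

lemma subI:
  assumes "E \<subseteq> carrier R" "\<zero> \<in> E" "\<And>x y. \<lbrakk> x \<in> E; y \<in> E \<rbrakk> \<Longrightarrow> x \<oplus> y \<in> E"
    "\<And>k x. \<lbrakk> k \<in> K; x \<in> E \<rbrakk> \<Longrightarrow> k \<otimes> x \<in> E"
  shows "sub E"
proof -
  have one: "\<one> \<in> K" "\<ominus> \<one> \<in> K"
    using subringE(3,5)[OF subfieldE(1)[OF K]] by auto
  have inv: "\<ominus> x \<in> E" if "x \<in> E" for x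
    using assms(4)[OF one(2) that] assms(1) that by (auto simp: l_minus)
  have "subgroup E (add_monoid R)"
    using assms inv by (intro add.subgroupI) (auto simp: a_inv_def)
  thus ?thesis using assms(4) by (intro subalgebra.intro subalgebra_axioms.intro) auto
qed

lemma mem_set_add: "z \<in> A <+>\<^bsub>R\<^esub> B \<longleftrightarrow> (\<exists>a \<in> A. \<exists>b \<in> B. z = a \<oplus> b)"
  unfolding set_add_def' by auto

lemma mem_set_addI: "\<lbrakk> a \<in> A; b \<in> B; z = a \<oplus> b \<rbrakk> \<Longrightarrow> z \<in> A <+>\<^bsub>R\<^esub> B"
  unfolding mem_set_add by blast

lemma sub_add:
  assumes "sub E" "sub F" shows "sub (E <+>\<^bsub>R\<^esub> F)"
proof (rule subI)
  note E = subD[OF assms(1)] and F = subD[OF assms(2)]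
  show "E <+>\<^bsub>R\<^esub> F \<subseteq> carrier R" using E F by (auto simp: mem_set_add)
  show "\<zero> \<in> E <+>\<^bsub>R\<^esub> F" using E F by (auto simp: mem_set_add intro!: bexI[of _ \<zero>])
  show "x \<oplus> y \<in> E <+>\<^bsub>R\<^esub> F" if xy: "x \<in> E <+>\<^bsub>R\<^esub> F" "y \<in> E <+>\<^bsub>R\<^esub> F" for x y
  proof -
    obtain a b c d where h: "a \<in> E" "b \<in> F" "c \<in> E" "d \<in> F" "x = a \<oplus> b" "y = c \<oplus> d"
      using xy unfolding mem_set_add by blast
    have "x \<oplus> y = (a \<oplus> c) \<oplus> (b \<oplus> d)" unfolding h(5,6) using h(1-4) E(1) F(1) by (simp add: a_ac)
    from mem_set_addI[OF E(3)[OF h(1,3)] F(3)[OF h(2,4)] this] show ?thesis .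
  qed
  show "k \<otimes> x \<in> E <+>\<^bsub>R\<^esub> F" if kx: "k \<in> K" "x \<in> E <+>\<^bsub>R\<^esub> F" for k x
  proof -
    obtain a b where h: "a \<in> E" "b \<in> F" "x = a \<oplus> b" using kx unfolding mem_set_add by blast
    have "k \<otimes> x = k \<otimes> a \<oplus> k \<otimes> b" unfolding h(3) using h(1,2) E(1) F(1) K_carrier kx(1) by (auto simp: r_distr)
    from mem_set_addI[OF E(5)[OF kx(1) h(1)] F(5)[OF kx(1) h(2)] this] show ?thesis .
  qed
qed

lemma add_least: "\<lbrakk> sub H; E \<subseteq> H; F \<subseteq> H \<rbrakk> \<Longrightarrow> E <+>\<^bsub>R\<^esub> F \<subseteq> H"
  using subD(3)[of H] unfolding subset_iff mem_set_add by metis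

lemma add_upper:
  assumes "sub E" "sub F" shows "E \<subseteq> E <+>\<^bsub>R\<^esub> F" "F \<subseteq> E <+>\<^bsub>R\<^esub> F"
proof -
  note E = subD[OF assms(1)] and F = subD[OF assms(2)]
  show "E \<subseteq> E <+>\<^bsub>R\<^esub> F"
  proof
    fix e assume "e \<in> E"
    thus "e \<in> E <+>\<^bsub>R\<^esub> F" using E(1) F(2) by (intro mem_set_addI[of e _ \<zero>]) auto
  qed
  show "F \<subseteq> E <+>\<^bsub>R\<^esub> F"
  proof
    fix e assume "e \<in> F"
    thus "e \<in> E <+>\<^bsub>R\<^esub> F" using F(1) E(2) by (intro mem_set_addI[of \<zero> _ e]) auto
  qed
qed

lemma fd_add: "\<lbrakk> fd E; fd F \<rbrakk> \<Longrightarrow> fd (E <+>\<^bsub>R\<^esub> F)"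
  by (rule sum_space_dim(1)[OF K])

lemma fd_mono: "\<lbrakk> fd F; sub E; E \<subseteq> F \<rbrakk> \<Longrightarrow> fd E"
  by (rule subalbegra_incl_imp_finite_dimension[OF K])

lemma vd_mono:
  assumes "fd F" "sub E" "E \<subseteq> F" shows "vd E \<le> vd F"
proof -
  obtain Us where Us: "independent K Us" "length Us = vd E" "Span K Us = E" "set Us \<subseteq> carrier R"
    using exists_base[OF K fd_dimension[OF fd_mono[OF assms]]] by blast
  thus ?thesis
    using independent_length_le_dimension[OF K fd_dimension[OF assms(1)] Us(1)] Span_base_incl[OF K Us(4)] assms(3)
    by auto
qed

lemma vd_eq_imp_eq:
  assumes "fd F" "sub E" "E \<subseteq> F" "vd F \<le> vd E" shows "E = F"
proof -
  obtain Us where Us: "independent K Us" "length Us = vd E" "Span K Us = E" "set Us \<subseteq> carrier R"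
    using exists_base[OF K fd_dimension[OF fd_mono[OF assms(1-3)]]] by blast
  have "vd E = vd F" using vd_mono[OF assms(1-3)] assms(4) by simp
  thus ?thesis
    using independent_length_eq_dimension[OF K fd_dimension[OF assms(1)] Us(1)] Span_base_incl[OF K Us(4)] assms(3) Us
    by auto
qed

lemma vd_add:
  assumes "fd E" "fd F" shows "vd (E <+>\<^bsub>R\<^esub> F) + vd (E \<inter> F) = vd E + vd F"
proof -
  have "sub (E \<inter> F)" by (intro subalgebra_inter fd_sub assms)
  hence "vd (E \<inter> F) \<le> vd E" using vd_mono[OF assms(1)] by blast
  thus ?thesis using sum_space_dim(2)[OF K assms] by (simp add: over_def)
qed

lemma vd_add_le: "\<lbrakk> fd E; fd F \<rbrakk> \<Longrightarrow> vd (E <+>\<^bsub>R\<^esub> F) \<le> vd E + vd F"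
  using vd_add[of E F] by simp

lemma vd_zero: "fd {\<zero>}" "vd {\<zero>} = 0"
  using vd_eqI[OF zero_dim] finite_dimensionI[OF zero_dim, of K] by auto

lemma vd_K: "fd K" "vd K = 1"
  using vd_eqI[of 1 K] finite_dimensionI[of 1 K K] dimension_one[OF K] by auto

lemma vd_pos_nonzero:
  assumes "fd E" "vd E > 0" obtains a where "a \<in> E" "a \<noteq> \<zero>"
proof -
  have "E \<noteq> {\<zero>}" using assms(2) vd_zero(2) by auto
  thus thesis using that subD(2)[OF fd_sub[OF assms(1)]] by blast
qed

section \<open>Multiplication by ring elements, complements and hyperplanes\<close>

definition smul :: "'a \<Rightarrow> 'a set \<Rightarrow> 'a set" where
  "smul a E = (\<lambda>e. a \<otimes> e) ` E"

lemma smul_subset_iff: "smul a E \<subseteq> F \<longleftrightarrow> (\<forall>e \<in> E. a \<otimes> e \<in> F)"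
  unfolding smul_def by blast

lemma smul_sub:
  assumes "a \<in> carrier R" "sub E" shows "sub (smul a E)"
proof (rule subI)
  note E = subD[OF assms(2)]
  show "smul a E \<subseteq> carrier R" using E assms by (auto simp: smul_def)
  show "\<zero> \<in> smul a E" unfolding smul_def using E assms by (intro image_eqI[of _ _ \<zero>]) auto
  show "x \<oplus> y \<in> smul a E" if xy: "x \<in> smul a E" "y \<in> smul a E" for x y
  proof -
    obtain e f where h: "e \<in> E" "f \<in> E" "x = a \<otimes> e" "y = a \<otimes> f" using xy unfolding smul_def by blast
    have "x \<oplus> y = a \<otimes> (e \<oplus> f)" unfolding h(3,4) using h(1,2) E(1) assms by (simp add: r_distr)
    thus ?thesis unfolding smul_def using E(3)[OF h(1,2)] by blast
  qed
  show "k \<otimes> x \<in> smul a E" if kx: "k \<in> K" "x \<in> smul a E" for k x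
  proof -
    obtain e where h: "e \<in> E" "x = a \<otimes> e" using kx unfolding smul_def by blast
    have "k \<in> carrier R" using kx(1) K_carrier by blast
    hence "k \<otimes> x = a \<otimes> (k \<otimes> e)" unfolding h(2) using h(1) E(1) assms by (simp add: m_ac)
    thus ?thesis unfolding smul_def using E(5)[OF kx(1) h(1)] by blast
  qed
qed

text \<open>Multiplication by a nonzero element of a domain is injective, hence carries line
  extensions to line extensions.\<close>

lemma smul_dimension:
  assumes "a \<in> carrier R" "a \<noteq> \<zero>" "dimension n K E" shows "dimension n K (smul a E)"
  using assms(3)
proof (induction n arbitrary: E)
  case 0
  hence "E = {\<zero>}" using dimension_zero[OF K] by blast
  thus ?case using assms by (simp add: smul_def dimension.zero_dim)
next
  case (Suc n E')
  obtain v E where v: "v \<in> carrier R" "v \<notin> E" "dimension n K E" "E' = line_extension K v E"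
    using dimension_backwards[OF K Suc.prems] by blast
  note Suc_dim = v(1-3)
  have E: "\<And>e. e \<in> E \<Longrightarrow> e \<in> carrier R" using space_subgroup_props(1)[OF K Suc_dim(3)] by blast
  have kc: "\<And>k. k \<in> K \<Longrightarrow> k \<in> carrier R" using K_carrier by blast
  have *: "a \<otimes> (k \<otimes> v \<oplus> e) = k \<otimes> (a \<otimes> v) \<oplus> a \<otimes> e" if "k \<in> K" "e \<in> E" for k e
    using that E kc Suc_dim(1) assms(1) by (simp add: r_distr m_ac)
  have eq: "smul a (line_extension K v E) = line_extension K (a \<otimes> v) (smul a E)"
  proof (intro equalityI subsetI)
    fix x assume "x \<in> smul a (line_extension K v E)"
    then obtain k e where "k \<in> K" "e \<in> E" "x = a \<otimes> (k \<otimes> v \<oplus> e)"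
      unfolding smul_def by (auto simp: line_extension_mem_iff)
    thus "x \<in> line_extension K (a \<otimes> v) (smul a E)"
      using * unfolding line_extension_mem_iff smul_def by blast
  next
    fix x assume "x \<in> line_extension K (a \<otimes> v) (smul a E)"
    then obtain k e where ke: "k \<in> K" "e \<in> E" "x = k \<otimes> (a \<otimes> v) \<oplus> a \<otimes> e"
      unfolding smul_def by (auto simp: line_extension_mem_iff)
    have "k \<otimes> v \<oplus> e \<in> line_extension K v E" using ke by (auto simp: line_extension_mem_iff)
    thus "x \<in> smul a (line_extension K v E)" unfolding smul_def ke(3) *[OF ke(1,2), symmetric] by blast
  qed
  have "a \<otimes> v \<notin> smul a E"
    using Suc_dim(1,2) E assms by (auto simp: smul_def m_lcancel)
  thus ?case unfolding v(4) eq using Suc_dim assms(1) Suc.IH by (intro dimension.Suc_dim) auto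
qed

lemma vd_smul:
  assumes "a \<in> carrier R" "a \<noteq> \<zero>" "fd E" shows "fd (smul a E)" "vd (smul a E) = vd E"
  using smul_dimension[OF assms(1,2) fd_dimension[OF assms(3)]] finite_dimensionI vd_eqI by auto

lemma smul_fd_le:
  assumes "a \<in> carrier R" "fd E" shows "fd (smul a E)" "vd (smul a E) \<le> vd E"
proof -
  have "fd (smul a E) \<and> vd (smul a E) \<le> vd E"
  proof (cases "a = \<zero>")
    case True
    have "smul a E = {\<zero>}" unfolding smul_def True using subD(1,2)[OF fd_sub[OF assms(2)]] by force
    thus ?thesis using vd_zero by simp
  qed (use vd_smul assms in auto)
  thus "fd (smul a E)" "vd (smul a E) \<le> vd E" by auto
qed

lemma exists_complement:
  assumes "fd F" "sub E" "E \<subseteq> F"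
  obtains Vs where "set Vs \<subseteq> F" "F = E <+>\<^bsub>R\<^esub> Span K Vs" "length Vs = vd F - vd E" "vd (Span K Vs) = length Vs"
    "fd (Span K Vs)"
proof -
  obtain Us where Us: "independent K Us" "length Us = vd E" "Span K Us = E" "set Us \<subseteq> carrier R"
    using exists_base[OF K fd_dimension[OF fd_mono[OF assms]]] by blast
  have UF: "set Us \<subseteq> F" using Span_base_incl[OF K Us(4)] Us(3) assms(3) by auto
  obtain Vs where Vs: "length (Vs @ Us) = vd F" "independent K (Vs @ Us)" "Span K (Vs @ Us) = F"
    using complete_base[OF K fd_dimension[OF assms(1)] Us(1) UF] by blast
  have Vc: "set Vs \<subseteq> carrier R" "set (Vs @ Us) \<subseteq> carrier R" using independent_in_carrier[OF Vs(2)] by auto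
  have iV: "independent K Vs" using independent_split(2)[OF K Vs(2)] .
  show thesis
  proof (rule that[of Vs])
    show "set Vs \<subseteq> F" using Span_base_incl[OF K Vc(2)] Vs(3) by auto
    show "F = E <+>\<^bsub>R\<^esub> Span K Vs"
      using Span_append_eq_set_add[OF K Vc(1) Us(4)] Vs(3) Us(3) set_add_comm[of "Span K Vs" E]
        Span_in_carrier[OF K_carrier Vc(1)] Span_in_carrier[OF K_carrier Us(4)] by simp
    show "length Vs = vd F - vd E" using Vs(1) Us(2) by simp
    show "vd (Span K Vs) = length Vs" by (rule vd_eqI[OF dimension_independent[OF iV]])
    show "fd (Span K Vs)" by (rule Span_finite_dimension[OF K Vc(1)])
  qed
qed

text \<open>One vector outside E is dropped from a basis of F that extends a basis of E.\<close>

lemma exists_hyperplane: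
  assumes "fd F" "sub E" "E \<subseteq> F" "E \<noteq> F"
  obtains U where "sub U" "E \<subseteq> U" "U \<subseteq> F" "Suc (vd U) = vd F"
proof -
  obtain Us where Us: "independent K Us" "length Us = vd E" "Span K Us = E" "set Us \<subseteq> carrier R"
    using exists_base[OF K fd_dimension[OF fd_mono[OF assms(1-3)]]] by blast
  have UF: "set Us \<subseteq> F" using Span_base_incl[OF K Us(4)] Us(3) assms(3) by auto
  obtain Vs where Vs: "length (Vs @ Us) = vd F" "independent K (Vs @ Us)" "Span K (Vs @ Us) = F"
    using complete_base[OF K fd_dimension[OF assms(1)] Us(1) UF] by blast
  have "Vs \<noteq> []" using Vs(3) Us(3) assms(4) by auto
  then obtain v Ws where W: "Vs = v # Ws" by (cases Vs) auto
  have i: "independent K (Ws @ Us)" using independent_backwards(2)[of K v "Ws @ Us"] Vs(2) W by simp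
  have c: "set (Ws @ Us) \<subseteq> carrier R" "set Ws \<subseteq> carrier R" using independent_in_carrier[OF i] by auto
  show thesis
  proof (rule that[of "Span K (Ws @ Us)"])
    show "sub (Span K (Ws @ Us))" by (rule Span_is_subalgebra[OF K c(1)])
    show "E \<subseteq> Span K (Ws @ Us)" using mono_Span_append(2)[OF K Us(4) c(2)] Us(3) by simp
    have "set (Ws @ Us) \<subseteq> F" using Span_base_incl[OF K independent_in_carrier[OF Vs(2)]] Vs(3) W by auto
    thus "Span K (Ws @ Us) \<subseteq> F" by (rule subalgebra_Span_incl[OF K fd_sub[OF assms(1)]])
    show "Suc (vd (Span K (Ws @ Us))) = vd F"
      using vd_eqI[OF dimension_independent[OF i]] Vs(1) W by simp
  qed
qed

text \<open>\<open>forms xs m E\<close> is the space \<open>S\<^sub>m E\<close>, where \<open>S\<^sub>m\<close> consists of the forms of degree \<open>m\<close> in \<open>xs\<close>.\<close>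

fun forms :: "'a list \<Rightarrow> nat \<Rightarrow> 'a set \<Rightarrow> 'a set" where
  "forms [] 0 E = E"
| "forms [] (Suc m) E = {\<zero>}"
| "forms (x # xs) 0 E = E"
| "forms (x # xs) (Suc m) E = forms xs (Suc m) E <+>\<^bsub>R\<^esub> smul x (forms (x # xs) m E)"

lemma forms_zero: "forms xs 0 E = E"
  by (cases xs) auto

lemma sub_zero: "sub {\<zero>}"
  by (rule fd_sub[OF vd_zero(1)])

lemma forms_sub:
  assumes "set xs \<subseteq> carrier R" "sub E" shows "sub (forms xs m E)"
  using assms
proof (induction xs m E rule: forms.induct)
  case (2 m E) show ?case using sub_zero by simp
next
  case (4 x xs m E) thus ?case by (auto intro!: sub_add smul_sub)
qed auto

lemma forms_fd:
  assumes "set xs \<subseteq> carrier R" "fd E"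
  shows "fd (forms xs m E)" "vd (forms xs m E) \<le> hilb (length xs) m * vd E"
proof -
  have "fd (forms xs m E) \<and> vd (forms xs m E) \<le> hilb (length xs) m * vd E"
    using assms
  proof (induction xs m E rule: forms.induct)
    case (2 m E) show ?case using vd_zero by simp
  next
    case (4 x xs m E)
    have 1: "fd (forms xs (Suc m) E)" "vd (forms xs (Suc m) E) \<le> hilb (length xs) (Suc m) * vd E"
      and 2: "fd (forms (x # xs) m E)" "vd (forms (x # xs) m E) \<le> hilb (length (x # xs)) m * vd E"
      using 4 by auto
    have x: "x \<in> carrier R" using 4 by auto
    note 3 = smul_fd_le[OF x 2(1)]
    have "vd (forms (x # xs) (Suc m) E) \<le> vd (forms xs (Suc m) E) + vd (smul x (forms (x # xs) m E))"
      using vd_add_le[OF 1(1) 3(1)] by simp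
    also have "\<dots> \<le> hilb (length xs) (Suc m) * vd E + hilb (length (x # xs)) m * vd E"
      using 1(2) 2(2) 3(2) by linarith
    finally show ?case using fd_add[OF 1(1) 3(1)] by (simp add: algebra_simps)
  qed auto
  thus "fd (forms xs m E)" "vd (forms xs m E) \<le> hilb (length xs) m * vd E" by auto
qed

lemma forms_mono:
  assumes "E \<subseteq> F" shows "forms xs m E \<subseteq> forms xs m F"
  using assms
proof (induction xs m E rule: forms.induct)
  case (4 x xs m E)
  thus ?case by (fastforce simp: mem_set_add smul_def)
qed auto

text \<open>The way to bound spaces of forms from above: they are the least spaces that start with E
  and absorb multiplication by the variables, so any such family contains them.\<close>

lemma forms_family:
  assumes "set xs \<subseteq> carrier R" "\<And>m. sub (B m)" "E \<subseteq> B k" "\<And>m x. x \<in> set xs \<Longrightarrow> smul x (B m) \<subseteq> B (Suc m)"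
  shows "forms xs m E \<subseteq> B (k + m)"
  using assms
proof (induction xs m E arbitrary: k rule: forms.induct)
  case (2 m E) thus ?case using subD(2)[OF 2(2)] by simp
next
  case (4 x xs m E)
  have "forms xs (Suc m) E \<subseteq> B (k + Suc m)" using 4 by (intro 4(1)) auto
  moreover have "forms (x # xs) m E \<subseteq> B (k + m)" using 4 by (intro 4(2)) auto
  hence "smul x (forms (x # xs) m E) \<subseteq> smul x (B (k + m))" unfolding smul_def by blast
  hence "smul x (forms (x # xs) m E) \<subseteq> B (k + Suc m)" using 4(6)[of x "k + m"] by auto
  ultimately show ?case using add_least[OF 4(4)[of "k + Suc m"]] by simp
qed auto

lemma forms_smul:
  assumes "set xs \<subseteq> carrier R" "sub E" "a \<in> carrier R"
  shows "smul a (forms xs m E) \<subseteq> forms xs m (smul a E)"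
  using assms
proof (induction xs m E rule: forms.induct)
  case (2 m E) thus ?case by (simp add: smul_def)
next
  case (4 x xs m E)
  have x: "x \<in> carrier R" "set xs \<subseteq> carrier R" using 4 by auto
  have s: "sub (forms xs (Suc m) E)" "sub (forms (x # xs) m E)" using 4 by (auto intro!: forms_sub)
  show ?case
    unfolding smul_subset_iff
  proof
    fix e assume "e \<in> forms (x # xs) (Suc m) E"
    then obtain u v where uv: "u \<in> forms xs (Suc m) E" "v \<in> forms (x # xs) m E" "e = u \<oplus> x \<otimes> v"
      by (auto simp: mem_set_add smul_def)
    have c: "u \<in> carrier R" "v \<in> carrier R" using uv s subD(1) by blast+
    have "a \<otimes> u \<in> forms xs (Suc m) (smul a E)" "a \<otimes> v \<in> forms (x # xs) m (smul a E)"
      using 4(1,2) 4(3-5) x uv unfolding smul_subset_iff by auto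
    moreover have "a \<otimes> e = a \<otimes> u \<oplus> x \<otimes> (a \<otimes> v)" unfolding uv(3) using c x 4(5) by (simp add: r_distr m_ac)
    ultimately show "a \<otimes> e \<in> forms (x # xs) (Suc m) (smul a E)"
      by (auto simp: mem_set_add smul_def)
  qed
qed auto

text \<open>The recursion multiplies by the head of the list only; any other y is pushed into both
  summands and commuted past the head.\<close>

lemma forms_step:
  assumes "set xs \<subseteq> carrier R" "sub E" "y \<in> set xs"
  shows "smul y (forms xs m E) \<subseteq> forms xs (Suc m) E"
  using assms
proof (induction xs m E rule: forms.induct)
  case (3 x xs E)
  have s: "sub (forms xs (Suc 0) E)" "sub (smul x E)" using 3 by (auto intro!: forms_sub smul_sub)
  show ?case
  proof (cases "y = x")
    case True thus ?thesis using add_upper(2)[OF s] by (simp add: forms_zero)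
  next
    case False
    \<comment> \<open>In degree zero the recursion makes no call and supplies no induction
      hypothesis, so this case has its own induction on the list.\<close>
    have "smul y (forms xs 0 E) \<subseteq> forms xs (Suc 0) E" if "y \<in> set xs"
      using that 3
    proof (induction xs)
      case (Cons z zs)
      have s: "sub (forms zs (Suc 0) E)" "sub (smul z E)" using Cons.prems by (auto intro!: forms_sub smul_sub)
      show ?case
      proof (cases "y = z")
        case True thus ?thesis using add_upper(2)[OF s] by (simp add: forms_zero)
      next
        case False
        hence "smul y (forms zs 0 E) \<subseteq> forms zs (Suc 0) E" using Cons by auto
        thus ?thesis using add_upper(1)[OF s] by (auto simp: forms_zero)
      qed
    qed auto
    thus ?thesis using False 3 add_upper(1)[OF s] by (auto simp: forms_zero)
  qed
next
  case (4 x xs m E)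
  have x: "x \<in> carrier R" "set xs \<subseteq> carrier R" "y \<in> carrier R" using 4 by auto
  have s: "sub (forms xs (Suc m) E)" "sub (forms (x # xs) m E)" "sub (forms xs (Suc (Suc m)) E)"
    "sub (forms (x # xs) (Suc m) E)"
  proof -
    have "sub (forms xs k E)" "sub (forms (x # xs) k E)" for k by (intro forms_sub; use 4 in auto)+
    thus "sub (forms xs (Suc m) E)" "sub (forms (x # xs) m E)" "sub (forms xs (Suc (Suc m)) E)"
      "sub (forms (x # xs) (Suc m) E)" by blast+
  qed
  have s': "sub (smul x (forms (x # xs) (Suc m) E))" by (rule smul_sub[OF x(1) s(4)])
  show ?case
  proof (cases "y = x")
    case True thus ?thesis using add_upper(2)[OF s(3) s'] by simp
  next
    case False
    hence y: "y \<in> set xs" using 4 by auto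
    have IH1: "smul y (forms xs (Suc m) E) \<subseteq> forms xs (Suc (Suc m)) E" using 4 y by auto
    have IH2: "smul y (forms (x # xs) m E) \<subseteq> forms (x # xs) (Suc m) E" using 4 by auto
    show ?thesis
      unfolding smul_subset_iff
    proof
      fix e assume "e \<in> forms (x # xs) (Suc m) E"
      then obtain u v where uv: "u \<in> forms xs (Suc m) E" "v \<in> forms (x # xs) m E" "e = u \<oplus> x \<otimes> v"
        by (auto simp: mem_set_add smul_def)
      have c: "u \<in> carrier R" "v \<in> carrier R" using uv s subD(1) by blast+
      have "y \<otimes> e = y \<otimes> u \<oplus> x \<otimes> (y \<otimes> v)" unfolding uv(3) using c x by (simp add: r_distr m_ac)
      moreover have "y \<otimes> u \<in> forms xs (Suc (Suc m)) E" using IH1 uv(1) unfolding smul_subset_iff by blast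
      moreover have "x \<otimes> (y \<otimes> v) \<in> smul x (forms (x # xs) (Suc m) E)"
        using IH2 uv(2) unfolding smul_subset_iff smul_def[of x] by blast
      ultimately show "y \<otimes> e \<in> forms (x # xs) (Suc (Suc m)) E"
        unfolding forms.simps(4)[of x xs "Suc m"] by (intro mem_set_addI)
    qed
  qed
qed auto

lemma forms_one_least:
  assumes "set xs \<subseteq> carrier R" "sub B" "\<And>x. x \<in> set xs \<Longrightarrow> smul x E \<subseteq> B"
  shows "forms xs (Suc 0) E \<subseteq> B"
  using assms(1,3)
proof (induction xs)
  case Nil thus ?case using subD(2)[OF assms(2)] by simp
next
  case (Cons x xs)
  hence "forms xs (Suc 0) E \<subseteq> B" "smul x E \<subseteq> B" by auto
  from add_least[OF assms(2) this] show ?case by simp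
qed

lemma forms_forms:
  assumes "set xs \<subseteq> carrier R" "sub E"
  shows "forms xs m (forms xs k E) \<subseteq> forms xs (k + m) E"
  using forms_family[of xs "\<lambda>m. forms xs m E" "forms xs k E" k m] assms forms_sub forms_step by auto

lemma forms_add:
  assumes "set xs \<subseteq> carrier R" "sub E" "sub F"
  shows "forms xs m (E <+>\<^bsub>R\<^esub> F) \<subseteq> forms xs m E <+>\<^bsub>R\<^esub> forms xs m F"
proof -
  define B where "B m = forms xs m E <+>\<^bsub>R\<^esub> forms xs m F" for m
  have "forms xs m (E <+>\<^bsub>R\<^esub> F) \<subseteq> B (0 + m)"
  proof (rule forms_family[OF assms(1)])
    show "sub (B m)" for m unfolding B_def by (intro sub_add forms_sub assms)
    show "E <+>\<^bsub>R\<^esub> F \<subseteq> B 0" unfolding B_def by (simp add: forms_zero)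
    fix m x assume x: "x \<in> set xs"
    have E: "smul x (forms xs m E) \<subseteq> forms xs (Suc m) E" and F: "smul x (forms xs m F) \<subseteq> forms xs (Suc m) F"
      using forms_step[OF assms(1) _ x] assms by auto
    show "smul x (B m) \<subseteq> B (Suc m)"
      unfolding smul_subset_iff
    proof
      fix e assume "e \<in> B m"
      then obtain u v where uv: "u \<in> forms xs m E" "v \<in> forms xs m F" "e = u \<oplus> v"
        unfolding B_def mem_set_add by blast
      have "u \<in> carrier R" "v \<in> carrier R" "x \<in> carrier R"
        using uv subD(1)[OF forms_sub[OF assms(1,2)]] subD(1)[OF forms_sub[OF assms(1,3)]] x assms(1) by auto
      hence "x \<otimes> e = x \<otimes> u \<oplus> x \<otimes> v" unfolding uv(3) by (simp add: r_distr)
      thus "x \<otimes> e \<in> B (Suc m)"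
        unfolding B_def using E F uv(1,2) unfolding smul_subset_iff by (intro mem_set_addI) auto
    qed
  qed
  thus ?thesis unfolding B_def by simp
qed

text \<open>A complement of E in F has \<open>vd F - vd E\<close> generators, and each contributes
  at most \<open>hilb (length xs) m\<close> dimensions.\<close>

lemma vd_forms_diff:
  assumes "set xs \<subseteq> carrier R" "fd F" "sub E" "E \<subseteq> F"
  shows "vd (forms xs m F) \<le> vd (forms xs m E) + hilb (length xs) m * (vd F - vd E)"
proof -
  obtain Vs where V: "F = E <+>\<^bsub>R\<^esub> Span K Vs" "length Vs = vd F - vd E" "vd (Span K Vs) = length Vs" "fd (Span K Vs)"
    using exists_complement[OF assms(2-4)] by metis
  have E: "fd E" by (rule fd_mono[OF assms(2-4)])
  have "vd (forms xs m F) \<le> vd (forms xs m E <+>\<^bsub>R\<^esub> forms xs m (Span K Vs))"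
    using forms_add[OF assms(1,3) fd_sub[OF V(4)]] V(1) assms forms_fd(1)[OF assms(1)] E V(4)
    by (intro vd_mono fd_add forms_sub) (auto intro: fd_sub)
  also have "\<dots> \<le> vd (forms xs m E) + vd (forms xs m (Span K Vs))"
    by (intro vd_add_le forms_fd(1) assms E V)
  also have "\<dots> \<le> vd (forms xs m E) + hilb (length xs) m * (vd F - vd E)"
    using forms_fd(2)[OF assms(1) V(4)] V(2,3) by simp
  finally show ?thesis .
qed

lemma preimage_sub:
  assumes "a \<in> carrier R" "sub V" "sub T" shows "sub {v \<in> V. a \<otimes> v \<in> T}"
proof (rule subI)
  note V = subD[OF assms(2)] and T = subD[OF assms(3)]
  show "x \<oplus> y \<in> {v \<in> V. a \<otimes> v \<in> T}" if "x \<in> {v \<in> V. a \<otimes> v \<in> T}" "y \<in> {v \<in> V. a \<otimes> v \<in> T}" for x y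
    using that V(1,3) T(3)[of "a \<otimes> x" "a \<otimes> y"] assms(1) by (auto simp: r_distr)
  show "k \<otimes> x \<in> {v \<in> V. a \<otimes> v \<in> T}" if kx: "k \<in> K" "x \<in> {v \<in> V. a \<otimes> v \<in> T}" for k x
  proof -
    have "a \<otimes> (k \<otimes> x) = k \<otimes> (a \<otimes> x)" using kx V(1) K_carrier assms(1) by (auto simp: m_ac)
    thus ?thesis using kx V(5) T(5) by auto
  qed
qed (use subD[OF assms(2)] subD[OF assms(3)] assms(1) in auto)

text \<open>Each condition that u a lies in T lowers the dimension by at most q, the bound on the
  codimension of T in W.\<close>

lemma common_preimage:
  assumes "fd V" "fd W" "sub T" "T \<subseteq> W" "set Us \<subseteq> carrier R" "\<And>u. u \<in> set Us \<Longrightarrow> smul u V \<subseteq> W" "vd W \<le> vd T + q"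
  obtains V' where "fd V'" "V' \<subseteq> V" "\<forall>u \<in> set Us. \<forall>a \<in> V'. u \<otimes> a \<in> T" "vd V \<le> vd V' + length Us * q"
proof -
  have T: "fd T" by (rule fd_mono[OF assms(2-4)])
  have "\<exists>V'. fd V' \<and> V' \<subseteq> V \<and> (\<forall>u \<in> set Us. \<forall>a \<in> V'. u \<otimes> a \<in> T) \<and> vd V \<le> vd V' + length Us * q"
    using assms(5,6)
  proof (induction Us)
    case Nil thus ?case using assms(1) by auto
  next
    case (Cons u Us)
    have "\<exists>V'. fd V' \<and> V' \<subseteq> V \<and> (\<forall>u \<in> set Us. \<forall>a \<in> V'. u \<otimes> a \<in> T) \<and> vd V \<le> vd V' + length Us * q"
      using Cons.prems by (intro Cons.IH) auto
    then obtain V1 where V1: "fd V1" "V1 \<subseteq> V" "\<forall>u \<in> set Us. \<forall>a \<in> V1. u \<otimes> a \<in> T" "vd V \<le> vd V1 + length Us * q" by blast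
    have u: "u \<in> carrier R" "smul u V \<subseteq> W" using Cons.prems by auto
    define V2 where "V2 = {v \<in> V1. u \<otimes> v \<in> T}"
    have V2: "sub V2" unfolding V2_def by (rule preimage_sub[OF u(1) fd_sub[OF V1(1)] assms(3)])
    have f2: "fd V2" "V2 \<subseteq> V1" using fd_mono[OF V1(1) V2] unfolding V2_def by auto
    have "vd V1 \<le> vd V2 + q"
    proof (cases "u = \<zero>")
      case True
      have "V2 = V1" unfolding V2_def True using subD(1)[OF fd_sub[OF V1(1)]] subD(2)[OF assms(3)] by auto
      thus ?thesis by simp
    next
      case False
      note s1 = vd_smul[OF u(1) False V1(1)] and s2 = vd_smul[OF u(1) False f2(1)]
      \<comment> \<open>Multiplication by u identifies V2 with the part of u V1 inside T, so the
        dimension formula within W bounds the loss.\<close>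
      have eq: "smul u V1 \<inter> T = smul u V2" unfolding smul_def V2_def by blast
      have "vd (smul u V1 <+>\<^bsub>R\<^esub> T) + vd V2 = vd V1 + vd T"
        using vd_add[OF s1(1) T] unfolding eq s1(2) s2(2) by simp
      moreover have "smul u V1 \<subseteq> W" using u(2) V1(2) unfolding smul_def by blast
      hence "vd (smul u V1 <+>\<^bsub>R\<^esub> T) \<le> vd W"
        by (intro vd_mono assms fd_sub fd_add s1(1) T add_least[OF fd_sub[OF assms(2)]])
      ultimately show ?thesis using assms(7) by linarith
    qed
    thus ?case using V1 f2 by (intro exI[of _ V2]) (auto simp: V2_def)
  qed
  thus thesis using that by blast
qed


text \<open>Suppose \<open>D \<noteq> G 2\<close> and enlarge \<open>D\<close> to a hyperplane \<open>U\<close>. With \<open>S\<close> the polynomial ring in \<open>xs\<close>,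
  the \<open>S\<close>-module \<open>S U\<close> contains all products of two elements of \<open>S (G 1)\<close>. If \<open>h2 \<le> h1\<close>,
  then \<open>S (G 1)\<close>, which has rank \<open>1 + h1\<close>, is so large that some nonzero \<open>a\<close> in it multiplies the remaining
  \<open>h2\<close> generators into \<open>S U\<close> as well. Then the whole ring, of rank \<open>1 + h1 + h2\<close>,
  embeds by multiplication with \<open>a\<close> into \<open>S U\<close>, which has smaller rank.\<close>

lemma degree_one_products_span:
  fixes G :: "nat \<Rightarrow> 'a set" and xs :: "'a list"
  defines "d \<equiv> length xs"
  assumes fdG: "\<And>i. fd (G i)"
    and mult: "\<And>i j x y. \<lbrakk> x \<in> G i; y \<in> G j \<rbrakk> \<Longrightarrow> x \<otimes> y \<in> G (i + j)"
    and G0: "G 0 = K" and xs: "set xs \<subseteq> G 1"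
    and gen: "\<And>m. 2 \<le> m \<Longrightarrow> G (Suc m) \<subseteq> forms xs (Suc 0) (G m)"
    and c1: "vd (G 1) = vd (forms xs (Suc 0) K) + h1"
    and c2: "vd (G 2) = vd (forms xs (Suc 0) (G 1)) + h2"
    and h: "h2 \<le> h1"
    and tot: "\<And>m. vd (G (m + 2)) = hilb d (m + 2) + h1 * hilb d (m + 1) + h2 * hilb d m"
    and D: "sub D" "D \<subseteq> G 2" "\<And>x y. \<lbrakk> x \<in> G 1; y \<in> G 1 \<rbrakk> \<Longrightarrow> x \<otimes> y \<in> D"
  shows "D = G 2"
proof (rule ccontr)
  assume ne: "D \<noteq> G 2"
  have sG: "sub (G i)" for i by (rule fd_sub[OF fdG])
  note Gc = subD(1)[OF sG]
  have xc: "set xs \<subseteq> carrier R" using xs Gc by auto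
  have sK: "sub K" by (rule fd_sub[OF vd_K(1)])
  show False
  proof (cases "xs = []")
    \<comment> \<open>Without variables there is no growth to compare. Then \<open>G 4\<close> is
      zero, and the square of an element of \<open>G 2\<close> outside D contradicts the domain
      property.\<close>
    case True
    have "G 3 \<subseteq> {\<zero>}" "G 4 \<subseteq> {\<zero>}" using gen[of 2] gen[of 3] unfolding True by (simp_all add: numeral_eq_Suc)
    moreover obtain u where u: "u \<in> G 2" "u \<notin> D" using ne D(2) by blast
    moreover have "u \<otimes> u \<in> G 4" using mult[OF u(1) u(1)] by simp
    ultimately have "u \<otimes> u = \<zero>" by blast
    hence "u = \<zero>" using integral[of u u] Gc[OF u(1)] by blast
    thus False using u(2) subD(2)[OF D(1)] by simp
  next
    case False
    then obtain e where d: "d = Suc e" unfolding d_def by (cases xs) auto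
    obtain U where U: "sub U" "D \<subseteq> U" "U \<subseteq> G 2" "Suc (vd U) = vd (G 2)"
      using exists_hyperplane[OF fdG D(1,2) ne] by blast
    have fU: "fd U" by (rule fd_mono[OF fdG U(1,3)])
    \<comment> \<open>Y is the part of \<open>G 2\<close> that S generates from degree one; by
      \<open>c2\<close> it has codimension h2.\<close>
    define Y where "Y = forms xs (Suc 0) (G 1)"
    have Y: "sub Y" "fd Y" unfolding Y_def by (intro forms_sub forms_fd(1) xc sG fdG)+
    have YU: "Y \<subseteq> U"
      unfolding Y_def
    proof (rule forms_one_least[OF xc U(1)])
      fix x assume "x \<in> set xs"
      thus "smul x (G 1) \<subseteq> U" using D(3) U(2) xs unfolding smul_subset_iff by blast
    qed
    have YG: "Y \<subseteq> G 2" using YU U(3) by blast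
    have fG: "forms xs m E \<subseteq> G (k + m)" if "E \<subseteq> G k" for m k E
    proof (rule forms_family[of xs G E k m, OF xc sG that])
      fix m x assume x: "x \<in> set xs"
      show "smul x (G m) \<subseteq> G (Suc m)"
        unfolding smul_subset_iff using mult[of x 1 _ m] x xs by auto
    qed
    have h2: "vd U - vd Y = h2 - 1" "h2 \<ge> 1"
    proof -
      have "vd Y \<le> vd U" by (rule vd_mono[OF fU Y(1) YU])
      thus "vd U - vd Y = h2 - 1" "h2 \<ge> 1" using U(4) c2 unfolding Y_def by auto
    qed
    have F1: "vd (forms xs m Y) \<le> vd (forms xs (Suc m) (G 1))" for m
      using vd_mono[OF forms_fd(1)[OF xc fdG] forms_sub[OF xc Y(1)]] forms_forms[OF xc sG, of m "Suc 0" 1]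
      unfolding Y_def by simp
    \<comment> \<open>\<open>G 1\<close> is S_1 K together with h1 further generators, which bounds
      the rank of S (\<open>G 1\<close>) by 1 + h1.\<close>
    have F2: "vd (forms xs (Suc m) (G 1)) \<le> hilb d (m + 2) + h1 * hilb d (m + 1)" for m
    proof -
      have Ksub: "forms xs (Suc 0) K \<subseteq> G 1" using fG[of K 0 "Suc 0"] G0 by simp
      have "vd (forms xs (Suc m) (G 1)) \<le> vd (forms xs (Suc m) (forms xs (Suc 0) K))
          + hilb d (Suc m) * (vd (G 1) - vd (forms xs (Suc 0) K))"
        unfolding d_def by (rule vd_forms_diff[OF xc fdG forms_sub[OF xc sK] Ksub])
      moreover have "vd (forms xs (Suc m) (forms xs (Suc 0) K)) \<le> vd (forms xs (Suc 0 + Suc m) K)"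
        by (rule vd_mono[OF forms_fd(1)[OF xc vd_K(1)] forms_sub[OF xc forms_sub[OF xc sK]] forms_forms[OF xc sK]])
      moreover have "\<dots> \<le> hilb d (m + 2)"
        using forms_fd(2)[OF xc vd_K(1), of "Suc 0 + Suc m"] vd_K(2) unfolding d_def by simp
      ultimately show ?thesis using c1 by (simp add: mult.commute)
    qed
    have F3: "G (m + 2) \<subseteq> forms xs m (G 2)" for m
    proof (induction m)
      case (Suc m)
      have "G (Suc (m + 2)) \<subseteq> forms xs (Suc 0) (forms xs m (G 2))"
        using gen[of "m + 2"] forms_mono[OF Suc] by fastforce
      also have "\<dots> \<subseteq> forms xs (m + Suc 0) (G 2)" by (rule forms_forms[OF xc sG])
      finally show ?case by simp
    qed (simp add: forms_zero numeral_2_eq_2)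
    have F3v: "vd (G (m + 2)) \<le> vd (forms xs m (G 2))" for m
      by (rule vd_mono[OF forms_fd(1)[OF xc fdG] sG F3])
    \<comment> \<open>Freeness enters as a count: \<open>tot\<close> gives the largest dimension
      that the generators allow. Subtracting the largest possible share of the h2 generators of
      degree two forces S (\<open>G 1\<close>) to have rank 1 + h1.\<close>
    have F4: "hilb d (m + 2) + h1 * hilb d (m + 1) \<le> vd (forms xs (Suc m) (G 1))" for m
    proof -
      have "vd (forms xs m (G 2)) \<le> vd (forms xs m Y) + hilb d m * (vd (G 2) - vd Y)"
        unfolding d_def by (rule vd_forms_diff[OF xc fdG Y(1) YG])
      also have "vd (G 2) - vd Y = h2" using c2 unfolding Y_def by simp
      finally show ?thesis using F3v[of m] F1[of m] tot[of m] by (simp add: mult.commute)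
    qed
    define T where "T m = forms xs m U" for m
    have T: "sub (T m)" "fd (T m)" "T m \<subseteq> G (m + 2)" for m
      unfolding T_def using fG[OF U(3), of m] by (auto intro!: forms_sub forms_fd(1) xc U(1) fU simp: add.commute)
    have Tstep: "x \<otimes> t \<in> T (Suc m)" if "x \<in> set xs" "t \<in> T m" for x t m
      using forms_step[OF xc U(1) that(1), of m] that(2) unfolding T_def smul_subset_iff by blast
    \<comment> \<open>U needs only h2 - 1 generators beyond Y, so the rank of S U is at most h1 +
      h2.\<close>
    have F5: "vd (T m) \<le> hilb d (m + 2) + h1 * hilb d (m + 1) + (h2 - 1) * hilb d m" for m
    proof -
      have "vd (T m) \<le> vd (forms xs m Y) + hilb d m * (vd U - vd Y)"
        unfolding d_def T_def by (rule vd_forms_diff[OF xc fU Y(1) YU])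
      thus ?thesis using F1[of m] F2[of m] h2(1) by (simp add: mult.commute)
    qed
    \<comment> \<open>As U is a hyperplane, S U has corank at most one. This count stands for the
      values of \<psi> in S(-2).\<close>
    have F6: "vd (G (m + 2)) \<le> vd (T m) + hilb d m" for m
    proof -
      have "vd (forms xs m (G 2)) \<le> vd (T m) + hilb d m * (vd (G 2) - vd U)"
        unfolding d_def T_def by (rule vd_forms_diff[OF xc fdG U(1,3)])
      moreover have "vd (G 2) - vd U = 1" using U(4) by simp
      ultimately show ?thesis using F3v[of m] by simp
    qed
    \<comment> \<open>This is the isotropy. In a (x g) = x (g a) the factor g of degree one meets
      the factors of degree one in a, and \<open>G 1\<close> times \<open>G 1\<close> lies in
      U.\<close>
    have F7: "a \<otimes> b \<in> T (Suc n)" if a: "a \<in> forms xs n (G 1)" and b: "b \<in> Y" for a b n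
    proof -
      have ac: "a \<in> carrier R" using a subD(1)[OF forms_sub[OF xc sG]] by blast
      have "Y \<subseteq> {b \<in> carrier R. a \<otimes> b \<in> T (Suc n)}"
        unfolding Y_def
      proof (rule forms_one_least[OF xc preimage_sub[OF ac carrier_is_subalgebra[OF K_carrier] T(1)]])
        fix x assume x: "x \<in> set xs"
        show "smul x (G 1) \<subseteq> {b \<in> carrier R. a \<otimes> b \<in> T (Suc n)}"
          unfolding smul_subset_iff
        proof
          fix g assume g: "g \<in> G 1"
          have c: "g \<in> carrier R" "x \<in> carrier R" using g Gc x xc by auto
          have "smul g (G 1) \<subseteq> U" using D(3)[OF g] U(2) unfolding smul_subset_iff by blast
          hence "forms xs n (smul g (G 1)) \<subseteq> T n" unfolding T_def by (rule forms_mono)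
          hence "g \<otimes> a \<in> T n" using forms_smul[OF xc sG c(1), of n 1] a unfolding smul_subset_iff by blast
          hence "x \<otimes> (g \<otimes> a) \<in> T (Suc n)" by (rule Tstep[OF x])
          moreover have "a \<otimes> (x \<otimes> g) = x \<otimes> (g \<otimes> a)" using ac c by (simp add: m_ac)
          ultimately show "x \<otimes> g \<in> {b \<in> carrier R. a \<otimes> b \<in> T (Suc n)}" using c by simp
        qed
      qed
      thus ?thesis using b by blast
    qed
    \<comment> \<open>Here h2 \<le> h1 enters: S (\<open>G 1\<close>) has rank 1 + h1 > h2, so in a
      large degree its dimension exceeds the cost of the h2 conditions imposed below.\<close>
    obtain n where n: "h2 * hilb d (Suc n) < vd (forms xs n (G 1))"
    proof -
      obtain k where k: "1 \<le> k" "h1 * hilb d (k + 1) < (h1 + 1) * hilb d k"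
        using hilb_growth[of 1 h1 e 1] unfolding d by blast
      obtain m where m: "k = Suc m" using k(1) by (cases k) auto
      have "h2 * hilb d (k + 1) \<le> h1 * hilb d (k + 1)" using h by (rule mult_le_mono1)
      also have "\<dots> < h1 * hilb d k + hilb d k" using k by simp
      also have "\<dots> \<le> h1 * hilb d k + hilb d (k + 1)"
        using hilb_mono[of k "k + 1" e] unfolding d by simp
      also have "\<dots> \<le> vd (forms xs k (G 1))" using F4[of m] unfolding m by (simp add: add.commute)
      finally show thesis using that[of k] by simp
    qed
    define A where "A = forms xs n (G 1)"
    have A: "fd A" "A \<subseteq> G (Suc n)" unfolding A_def using fG[of "G 1" 1 n] by (auto intro!: forms_fd(1) xc fdG)
    obtain Vs where Vs: "set Vs \<subseteq> G 2" "G 2 = Y <+>\<^bsub>R\<^esub> Span K Vs" "length Vs = vd (G 2) - vd Y"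
      using exists_complement[OF fdG Y(1) YG] by metis
    have Vc: "set Vs \<subseteq> carrier R" using Vs(1) Gc by auto
    have lV: "length Vs = h2" using Vs(3) c2 unfolding Y_def by simp
    \<comment> \<open>There is one condition for each of the h2 generators in \<open>Vs\<close>, and
      by \<open>F6\<close> each costs at most \<open>hilb d (Suc n)\<close> dimensions.\<close>
    obtain V' where V': "fd V'" "V' \<subseteq> A" "\<forall>u \<in> set Vs. \<forall>a \<in> V'. u \<otimes> a \<in> T (Suc n)"
      "vd A \<le> vd V' + length Vs * hilb d (Suc n)"
    proof (rule common_preimage[OF A(1) fdG T(1) T(3) Vc _ F6])
      fix u assume "u \<in> set Vs"
      thus "smul u A \<subseteq> G (Suc n + 2)"
        unfolding smul_subset_iff using mult[of u 2 _ "Suc n"] A(2) Vs(1) by (auto simp: add.commute)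
    qed
    have "vd V' > 0" using V'(4) n lV unfolding A_def by simp
    then obtain a where a: "a \<in> V'" "a \<noteq> \<zero>" using vd_pos_nonzero[OF V'(1)] by blast
    have aA: "a \<in> A" "a \<in> carrier R" using a V'(2) A(2) Gc by blast+
    have aG2: "smul a (G 2) \<subseteq> T (Suc n)"
    proof -
      have s: "sub {b \<in> carrier R. a \<otimes> b \<in> T (Suc n)}"
        by (rule preimage_sub[OF aA(2) carrier_is_subalgebra[OF K_carrier] T(1)])
      have "set Vs \<subseteq> {b \<in> carrier R. a \<otimes> b \<in> T (Suc n)}"
        using V'(3) a(1) Vc m_comm[OF aA(2)] by auto
      hence "Span K Vs \<subseteq> {b \<in> carrier R. a \<otimes> b \<in> T (Suc n)}" by (rule subalgebra_Span_incl[OF K s])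
      moreover have "Y \<subseteq> {b \<in> carrier R. a \<otimes> b \<in> T (Suc n)}"
        using F7[of a n] aA subD(1)[OF Y(1)] unfolding A_def by blast
      ultimately have "G 2 \<subseteq> {b \<in> carrier R. a \<otimes> b \<in> T (Suc n)}" unfolding Vs(2) by (intro add_least[OF s])
      thus ?thesis unfolding smul_subset_iff by blast
    qed
    \<comment> \<open>\<open>G 2\<close> generates all higher degrees over S, so multiplication by a
      embeds the part of R in degrees at least two into S U.\<close>
    have F8: "vd (G (k + 2)) \<le> vd (T (Suc n + k))" for k
    proof -
      have "smul a (G (k + 2)) \<subseteq> smul a (forms xs k (G 2))" using F3 unfolding smul_def by blast
      also have "\<dots> \<subseteq> forms xs k (smul a (G 2))" by (rule forms_smul[OF xc sG aA(2)])
      also have "\<dots> \<subseteq> forms xs k (T (Suc n))" by (rule forms_mono[OF aG2])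
      also have "\<dots> \<subseteq> T (Suc n + k)" unfolding T_def by (rule forms_forms[OF xc U(1)])
      finally have "vd (smul a (G (k + 2))) \<le> vd (T (Suc n + k))"
        by (intro vd_mono T smul_sub aA sG)
      thus ?thesis using vd_smul(2)[OF aA(2) a(2) fdG] by simp
    qed
    \<comment> \<open>The rank 1 + h1 + h2 of the source exceeds the rank h1 + h2 of the target. The
      shift n + 3 comes from the largest argument of \<open>hilb\<close> in \<open>F5\<close> at
      degree \<open>Suc n + k\<close>.\<close>
    obtain k where k: "(h1 + h2) * hilb d (k + (n + 3)) < (h1 + h2 + 1) * hilb d k"
      using hilb_growth[of 0 "h1 + h2" e "n + 3"] unfolding d by blast
    have "(h1 + h2 + 1) * hilb d k \<le> vd (G (k + 2))"
    proof -
      have "hilb d k \<le> hilb d (k + 2)" "hilb d k \<le> hilb d (k + 1)" using hilb_mono[of k] unfolding d by simp_all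
      hence "hilb d k + h1 * hilb d k + h2 * hilb d k \<le> hilb d (k + 2) + h1 * hilb d (k + 1) + h2 * hilb d k"
        by (intro add_mono mult_le_mono2) auto
      thus ?thesis unfolding tot by (simp add: algebra_simps)
    qed
    also have "\<dots> \<le> vd (T (Suc n + k))" by (rule F8)
    also have "\<dots> \<le> hilb d (Suc n + k + 2) + h1 * hilb d (Suc n + k + 1) + (h2 - 1) * hilb d (Suc n + k)" by (rule F5)
    also have "\<dots> \<le> hilb d (k + (n + 3)) + h1 * hilb d (k + (n + 3)) + (h2 - 1) * hilb d (k + (n + 3))"
      unfolding d by ((intro add_mono mult_le_mono2; rule hilb_mono), simp_all)
    also have "\<dots> = (h1 + h2) * hilb d (k + (n + 3))"
      using h2(2) by (cases h2) (auto simp: algebra_simps)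
    finally show False using k by simp
  qed
qed

end

section \<open>Graded domains\<close>

locale graded_domain = graded_cring R G + noetherian_ring R + domain R for R (structure) and G +
  assumes ground_field: "subfield (G 0) R"

sublocale graded_domain \<subseteq> noetherian_cring R
  by (intro noetherian_cring.intro noetherian_ring_axioms cring_axioms)

sublocale graded_domain \<subseteq> domain_over_field R "G 0"
  by (intro domain_over_field.intro domain_over_field_axioms.intro domain_axioms ground_field)

context graded_domain
begin

lemma G_closed:
  shows "\<And>x. x \<in> G i \<Longrightarrow> x \<in> carrier R" "\<zero> \<in> G i" "\<And>x y. \<lbrakk> x \<in> G i; y \<in> G i \<rbrakk> \<Longrightarrow> x \<oplus> y \<in> G i"
    "\<And>x. x \<in> G i \<Longrightarrow> \<ominus> x \<in> G i"
  using subgroup.mem_carrier[OF component_subgroup[of i]] subgroup.one_closed[OF component_subgroup[of i]]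
    subgroup.m_closed[OF component_subgroup[of i]] subgroup.m_inv_closed[OF component_subgroup[of i]]
  by (auto simp: a_inv_def)

section \<open>Homogeneous components and the irrelevant ideal\<close>

definition cmp :: "'a \<Rightarrow> nat \<Rightarrow> 'a" where
  "cmp x = (THE f. (\<forall>i. f i \<in> G i) \<and> finite {i. f i \<noteq> \<zero>} \<and> x = finsum R f {i. f i \<noteq> \<zero>})"

lemma cmp_props:
  assumes "x \<in> carrier R"
  shows "cmp x i \<in> G i" "finite {i. cmp x i \<noteq> \<zero>}" "finsum R (cmp x) {i. cmp x i \<noteq> \<zero>} = x"
  using theI'[OF decomposition[OF assms]] unfolding cmp_def[symmetric] by auto

lemma cmp_closed: "x \<in> carrier R \<Longrightarrow> cmp x i \<in> carrier R"
  using cmp_props(1) G_closed(1) by blast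

lemma cmp_unique:
  assumes "\<And>i. f i \<in> G i" "finite A" "\<And>i. i \<notin> A \<Longrightarrow> f i = \<zero>" "x = finsum R f A"
  shows "cmp x = f"
proof -
  have fc: "f \<in> B \<rightarrow> carrier R" for B using assms(1) G_closed(1) by blast
  have x: "x \<in> carrier R" unfolding assms(4) by (rule finsum_closed[OF fc])
  have sub: "{i. f i \<noteq> \<zero>} \<subseteq> A" using assms(3) by blast
  have "x = finsum R f {i. f i \<noteq> \<zero>}"
    unfolding assms(4) using sub assms(2) fc
    by (intro add.finprod_mono_neutral_cong_left[symmetric]) auto
  hence "(\<forall>i. f i \<in> G i) \<and> finite {i. f i \<noteq> \<zero>} \<and> x = finsum R f {i. f i \<noteq> \<zero>}"
    using assms(1) finite_subset[OF sub assms(2)] by blast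
  thus ?thesis unfolding cmp_def using the1_equality[OF decomposition[OF x]] by blast
qed

lemma finsum_cmp:
  assumes "x \<in> carrier R" "finite A" "{i. cmp x i \<noteq> \<zero>} \<subseteq> A"
  shows "finsum R (cmp x) A = x"
proof -
  have "finsum R (cmp x) A = finsum R (cmp x) {i. cmp x i \<noteq> \<zero>}"
    using assms cmp_closed[OF assms(1)] by (intro add.finprod_mono_neutral_cong_right) auto
  thus ?thesis using cmp_props(3)[OF assms(1)] by simp
qed

lemma cmp_add:
  assumes "x \<in> carrier R" "y \<in> carrier R" shows "cmp (x \<oplus> y) i = cmp x i \<oplus> cmp y i"
proof -
  define A where "A = {i. cmp x i \<noteq> \<zero>} \<union> {i. cmp y i \<noteq> \<zero>}"
  have A: "finite A" unfolding A_def using cmp_props(2) assms by auto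
  have "cmp (x \<oplus> y) = (\<lambda>i. cmp x i \<oplus> cmp y i)"
  proof (rule cmp_unique[OF _ A])
    have "finsum R (\<lambda>i. cmp x i \<oplus> cmp y i) A = finsum R (cmp x) A \<oplus> finsum R (cmp y) A"
      using cmp_closed assms by (intro finsum_addf) auto
    thus "x \<oplus> y = finsum R (\<lambda>i. cmp x i \<oplus> cmp y i) A"
      using finsum_cmp[OF assms(1) A] finsum_cmp[OF assms(2) A] unfolding A_def by auto
  qed (use assms cmp_props(1) G_closed(3) in \<open>auto simp: A_def\<close>)
  thus ?thesis by simp
qed

lemma cmp_homogeneous:
  assumes "x \<in> G i" shows "cmp x j = (if j = i then x else \<zero>)"
proof -
  have "cmp x = (\<lambda>j. if j = i then x else \<zero>)"
    using assms G_closed by (intro cmp_unique[of _ "{i}"]) (auto simp: finsum_singleton)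
  thus ?thesis by simp
qed

lemma cmp_zero: "cmp \<zero> j = \<zero>"
  using cmp_homogeneous[OF G_closed(2)[of j], of j] by simp

lemma cmp_minus:
  assumes "x \<in> carrier R" shows "cmp (\<ominus> x) i = \<ominus> cmp x i"
proof -
  have "cmp (\<ominus> x) i \<oplus> cmp x i = \<zero>" using cmp_add[of "\<ominus> x" x i] assms by (simp add: l_neg cmp_zero)
  thus ?thesis using minus_equality cmp_closed assms by simp
qed

lemma cmp_diff:
  "\<lbrakk> x \<in> carrier R; y \<in> carrier R \<rbrakk> \<Longrightarrow> cmp (x \<ominus> y) i = cmp x i \<ominus> cmp y i"
  by (simp add: a_minus_def cmp_add cmp_minus)

lemma mem_of_cmp:
  assumes "x \<in> carrier R" "\<zero> \<in> H" "H \<subseteq> carrier R" "\<And>a b. \<lbrakk> a \<in> H; b \<in> H \<rbrakk> \<Longrightarrow> a \<oplus> b \<in> H" "\<And>i. cmp x i \<in> H"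
  shows "x \<in> H"
proof -
  have "finsum R (cmp x) A \<in> H" if "finite A" for A
    using that
  proof (induction A)
    case (insert i A)
    have "finsum R (cmp x) (insert i A) = cmp x i \<oplus> finsum R (cmp x) A"
      using insert cmp_closed[OF assms(1)] by (intro finsum_insert) auto
    thus ?case using insert assms(4,5) by simp
  qed (use assms in simp)
  thus ?thesis using cmp_props(2,3)[OF assms(1)] by metis
qed

lemma cmp_finsum:
  assumes "finite A" "f \<in> A \<rightarrow> carrier R" shows "cmp (finsum R f A) k = finsum R (\<lambda>i. cmp (f i) k) A"
  using assms
proof (induction A)
  case (insert i A)
  have 1: "finsum R f (insert i A) = f i \<oplus> finsum R f A" using insert by (intro finsum_insert) auto
  have 2: "finsum R (\<lambda>i. cmp (f i) k) (insert i A) = cmp (f i) k \<oplus> finsum R (\<lambda>i. cmp (f i) k) A"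
    using insert cmp_closed by (intro finsum_insert) auto
  show ?case unfolding 1 2 using insert by (subst cmp_add) (auto intro!: finsum_closed)
qed (simp add: cmp_zero)

lemma cmp_mult_homogeneous:
  assumes x: "x \<in> carrier R" and a: "a \<in> G i"
  shows "cmp (x \<otimes> a) k = (if i \<le> k then cmp x (k - i) \<otimes> a else \<zero>)"
proof -
  have ac: "a \<in> carrier R" using a G_closed(1) by blast
  define A where "A = {i. cmp x i \<noteq> \<zero>}"
  have A: "finite A" unfolding A_def by (rule cmp_props(2)[OF x])
  have "cmp (x \<otimes> a) = (\<lambda>k. if i \<le> k then cmp x (k - i) \<otimes> a else \<zero>)"
  proof (rule cmp_unique[of _ "(\<lambda>j. j + i) ` A"])
    show "(if i \<le> k then cmp x (k - i) \<otimes> a else \<zero>) \<in> G k" for k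
      using component_mult[OF cmp_props(1)[OF x] a, of "k - i"] G_closed(2) by auto
    show "finite ((\<lambda>j. j + i) ` A)" using A by simp
    show "(if i \<le> k then cmp x (k - i) \<otimes> a else \<zero>) = \<zero>" if "k \<notin> (\<lambda>j. j + i) ` A" for k
    proof (cases "i \<le> k")
      case True
      hence "k = (k - i) + i" by simp
      hence "k - i \<notin> A" using that by blast
      thus ?thesis using ac unfolding A_def by simp
    qed simp
    have "finsum R (\<lambda>k. if i \<le> k then cmp x (k - i) \<otimes> a else \<zero>) ((\<lambda>j. j + i) ` A)
        = finsum R (\<lambda>j. cmp x j \<otimes> a) A"
      using cmp_closed[OF x] ac by (subst finsum_reindex) auto
    also have "\<dots> = finsum R (cmp x) A \<otimes> a"
      using cmp_closed[OF x] ac A by (intro finsum_ldistr[symmetric]) auto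
    also have "\<dots> = x \<otimes> a" using finsum_cmp[OF x A] unfolding A_def by simp
    finally show "x \<otimes> a = finsum R (\<lambda>k. if i \<le> k then cmp x (k - i) \<otimes> a else \<zero>) ((\<lambda>j. j + i) ` A)" by simp
  qed
  thus ?thesis by simp
qed

text \<open>The filtration by lowest degree: it is multiplicative, so powers of an element of the
  irrelevant ideal move to arbitrarily high degrees.\<close>

definition D :: "nat \<Rightarrow> 'a set" where
  "D n = {x \<in> carrier R. \<forall>k < n. cmp x k = \<zero>}"

lemma D_mult:
  assumes "x \<in> D m" "y \<in> D n" shows "x \<otimes> y \<in> D (m + n)"
proof -
  have c: "x \<in> carrier R" "y \<in> carrier R" using assms unfolding D_def by auto
  have "cmp (x \<otimes> y) k = \<zero>" if k: "k < m + n" for k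
  proof -
    define A where "A = {i. cmp y i \<noteq> \<zero>}"
    have A: "finite A" unfolding A_def by (rule cmp_props(2)[OF c(2)])
    have yA: "cmp y \<in> A \<rightarrow> carrier R" using cmp_closed[OF c(2)] by auto
    have "x \<otimes> y = x \<otimes> finsum R (cmp y) A" using finsum_cmp[OF c(2) A] unfolding A_def by simp
    also have "\<dots> = finsum R (\<lambda>i. x \<otimes> cmp y i) A" by (rule finsum_rdistr[OF A c(1) yA])
    finally have "cmp (x \<otimes> y) k = finsum R (\<lambda>i. cmp (x \<otimes> cmp y i) k) A"
      using cmp_finsum[OF A, of "\<lambda>i. x \<otimes> cmp y i"] c(1) yA by auto
    also have "\<dots> = finsum R (\<lambda>i. \<zero>) A"
    proof (rule finsum_cong')
      fix i assume "i \<in> A"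
      hence i: "n \<le> i" using assms(2) unfolding A_def D_def by (auto simp: not_less[symmetric])
      have "cmp x (k - i) = \<zero>" if "i \<le> k" using assms(1) i k that unfolding D_def by auto
      thus "cmp (x \<otimes> cmp y i) k = \<zero>"
        using cmp_mult_homogeneous[OF c(1) cmp_props(1)[OF c(2)], of i k] cmp_closed[OF c(2)] by auto
    qed auto
    finally show ?thesis by simp
  qed
  thus ?thesis using c unfolding D_def by auto
qed

definition M :: "'a set" where "M = D 1"

lemma M_iff: "x \<in> M \<longleftrightarrow> x \<in> carrier R \<and> cmp x 0 = \<zero>"
  unfolding M_def D_def by auto

lemma one_G: "\<one> \<in> G 0"
  using subringE(3)[OF subfieldE(1)[OF ground_field]] .

lemma G_unit:
  assumes "a \<in> G 0" "a \<noteq> \<zero>" shows "\<exists>b \<in> G 0. b \<otimes> a = \<one>"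
  using subfield_m_inv[OF ground_field, of a] assms by (intro bexI[of _ "inv a"]) auto

text \<open>An element outside M differs by an element of M from its degree zero component, which is
  a unit.\<close>

lemma M_maximal: "maximalideal M R"
proof (rule maximalidealI)
  show I: "ideal M R"
  proof (rule idealI[OF ring_axioms])
    have "\<zero> \<in> M" by (simp add: M_iff cmp_zero)
    hence "M \<noteq> {}" by blast
    thus "subgroup M (add_monoid R)"
      by (intro add.subgroupI) (auto simp: M_iff cmp_add cmp_minus a_inv_def[symmetric])
    fix a x assume ax: "a \<in> M" "x \<in> carrier R"
    have "x \<in> D 0" "a \<in> D 1" using ax unfolding M_def D_def by auto
    thus "x \<otimes> a \<in> M" using D_mult[of x 0 a 1] unfolding M_def by simp
    thus "a \<otimes> x \<in> M" using ax m_comm unfolding M_iff by auto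
  qed
  have "\<one> \<notin> M" unfolding M_iff using cmp_homogeneous[OF one_G, of 0] by simp
  thus "carrier R \<noteq> M" by auto
  fix J assume J: "ideal J R" "M \<subseteq> J" "J \<subseteq> carrier R"
  show "J = M \<or> J = carrier R"
  proof (rule disjCI)
    note JC = ideal_closed[OF J(1)]
    assume "J \<noteq> carrier R"
    have "x \<in> M" if x: "x \<in> J" for x
    proof (rule ccontr)
      assume n: "x \<notin> M"
      have xc: "x \<in> carrier R" by (rule JC(1)[OF x])
      have x0: "cmp x 0 \<in> G 0" "cmp x 0 \<noteq> \<zero>" "cmp x 0 \<in> carrier R"
        using n xc cmp_props(1) cmp_closed unfolding M_iff by auto
      have "x \<ominus> cmp x 0 \<in> M"
        unfolding M_iff using xc x0 by (simp add: cmp_diff cmp_homogeneous[OF x0(1)])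
      hence "x \<ominus> (x \<ominus> cmp x 0) \<in> J" using J(2) x JC by blast
      moreover have "x \<ominus> (x \<ominus> cmp x 0) = cmp x 0" using xc x0(3) by algebra
      ultimately have "cmp x 0 \<in> J" by simp
      moreover obtain b where "b \<in> G 0" "b \<otimes> cmp x 0 = \<one>" using G_unit[OF x0(1,2)] by blast
      ultimately have "\<one> \<in> J" using JC(6)[of "cmp x 0" b] G_closed(1) by auto
      thus False using ideal.one_imp_carrier[OF J(1)] \<open>J \<noteq> carrier R\<close> by simp
    qed
    thus "J = M" using J(2) by blast
  qed
qed

lemma M_prime: "primeideal M R"
  by (rule maximalideal_prime[OF M_maximal])

lemma G_pos_M: "0 < i \<Longrightarrow> G i \<subseteq> M"
  using cmp_homogeneous[of _ i 0] G_closed(1) unfolding M_iff subset_iff by auto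

section \<open>Homogeneous ideals\<close>

definition homog :: "'a set \<Rightarrow> bool" where
  "homog J \<longleftrightarrow> (\<forall>x \<in> J. \<forall>i. cmp x i \<in> J)"

lemma homog_zero: "homog {\<zero>}"
  unfolding homog_def using cmp_zero by simp

lemma cmp_adjoin:
  assumes "ideal J R" "x \<in> G k" "j \<in> J" "c \<in> carrier R"
  shows "cmp (j \<oplus> c \<otimes> x) i = cmp j i \<oplus> (if k \<le> i then cmp c (i - k) \<otimes> x else \<zero>)"
  using assms ideal_closed(1)[OF assms(1)] G_closed(1)
  by (subst cmp_add) (auto simp: cmp_mult_homogeneous)

lemma homog_adjoin:
  assumes "ideal J R" "homog J" "x \<in> G k" shows "homog (adjoin J x)"
  unfolding homog_def
proof (intro ballI allI)
  fix r i assume "r \<in> adjoin J x"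
  then obtain j c where h: "j \<in> J" "c \<in> carrier R" "r = j \<oplus> c \<otimes> x" by (elim adjoinE)
  have xc: "x \<in> carrier R" using assms G_closed(1) by blast
  have cj: "cmp j i \<in> J" using assms(2) h(1) unfolding homog_def by blast
  hence cjc: "cmp j i \<in> carrier R" using ideal_closed(1)[OF assms(1)] by blast
  show "cmp r i \<in> adjoin J x"
  proof (cases "k \<le> i")
    case True
    thus ?thesis
      unfolding h(3) cmp_adjoin[OF assms(1,3) h(1,2)] using cj cmp_closed[OF h(2)]
      by (intro adjoinI[of "cmp j i" J "cmp c (i - k)"]) auto
  next
    case False
    thus ?thesis
      unfolding h(3) cmp_adjoin[OF assms(1,3) h(1,2)] using cj cjc xc
      by (intro adjoinI[of "cmp j i" J \<zero>]) auto
  qed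
qed

lemma homog_adjoins:
  assumes "ideal J R" "homog J" "set xs \<subseteq> G k" shows "homog (adjoins J xs)"
  using assms
proof (induction xs arbitrary: J)
  case (Cons x xs)
  have "x \<in> carrier R" using Cons.prems G_closed(1) by auto
  thus ?case using Cons homog_adjoin adjoin_ideal by auto
qed simp

text \<open>An element s outside M has a unit as degree zero component, and the degree i component
  of s a is this unit times a. So localizing at M loses nothing on homogeneous elements.\<close>

lemma satur_homogeneous:
  assumes "ideal J R" "homog J" "a \<in> G i" "a \<in> satur M J" shows "a \<in> J"
proof -
  obtain s where s: "s \<in> carrier R" "s \<notin> M" "s \<otimes> a \<in> J" using assms(4) by (elim saturE)
  have ac: "a \<in> carrier R" using assms(3) G_closed(1) by blast
  have s0: "cmp s 0 \<in> G 0" "cmp s 0 \<noteq> \<zero>" "cmp s 0 \<in> carrier R"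
    using s cmp_props(1) cmp_closed unfolding M_iff by auto
  have "cmp (s \<otimes> a) i \<in> J" using assms(2) s(3) unfolding homog_def by blast
  hence *: "cmp s 0 \<otimes> a \<in> J" using cmp_mult_homogeneous[OF s(1) assms(3), of i] by simp
  obtain b where b: "b \<in> G 0" "b \<otimes> cmp s 0 = \<one>" using G_unit[OF s0(1,2)] by blast
  have bc: "b \<in> carrier R" using b(1) G_closed(1) by blast
  have "b \<otimes> (cmp s 0 \<otimes> a) \<in> J" using ideal_closed(6)[OF assms(1) * bc] .
  moreover have "b \<otimes> (cmp s 0 \<otimes> a) = a" using bc s0 ac b(2) by (simp add: m_assoc[symmetric])
  ultimately show ?thesis by simp
qed

lemma sub_G: "subalgebra (G 0) (G i) R"
  using G_closed component_mult[of _ 0 _ i] by (intro subI) auto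

text \<open>All generators have degree k, so only the degree n parts of the coefficients contribute
  to the component of degree n + k.\<close>

lemma cmp_adjoins_mem:
  assumes "set us \<subseteq> G k" "r \<in> adjoins {\<zero>} us" "subalgebra (G 0) H R"
    "\<And>u w. \<lbrakk> u \<in> set us; w \<in> G n \<rbrakk> \<Longrightarrow> w \<otimes> u \<in> H"
  shows "cmp r (n + k) \<in> H"
  using assms(1,2,4)
proof (induction us arbitrary: r rule: rev_induct)
  case Nil
  thus ?case using subD(2)[OF assms(3)] cmp_zero by simp
next
  case (snoc u us)
  have uc: "set us \<subseteq> carrier R" using snoc.prems G_closed(1) by auto
  obtain j c where h: "j \<in> adjoins {\<zero>} us" "c \<in> carrier R" "r = j \<oplus> c \<otimes> u"
    using snoc.prems(2) by (auto elim!: adjoinE)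
  have "cmp j (n + k) \<in> H" using snoc h by auto
  moreover have "cmp c n \<otimes> u \<in> H" using snoc.prems(3) cmp_props(1)[OF h(2)] by auto
  ultimately show ?case
    unfolding h(3) using cmp_adjoin[OF adjoins_ideal[OF zeroideal uc] _ h(1,2), of u k "n + k"] snoc.prems(1)
      subD(3)[OF assms(3)] by auto
qed

text \<open>An ideal maximal among those generated by finitely many elements of \<open>G i\<close>
  must absorb every element of \<open>G i\<close>.\<close>

lemma G_in_adjoins:
  obtains us where "set us \<subseteq> G i" "G i \<subseteq> adjoins {\<zero>} us"
proof -
  obtain J where J: "ideal J R" "{\<zero>} \<subseteq> J" "\<exists>us. set us \<subseteq> G i \<and> J = adjoins {\<zero>} us"
    "\<forall>J'. ideal J' R \<and> J \<subseteq> J' \<and> (\<exists>us. set us \<subseteq> G i \<and> J' = adjoins {\<zero>} us) \<longrightarrow> J' = J"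
    by (rule exists_maximal_ideal[of "{\<zero>}" "\<lambda>J. \<exists>us. set us \<subseteq> G i \<and> J = adjoins {\<zero>} us", OF zeroideal])
      (auto intro: exI[of _ "[]"])
  then obtain us where us: "set us \<subseteq> G i" "J = adjoins {\<zero>} us" by blast
  have "g \<in> J" if g: "g \<in> G i" for g
  proof -
    have gc: "g \<in> carrier R" using g G_closed(1) by blast
    have "adjoin J g = J"
    proof (rule J(4)[rule_format], intro conjI)
      show "\<exists>us. set us \<subseteq> G i \<and> adjoin J g = adjoins {\<zero>} us"
        using us g by (intro exI[of _ "us @ [g]"]) auto
    qed (use adjoin_ideal[OF J(1) gc] adjoin_incl(1)[OF J(1) gc] in auto)
    thus ?thesis using adjoin_incl(2)[OF J(1) gc] by simp
  qed
  thus thesis using that us by blast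
qed

text \<open>In degree i the ideal generated by \<open>us\<close> uses only coefficients from
  \<open>G 0\<close>, so the ideal generators span the component.\<close>

lemma fd_G: "finite_dimension (G 0) (G i)"
proof -
  obtain us where us: "set us \<subseteq> G i" "G i \<subseteq> adjoins {\<zero>} us" by (rule G_in_adjoins)
  have uc: "set us \<subseteq> carrier R" using us(1) G_closed(1) by auto
  have S: "subalgebra (G 0) (Span (G 0) us) R" by (rule Span_is_subalgebra[OF ground_field uc])
  have "G i \<subseteq> Span (G 0) us"
  proof
    fix g assume g: "g \<in> G i"
    have "cmp g (0 + i) \<in> Span (G 0) us"
      using us g Span_base_incl[OF ground_field uc] subD(5)[OF S] by (intro cmp_adjoins_mem[OF us(1) _ S]) auto
    thus "g \<in> Span (G 0) us" using cmp_homogeneous[OF g, of i] by simp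
  qed
  thus ?thesis by (intro fd_mono[OF Span_finite_dimension[OF ground_field uc] sub_G])
qed

section \<open>Hilbert functions of quotients by homogeneous ideals\<close>

definition corank :: "'a set \<Rightarrow> nat \<Rightarrow> int" where
  "corank J i = int (dim (G 0) (G i)) - int (dim (G 0) (J \<inter> G i))"

lemma sub_inter: "ideal J R \<Longrightarrow> subalgebra (G 0) (J \<inter> G i) R"
  by (intro subalgebra_inter sub_G ideal_is_subalgebra[OF K_carrier])

lemma fd_inter: "ideal J R \<Longrightarrow> finite_dimension (G 0) (J \<inter> G i)"
  by (rule fd_mono[OF fd_G sub_inter]) auto

text \<open>This counts the exact sequence 0 -> (R/J)(-1) -> R/J -> R/(J, x) -> 0, whose first map
  is multiplication by x.\<close>

lemma corank_adjoin:
  assumes J: "ideal J R" "homog J" and x: "x \<in> G 1" "x \<noteq> \<zero>" and nz: "nzd (satur M J) x"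
  shows "corank (adjoin J x) 0 = corank J 0" "corank (adjoin J x) (Suc i) = corank J (Suc i) - corank J i"
proof -
  have xc: "x \<in> carrier R" using x G_closed(1) by blast
  have mem: "r \<in> J \<inter> G i \<or> (\<exists>c j. i = Suc n \<and> c \<in> G n \<and> j \<in> J \<inter> G i \<and> r = x \<otimes> c \<oplus> j)"
    if r: "r \<in> adjoin J x" "r \<in> G i" "i = 0 \<or> i = Suc n" for r i n
  proof -
    obtain j c where h: "j \<in> J" "c \<in> carrier R" "r = j \<oplus> c \<otimes> x" using r(1) by (elim adjoinE)
    have jc: "j \<in> carrier R" using h(1) ideal_closed(1)[OF J(1)] by blast
    have ji: "cmp j i \<in> J \<inter> G i" using J(2) h(1) cmp_props(1)[OF jc] unfolding homog_def by blast
    have eq: "r = cmp j i \<oplus> (if 1 \<le> i then cmp c (i - 1) \<otimes> x else \<zero>)"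
      using cmp_homogeneous[OF r(2), of i] cmp_adjoin[OF J(1) x(1) h(1,2), of i] h(3) by simp
    have c: "cmp c n \<in> G n" "cmp c n \<in> carrier R" using cmp_props(1)[OF h(2)] cmp_closed[OF h(2)] by auto
    from r(3) show ?thesis
    proof
      assume "i = 0" thus ?thesis using eq ji cmp_closed[OF jc] by simp
    next
      assume i: "i = Suc n"
      have "r = x \<otimes> cmp c n \<oplus> cmp j i" unfolding eq using i c(2) xc cmp_closed[OF jc] by (simp add: a_comm m_comm)
      thus ?thesis using i c(1) ji by blast
    qed
  qed
  have inc: "J \<subseteq> adjoin J x" by (rule adjoin_incl(1)[OF J(1) xc])
  have "adjoin J x \<inter> G 0 = J \<inter> G 0" using mem[of _ 0 0] inc by blast
  thus "corank (adjoin J x) 0 = corank J 0" unfolding corank_def by simp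
  have eq1: "adjoin J x \<inter> G (Suc i) = smul x (G i) <+>\<^bsub>R\<^esub> (J \<inter> G (Suc i))"
  proof
    show "adjoin J x \<inter> G (Suc i) \<subseteq> smul x (G i) <+>\<^bsub>R\<^esub> (J \<inter> G (Suc i))"
    proof
      fix r assume r: "r \<in> adjoin J x \<inter> G (Suc i)"
      have up: "J \<inter> G (Suc i) \<subseteq> smul x (G i) <+>\<^bsub>R\<^esub> (J \<inter> G (Suc i))"
        by (rule add_upper(2)[OF smul_sub[OF xc sub_G] sub_inter[OF J(1)]])
      have "r \<in> J \<inter> G (Suc i) \<or> (\<exists>c j. c \<in> G i \<and> j \<in> J \<inter> G (Suc i) \<and> r = x \<otimes> c \<oplus> j)"
        using mem[of r "Suc i" i] r by simp
      thus "r \<in> smul x (G i) <+>\<^bsub>R\<^esub> (J \<inter> G (Suc i))"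
      proof
        assume "\<exists>c j. c \<in> G i \<and> j \<in> J \<inter> G (Suc i) \<and> r = x \<otimes> c \<oplus> j"
        then obtain c j where c: "c \<in> G i" "j \<in> J \<inter> G (Suc i)" "r = x \<otimes> c \<oplus> j" by blast
        have "x \<otimes> c \<in> smul x (G i)" using c(1) unfolding smul_def by blast
        from mem_set_addI[OF this c(2,3)] show ?thesis .
      qed (use up in blast)
    qed
    show "smul x (G i) <+>\<^bsub>R\<^esub> (J \<inter> G (Suc i)) \<subseteq> adjoin J x \<inter> G (Suc i)"
    proof (rule add_least[OF sub_inter[OF adjoin_ideal[OF J(1) xc]]])
      show "smul x (G i) \<subseteq> adjoin J x \<inter> G (Suc i)"
        unfolding smul_subset_iff
        using component_mult[OF x(1), of _ i] adjoin_incl(2)[OF J(1) xc] ideal_closed(7)[OF adjoin_ideal[OF J(1) xc]] G_closed(1)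
        by auto
    qed (use inc in auto)
  qed
  \<comment> \<open>This is injectivity of x on R/J. Regularity is given only locally;
    \<open>satur_homogeneous\<close> removes the localization.\<close>
  have eq2: "smul x (G i) \<inter> (J \<inter> G (Suc i)) = smul x (J \<inter> G i)"
  proof
    show "smul x (G i) \<inter> (J \<inter> G (Suc i)) \<subseteq> smul x (J \<inter> G i)"
    proof
      fix r assume "r \<in> smul x (G i) \<inter> (J \<inter> G (Suc i))"
      then obtain g where g: "g \<in> G i" "r = x \<otimes> g" "r \<in> J" unfolding smul_def by blast
      have "x \<otimes> g \<in> satur M J" using g satur_incl[OF M_prime J(1)] by blast
      hence "g \<in> satur M J" using nzdD[OF nz] g(1) G_closed(1) by blast
      hence "g \<in> J" by (rule satur_homogeneous[OF J g(1)])
      thus "r \<in> smul x (J \<inter> G i)" using g unfolding smul_def by blast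
    qed
    show "smul x (J \<inter> G i) \<subseteq> smul x (G i) \<inter> (J \<inter> G (Suc i))"
      using component_mult[OF x(1), of _ i] ideal_closed(6)[OF J(1) _ xc] unfolding smul_def by auto
  qed
  have "dim (G 0) (adjoin J x \<inter> G (Suc i)) + dim (G 0) (J \<inter> G i) = dim (G 0) (G i) + dim (G 0) (J \<inter> G (Suc i))"
    using vd_add[OF vd_smul(1)[OF xc x(2) fd_G] fd_inter[OF J(1)], of i "Suc i"]
    unfolding eq1 eq2 vd_smul(2)[OF xc x(2) fd_G] vd_smul(2)[OF xc x(2) fd_inter[OF J(1)]] .
  thus "corank (adjoin J x) (Suc i) = corank J (Suc i) - corank J i" unfolding corank_def by linarith
qed

lemma corank_lreg:
  assumes "ideal J R" "homog J" "J \<subseteq> M" "set xs \<subseteq> G 1" "lreg M J xs"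
  shows "Abs_fps (corank (adjoins J xs)) = Abs_fps (corank J) * (1 - fps_X) ^ length xs"
  using assms
proof (induction xs arbitrary: J)
  case (Cons x xs)
  have x: "x \<in> G 1" "x \<in> carrier R" using Cons.prems G_closed(1) by auto
  have nz: "nzd (satur M J) x" and lr: "lreg M (adjoin J x) xs" using Cons.prems(5) unfolding lreg_Cons by auto
  \<comment> \<open>A zero entry would be regular only if the localized quotient vanished, which J
    \<subseteq> M excludes.\<close>
  have "x \<noteq> \<zero>"
  proof
    assume "x = \<zero>"
    hence "\<one> \<in> satur M J" using nzdD[OF nz one_closed] satur_incl[OF M_prime Cons.prems(1)] ideal_closed(2)[OF Cons.prems(1)] by auto
    hence "\<one> \<in> M" using satur_subset_prime[OF M_prime _ Cons.prems(3)] by blast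
    thus False using primeideal_one[OF M_prime] by blast
  qed
  note cr = corank_adjoin[OF Cons.prems(1,2) x(1) this nz]
  have "Abs_fps (corank (adjoin J x)) = Abs_fps (corank J) * (1 - fps_X)"
  proof (rule fps_ext)
    fix n show "fps_nth (Abs_fps (corank (adjoin J x))) n = fps_nth (Abs_fps (corank J) * (1 - fps_X)) n"
      using cr by (cases n) (simp_all add: algebra_simps)
  qed
  moreover have "Abs_fps (corank (adjoins (adjoin J x) xs)) = Abs_fps (corank (adjoin J x)) * (1 - fps_X) ^ length xs"
  proof (rule Cons.IH[OF adjoin_ideal[OF Cons.prems(1) x(2)] homog_adjoin[OF Cons.prems(1,2) x(1)] _ _ lr])
    show "adjoin J x \<subseteq> M"
      using x(1) G_pos_M[of 1] primeideal.axioms(1)[OF M_prime] by (intro adjoin_least Cons.prems) auto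
  qed (use Cons.prems in auto)
  ultimately show ?case by (simp add: mult_ac)
qed simp

lemma corank_zero: "Abs_fps (corank {\<zero>}) = hilbert_series R G"
proof -
  have "{\<zero>} \<inter> G i = {\<zero>}" for i using G_closed(2) by blast
  thus ?thesis unfolding corank_def hilbert_series_def by (simp add: vd_zero)
qed

lemma corank_eq_0:
  assumes "ideal J R" "corank J i = 0" shows "G i \<subseteq> J"
  using vd_eq_imp_eq[OF fd_G sub_inter[OF assms(1)], of i i] assms(2) unfolding corank_def by auto

text \<open>Converts ideals into spaces of forms, so that values of \<open>corank\<close> become
  hypotheses of \<open>degree_one_products_span\<close>.\<close>

lemma adjoins_inter_G:
  assumes "set xs \<subseteq> G 1"
  shows "adjoins {\<zero>} xs \<inter> G (Suc m) = forms xs (Suc 0) (G m)"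
proof
  have xc: "set xs \<subseteq> carrier R" using assms G_closed(1) by auto
  have I: "ideal (adjoins {\<zero>} xs) R" by (rule adjoins_ideal[OF zeroideal xc])
  show "adjoins {\<zero>} xs \<inter> G (Suc m) \<subseteq> forms xs (Suc 0) (G m)"
  proof
    fix r assume r: "r \<in> adjoins {\<zero>} xs \<inter> G (Suc m)"
    have "cmp r (m + 1) \<in> forms xs (Suc 0) (G m)"
    proof (rule cmp_adjoins_mem[OF assms _ forms_sub[OF xc sub_G]])
      fix u w assume uw: "u \<in> set xs" "w \<in> G m"
      have "u \<otimes> w \<in> forms xs (Suc 0) (G m)"
        using forms_step[OF xc sub_G uw(1), of 0 m] uw(2) unfolding smul_subset_iff forms_zero by blast
      thus "w \<otimes> u \<in> forms xs (Suc 0) (G m)" using m_comm uw xc G_closed(1) by (metis subsetD)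
    qed (use r in auto)
    thus "r \<in> forms xs (Suc 0) (G m)" using cmp_homogeneous[of r "Suc m" "Suc m"] r by simp
  qed
  show "forms xs (Suc 0) (G m) \<subseteq> adjoins {\<zero>} xs \<inter> G (Suc m)"
  proof (rule forms_one_least[OF xc sub_inter[OF I]])
    fix x assume x: "x \<in> set xs"
    show "smul x (G m) \<subseteq> adjoins {\<zero>} xs \<inter> G (Suc m)"
      unfolding smul_subset_iff
      using component_mult[of x 1 _ m] x assms adjoins_incl(2)[OF zeroideal xc] ideal_closed(7)[OF I] G_closed(1)
      by auto
  qed
qed

end

lemma Abs_fps_hilb: "Abs_fps (\<lambda>m. int (hilb d m)) * (1 - fps_X) ^ d = 1"
proof (induction d)
  case 0
  show ?case
  proof (rule fps_ext)
    fix n show "fps_nth (Abs_fps (\<lambda>m. int (hilb 0 m)) * (1 - fps_X) ^ 0) n = fps_nth 1 n" by (cases n) auto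
  qed
next
  case (Suc d)
  have "Abs_fps (\<lambda>m. int (hilb (Suc d) m)) * (1 - fps_X) = Abs_fps (\<lambda>m. int (hilb d m))"
  proof (rule fps_ext)
    fix n show "fps_nth (Abs_fps (\<lambda>m. int (hilb (Suc d) m)) * (1 - fps_X)) n = fps_nth (Abs_fps (\<lambda>m. int (hilb d m))) n"
      by (cases n) (simp_all add: algebra_simps hilb_zero)
  qed
  thus ?case using Suc by (simp add: mult.assoc[symmetric])
qed

text \<open>On a finite field x^2 - x takes the value 0 twice, hence misses some a, and X^2 - X - a
  has no root.\<close>

lemma (in field) algebraically_closed_infinite:
  assumes "algebraically_closed R" shows "infinite (carrier R)"
proof
  assume fin: "finite (carrier R)"
  interpret A: algebraically_closed R by fact
  define f where "f x = x \<otimes> x \<ominus> x" for x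
  have f: "f ` carrier R \<subseteq> carrier R" unfolding f_def by auto
  have "f \<zero> = f \<one>" unfolding f_def by (simp add: r_neg a_minus_def)
  hence "\<not> inj_on f (carrier R)" using inj_onD[of f "carrier R" \<zero> \<one>] zero_not_one by auto
  hence "f ` carrier R \<noteq> carrier R" using eq_card_imp_inj_on[OF fin, of f] by auto
  then obtain a where a: "a \<in> carrier R" "a \<notin> f ` carrier R" using f by blast
  define p where "p = [\<one>, \<ominus> \<one>, \<ominus> a]"
  have "p \<in> carrier (poly_ring R)"
    unfolding sym[OF univ_poly_carrier] polynomial_def p_def using a(1) by auto
  hence sp: "splitted p" by (rule A.roots_over_carrier)
  hence "size (roots p) = 2" unfolding splitted_def p_def by simp
  then obtain x where "x \<in># roots p" by fastforce
  hence "is_root p x" using roots_mem_iff_is_root \<open>p \<in> carrier (poly_ring R)\<close> by simp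
  hence x: "x \<in> carrier R" "eval p x = \<zero>" unfolding is_root_def by auto
  have "eval p x = f x \<ominus> a" unfolding p_def f_def using x(1) a(1) by (simp add: numeral_2_eq_2) algebra
  moreover have "f x \<in> carrier R" using f x(1) by blast
  ultimately have "f x = a" using x(2) a(1) r_right_minus_eq by metis
  thus False using a(2) x(1) by blast
qed

section \<open>Regular sequences of linear forms and the conclusion\<close>

context graded_domain
begin

text \<open>Products of n elements of \<open>G 1\<close> stand for the n-th power of the ideal
  generated by \<open>G 1\<close>.\<close>

definition prodl :: "'a list \<Rightarrow> 'a" where
  "prodl zs = foldr (\<otimes>) zs \<one>"

lemma prodl_simps: "prodl [] = \<one>" "prodl (z # zs) = z \<otimes> prodl zs"
  unfolding prodl_def by auto

lemma prodl_closed: "set zs \<subseteq> carrier R \<Longrightarrow> prodl zs \<in> carrier R"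
  by (induction zs) (auto simp: prodl_simps)

lemma prodl_append:
  "\<lbrakk> set zs \<subseteq> carrier R; set ws \<subseteq> carrier R \<rbrakk> \<Longrightarrow> prodl (zs @ ws) = prodl zs \<otimes> prodl ws"
  by (induction zs) (auto simp: prodl_simps prodl_closed m_assoc)

lemma prodl_G: "set zs \<subseteq> G 1 \<Longrightarrow> prodl zs \<in> G (length zs)"
proof (induction zs)
  case (Cons z zs)
  thus ?case using component_mult[of z 1 "prodl zs" "length zs"] by (auto simp: prodl_simps)
qed (simp add: prodl_simps one_G)

text \<open>Modulo the ideal generated by \<open>G 1\<close> the degree one subalgebra reduces to
  scalars. So the quotient is spanned by the classes of finitely many module generators, and N
  bounds the degrees of their components.\<close>

lemma semi_standard_bound:
  assumes "semi_standard_graded R G"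
  obtains N us where "set us \<subseteq> G 1" "\<And>i. N < i \<Longrightarrow> G i \<subseteq> adjoins {\<zero>} us" "adjoins {\<zero>} us = Idl (G 1)"
proof -
  obtain us where us: "set us \<subseteq> G 1" "G 1 \<subseteq> adjoins {\<zero>} us" by (rule G_in_adjoins)
  have G1c: "G 1 \<subseteq> carrier R" and uc: "set us \<subseteq> carrier R" using us(1) G_closed(1) by auto
  define I where "I = adjoins {\<zero>} us"
  have I: "ideal I R" unfolding I_def by (rule adjoins_ideal[OF zeroideal uc])
  have Ih: "homog I" unfolding I_def by (rule homog_adjoins[OF zeroideal homog_zero us(1)])
  note IC = ideal_closed[OF I]
  have eq: "I = Idl (G 1)"
  proof
    show "Idl (G 1) \<subseteq> I" using us(2) unfolding I_def[symmetric] by (rule genideal_minimal[OF I])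
    have "set us \<subseteq> Idl (G 1)" using us(1) genideal_self[OF G1c] by blast
    thus "I \<subseteq> Idl (G 1)" unfolding I_def
      using ideal_closed(2)[OF genideal_ideal[OF G1c]] by (intro adjoins_least genideal_ideal[OF G1c]) auto
  qed
  define A where "A = degree_one_subalgebra R G"
  have A: "c \<in> carrier R \<and> (\<exists>k \<in> G 0. c \<ominus> k \<in> I)" if "c \<in> A" for c
    using that unfolding A_def degree_one_subalgebra_def
  proof (induction c rule: generate_ring.induct)
    case one
    thus ?case using one_G IC(2) by (auto intro!: bexI[of _ \<one>] simp: a_minus_def r_neg)
  next
    case (incl h)
    thus ?case
    proof
      assume h: "h \<in> G 0"
      thus ?thesis using G_closed(1)[OF h] IC(2) by (auto intro!: bexI[of _ h] simp: a_minus_def r_neg)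
    next
      assume h: "h \<in> G 1"
      thus ?thesis using G_closed(1)[OF h] G_closed(2)[of 0] us(2) unfolding I_def
        by (auto intro!: bexI[of _ \<zero>] simp: a_minus_def)
    qed
  next
    case (a_inv h)
    then obtain k where k: "k \<in> G 0" "h \<ominus> k \<in> I" "h \<in> carrier R" by blast
    have "\<ominus> h \<ominus> (\<ominus> k) = \<ominus> (h \<ominus> k)" using k(3) G_closed(1)[OF k(1)] by algebra
    thus ?case using k G_closed(4)[OF k(1)] IC(5) by (intro conjI bexI[of _ "\<ominus> k"]) auto
  next
    case (eng_add h g)
    then obtain k l where k: "k \<in> G 0" "h \<ominus> k \<in> I" "h \<in> carrier R" "l \<in> G 0" "g \<ominus> l \<in> I" "g \<in> carrier R" by blast
    have "(h \<oplus> g) \<ominus> (k \<oplus> l) = (h \<ominus> k) \<oplus> (g \<ominus> l)" using k(3,6) G_closed(1)[OF k(1)] G_closed(1)[OF k(4)] by algebra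
    thus ?case using k G_closed(3)[OF k(1,4)] IC(3) by (intro conjI bexI[of _ "k \<oplus> l"]) auto
  next
    case (eng_mult h g)
    then obtain k l where k: "k \<in> G 0" "h \<ominus> k \<in> I" "h \<in> carrier R" "l \<in> G 0" "g \<ominus> l \<in> I" "g \<in> carrier R" by blast
    have c: "k \<in> carrier R" "l \<in> carrier R" using k G_closed(1) by auto
    have "(h \<otimes> g) \<ominus> (k \<otimes> l) = h \<otimes> (g \<ominus> l) \<oplus> l \<otimes> (h \<ominus> k)" using k(3,6) c by algebra
    moreover have "k \<otimes> l \<in> G 0" using component_mult[OF k(1,4)] by simp
    ultimately show ?case using k c IC(3,6) by (intro conjI bexI[of _ "k \<otimes> l"]) auto
  qed
  obtain B where B: "finite B" "B \<subseteq> carrier R" "\<And>r. r \<in> carrier R \<Longrightarrow> \<exists>c. c \<in> B \<rightarrow> A \<and> r = (\<Oplus>x\<in>B. c x \<otimes> x)"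
    using assms unfolding semi_standard_graded_def finitely_generated_over_def A_def by blast
  have "finite (\<Union>b \<in> B. {i. cmp b i \<noteq> \<zero>})" using B cmp_props(2) by (intro finite_UN_I) auto
  then obtain N where N: "\<forall>i \<in> (\<Union>b \<in> B. {i. cmp b i \<noteq> \<zero>}). i \<le> N" using finite_nat_set_iff_bounded_le by blast
  have Nb: "cmp b i = \<zero>" if "b \<in> B" "N < i" for b i using N that by (meson CollectI UN_I leD)
  have NG: "G i \<subseteq> I" if i: "N < i" for i
  proof
    fix r assume r: "r \<in> G i"
    have rc: "r \<in> carrier R" by (rule G_closed(1)[OF r])
    obtain c where c: "c \<in> B \<rightarrow> A" "r = (\<Oplus>x\<in>B. c x \<otimes> x)" using B(3)[OF rc] by blast
    have cb: "c b \<in> carrier R" if "b \<in> B" for b using c(1) A that by blast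
    have mem: "cmp (c b \<otimes> b) i \<in> I" if b: "b \<in> B" for b
    proof -
      obtain k where k: "k \<in> G 0" "c b \<ominus> k \<in> I" using A c(1) b by blast
      have cc: "b \<in> carrier R" "k \<in> carrier R" using b B(2) G_closed(1)[OF k(1)] by auto
      \<comment> \<open>The scalar k contributes b k, which has no components beyond degree N; the
        rest lies in I.\<close>
      have e: "c b \<otimes> b = (c b \<ominus> k) \<otimes> b \<oplus> b \<otimes> k" using cb[OF b] cc by algebra
      have "cmp (c b \<otimes> b) i = cmp ((c b \<ominus> k) \<otimes> b) i \<oplus> cmp (b \<otimes> k) i"
        by (subst e, subst cmp_add) (use cb[OF b] cc in auto)
      also have "cmp (b \<otimes> k) i = \<zero>" using cmp_mult_homogeneous[OF cc(1) k(1), of i] Nb[OF b i] cc by simp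
      finally have "cmp (c b \<otimes> b) i = cmp ((c b \<ominus> k) \<otimes> b) i"
        using cmp_closed[of "(c b \<ominus> k) \<otimes> b" i] cb[OF b] cc by simp
      thus ?thesis using Ih IC(7)[OF k(2) cc(1)] unfolding homog_def by simp
    qed
    have "r = cmp r i" using cmp_homogeneous[OF r, of i] by simp
    also have "\<dots> = (\<Oplus>b\<in>B. cmp (c b \<otimes> b) i)"
      unfolding c(2) using cb B(2) by (intro cmp_finsum B(1)) auto
    also have "\<dots> \<in> I"
    proof -
      have "(\<Oplus>b\<in>C. cmp (c b \<otimes> b) i) \<in> I" if "finite C" "C \<subseteq> B" for C
        using that
      proof (induction C)
        case (insert b C)
        have "(\<Oplus>b\<in>insert b C. cmp (c b \<otimes> b) i) = cmp (c b \<otimes> b) i \<oplus> (\<Oplus>b\<in>C. cmp (c b \<otimes> b) i)"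
          using insert mem IC(1) by (intro finsum_insert) auto
        thus ?case using insert mem IC(3) by auto
      qed (use IC in simp)
      thus ?thesis using B(1) by blast
    qed
    finally show "r \<in> I" .
  qed
  show thesis by (rule that[OF us(1), of N]) (use NG eq in \<open>auto simp: I_def\<close>)
qed

text \<open>The power N + 1 has no components up to degree N, and all later components lie in the
  ideal.\<close>

lemma nilpotent_mod_degree_one:
  assumes "\<And>i. N < i \<Longrightarrow> G i \<subseteq> adjoins {\<zero>} us" "set us \<subseteq> G 1" "y \<in> M"
  shows "\<exists>n::nat. y [^] n \<in> adjoins {\<zero>} us"
proof -
  have uc: "set us \<subseteq> carrier R" using assms(2) G_closed(1) by auto
  have I: "ideal (adjoins {\<zero>} us) R" by (rule adjoins_ideal[OF zeroideal uc])
  have yc: "y \<in> carrier R" using assms(3) M_iff by blast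
  have "y [^] n \<in> D n" for n :: nat
  proof (induction n)
    case 0 show ?case by (simp add: D_def)
  next
    case (Suc n) thus ?case using D_mult[of "y [^] n" n y 1] assms(3) unfolding M_def by simp
  qed
  hence d: "y [^] Suc N \<in> D (Suc N)" .
  have "y [^] Suc N \<in> adjoins {\<zero>} us"
  proof (rule mem_of_cmp)
    fix i show "cmp (y [^] Suc N) i \<in> adjoins {\<zero>} us"
    proof (cases "N < i")
      case True thus ?thesis using assms(1) cmp_props(1) yc nat_pow_closed by blast
    next
      case False thus ?thesis using d ideal_closed(2)[OF I] unfolding D_def by auto
    qed
  qed (use yc ideal_closed[OF I] in auto)
  thus ?thesis by blast
qed

text \<open>If M were the only prime over I inside M, a power of the ideal generated by
  \<open>G 1\<close> would vanish in the localized quotient, by homogeneity also in R/I, and R/I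
  would be zero in all large degrees.\<close>

lemma exists_lower_prime:
  assumes us: "set us \<subseteq> G 1" and N: "\<And>i. N < i \<Longrightarrow> G i \<subseteq> adjoins {\<zero>} us"
    and I: "ideal I R" "homog I" and unb: "\<And>n. \<exists>m \<ge> n. \<not> G m \<subseteq> I"
  obtains Q where "primeideal Q R" "I \<subseteq> Q" "Q \<subset> M"
proof -
  note IC = ideal_closed[OF I(1)]
  have G1: "G 1 \<subseteq> carrier R" using G_closed(1) by auto
  \<comment> \<open>This says that some power of the ideal generated by \<open>G 1\<close> lies in J
    after localizing at M, with one denominator s for all products.\<close>
  define bad where "bad J \<longleftrightarrow> (\<exists>n. \<exists>s \<in> carrier R - M. \<forall>zs. set zs \<subseteq> G 1 \<and> length zs = n \<longrightarrow> s \<otimes> prodl zs \<in> J)" for J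
  have step: "G (Suc m) \<subseteq> H" if "N < Suc m" "subalgebra (G 0) H R" "\<And>u w. \<lbrakk> u \<in> G 1; w \<in> G m \<rbrakk> \<Longrightarrow> w \<otimes> u \<in> H" for m H
  proof
    fix r assume r: "r \<in> G (Suc m)"
    have "cmp r (m + 1) \<in> H" using r N[OF that(1)] that(3) us by (intro cmp_adjoins_mem[OF us _ that(2)]) auto
    thus "r \<in> H" using cmp_homogeneous[OF r, of "Suc m"] by simp
  qed
  obtain Q where Q: "primeideal Q R" "I \<subseteq> Q" "\<not> bad Q"
  proof (rule exists_prime_not_bad[OF I(1), of bad])
    show "\<not> bad I"
    proof
      assume "bad I"
      then obtain n s where s: "s \<in> carrier R" "s \<notin> M" "\<forall>zs. set zs \<subseteq> G 1 \<and> length zs = n \<longrightarrow> s \<otimes> prodl zs \<in> I"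
        unfolding bad_def by blast
      have pI: "prodl zs \<in> I" if zs: "set zs \<subseteq> G 1" "length zs = n" for zs
      proof (rule satur_homogeneous[OF I prodl_G[OF zs(1)]])
        have "prodl zs \<in> carrier R" using prodl_closed zs G1 by blast
        thus "prodl zs \<in> satur M I" using s zs by (intro saturI[of _ s]) auto
      qed
      \<comment> \<open>Above degree N a factor from \<open>G 1\<close> can be split off, so k
        factors of the product are traded for k degrees; k = n leaves the empty product.\<close>
      have claim: "\<forall>w \<in> G (N + k). prodl zs \<otimes> w \<in> I" if "set zs \<subseteq> G 1" "k \<le> n" "length zs = n - k" for k zs
        using that
      proof (induction k arbitrary: zs)
        case 0 thus ?case using pI[of zs] IC(7) G_closed(1) by auto
      next
        case (Suc k)
        have zc: "prodl zs \<in> carrier R" using prodl_closed Suc.prems(1) G1 by blast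
        have "G (Suc (N + k)) \<subseteq> {w \<in> carrier R. prodl zs \<otimes> w \<in> I}"
        proof (rule step)
          show "subalgebra (G 0) {w \<in> carrier R. prodl zs \<otimes> w \<in> I} R"
            by (rule preimage_sub[OF zc carrier_is_subalgebra[OF K_carrier] ideal_is_subalgebra[OF K_carrier I(1)]])
          fix u w assume uw: "u \<in> G 1" "w \<in> G (N + k)"
          have c: "u \<in> carrier R" "w \<in> carrier R" using uw G_closed(1) by auto
          have "prodl (u # zs) \<otimes> w \<in> I" using Suc.IH[of "u # zs"] Suc.prems uw by auto
          moreover have "prodl (u # zs) \<otimes> w = prodl zs \<otimes> (w \<otimes> u)"
            unfolding prodl_simps using c zc by (simp add: m_ac)
          ultimately show "w \<otimes> u \<in> {w \<in> carrier R. prodl zs \<otimes> w \<in> I}" using c by simp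
        qed simp
        thus ?case by auto
      qed
      have base: "G (N + n) \<subseteq> I" using claim[of "[]" n] G_closed(1)[of _ "N + n"] by (auto simp: prodl_simps)
      have "G m \<subseteq> I" if "N + n \<le> m" for m
        using that
      proof (induction m rule: dec_induct)
        case (step m)
        show ?case
        proof (rule \<open>\<And>m H. \<lbrakk>N < Suc m; sub H; \<And>u w. \<lbrakk>u \<in> G 1; w \<in> G m\<rbrakk> \<Longrightarrow> w \<otimes> u \<in> H\<rbrakk> \<Longrightarrow> G (Suc m) \<subseteq> H\<close>)
          show "sub I" by (rule ideal_is_subalgebra[OF K_carrier I(1)])
        qed (use step IC(7) G_closed(1) in auto)
      qed (rule base)
      thus False using unb[of "N + n"] by blast
    qed
    show "bad (carrier R)"
      unfolding bad_def using primeideal_one[OF M_prime] prodl_closed by (intro exI[of _ 0] bexI[of _ \<one>]) (auto simp: prodl_simps)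
    fix J a b assume J: "ideal J R" "a \<in> carrier R" "b \<in> carrier R" "a \<otimes> b \<in> J" "bad (adjoin J a)" "bad (adjoin J b)"
    then obtain n s m t where s: "s \<in> carrier R - M" "\<forall>zs. set zs \<subseteq> G 1 \<and> length zs = n \<longrightarrow> s \<otimes> prodl zs \<in> adjoin J a"
      and t: "t \<in> carrier R - M" "\<forall>zs. set zs \<subseteq> G 1 \<and> length zs = m \<longrightarrow> t \<otimes> prodl zs \<in> adjoin J b"
      unfolding bad_def by meson
    have "(s \<otimes> t) \<otimes> prodl zs \<in> J" if zs: "set zs \<subseteq> G 1" "length zs = n + m" for zs
    proof -
      have z1: "set (take n zs) \<subseteq> G 1" "set (drop n zs) \<subseteq> G 1"
        using order_trans[OF set_take_subset zs(1)] order_trans[OF set_drop_subset zs(1)] by auto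
      have c: "prodl (take n zs) \<in> carrier R" "prodl (drop n zs) \<in> carrier R"
        using prodl_closed order_trans[OF z1(1) G1] order_trans[OF z1(2) G1] by auto
      have "prodl zs = prodl (take n zs) \<otimes> prodl (drop n zs)"
        using prodl_append[OF order_trans[OF z1(1) G1] order_trans[OF z1(2) G1]] by simp
      hence "(s \<otimes> t) \<otimes> prodl zs = (s \<otimes> prodl (take n zs)) \<otimes> (t \<otimes> prodl (drop n zs))"
        using s(1) t(1) c by (simp add: m_ac)
      moreover have "s \<otimes> prodl (take n zs) \<in> adjoin J a" "t \<otimes> prodl (drop n zs) \<in> adjoin J b"
        using s(2) t(2) z1 zs(2) by auto
      ultimately show ?thesis using adjoin_mult[OF J(1-4)] by simp
    qed
    moreover have "s \<otimes> t \<in> carrier R - M" using s(1) t(1) primeideal_mult[OF M_prime] by auto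
    ultimately show "bad J" unfolding bad_def by blast
  qed
  have "Q \<subseteq> M"
  proof
    fix q assume q: "q \<in> Q"
    have qc: "q \<in> carrier R" by (rule ideal_closed(1)[OF primeideal.axioms(1)[OF Q(1)] q])
    show "q \<in> M"
    proof (rule ccontr)
      assume "q \<notin> M"
      hence "bad Q" unfolding bad_def using q qc by (intro exI[of _ 0] bexI[of _ q]) (auto simp: prodl_simps)
      thus False using Q(3) by simp
    qed
  qed
  \<comment> \<open>M itself is bad, with n = 1 and s = 1, because it contains
    \<open>G 1\<close>.\<close>
  moreover have "Q \<noteq> M"
  proof
    assume QM: "Q = M"
    have "\<one> \<otimes> prodl zs \<in> Q" if "set zs \<subseteq> G 1" "length zs = 1" for zs
    proof -
      have "prodl zs \<in> G 1" using prodl_G[OF that(1)] that(2) by simp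
      thus ?thesis using G_pos_M[of 1] G_closed(1) unfolding QM by auto
    qed
    hence "bad Q" unfolding bad_def using primeideal_one[OF M_prime] by (intro exI[of _ 1] bexI[of _ \<one>]) auto
    thus False using Q(3) by simp
  qed
  ultimately show thesis using that Q by blast
qed

lemma exists_linear_lreg:
  assumes "infinite (G 0)" "semi_standard_graded R G" "cohen_macaulay R"
    and H: "hilbert_series R G * (1 - fps_X) ^ d = fps_of_poly p" and p: "poly p 1 \<noteq> 0"
  obtains xs where "set xs \<subseteq> G 1" "length xs = d" "lreg M {\<zero>} xs"
proof -
  obtain N us where us: "set us \<subseteq> G 1" "\<And>i. N < i \<Longrightarrow> G i \<subseteq> adjoins {\<zero>} us" "adjoins {\<zero>} us = Idl (G 1)"
    by (rule semi_standard_bound[OF assms(2)]) blast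
  obtain ys where ys: "set ys \<subseteq> M" "lreg M {\<zero>} ys" "length ys \<le> d"
    and chain: "\<And>n P. \<lbrakk> length ys < d; \<And>i. i \<le> n \<Longrightarrow> primeideal (P i) R; \<And>i. i < n \<Longrightarrow> P i \<subset> P (Suc i); P n \<subseteq> M \<rbrakk>
      \<Longrightarrow> n \<le> length ys"
    by (rule cohen_macaulay_lreg[OF assms(3) M_maximal, of d]) blast
  have G1: "G 1 \<subseteq> carrier R" "G 1 \<noteq> {}" using G_closed(1,2) by blast+
  have "\<exists>xs. set xs \<subseteq> G 1 \<and> length xs = length ys \<and> lreg M {\<zero>} xs"
  proof (rule lreg_in_subspace[OF ground_field assms(1) G1 _ M_prime _ zeroideal ys(1,2)])
    show "v \<oplus> c \<otimes> u \<in> G 1" if "u \<in> G 1" "v \<in> G 1" "c \<in> G 0" for u v c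
      using G_closed(3)[of v 1 "c \<otimes> u"] component_mult[of c 0 u 1] that by simp
    show "\<exists>n::nat. y [^] n \<in> Idl (G 1)" if "y \<in> M" for y
      using nilpotent_mod_degree_one[OF us(2,1) that] unfolding us(3) .
  qed
  then obtain xs where xs: "set xs \<subseteq> G 1" "length xs = length ys" "lreg M {\<zero>} xs" by blast
  have "length ys = d"
  proof (rule ccontr)
    assume "length ys \<noteq> d"
    hence lt: "length ys < d" using ys(3) by simp
    have xc: "set xs \<subseteq> carrier R" using xs(1) G1 by blast
    define I where "I = adjoins {\<zero>} xs"
    have I: "ideal I R" unfolding I_def by (rule adjoins_ideal[OF zeroideal xc])
    have Ih: "homog I" unfolding I_def by (rule homog_adjoins[OF zeroideal homog_zero xs(1)])
    have zM: "{\<zero>} \<subseteq> M" using ideal_closed(2)[OF primeideal.axioms(1)[OF M_prime]] by simp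
    have cr: "Abs_fps (corank I) = hilbert_series R G * (1 - fps_X) ^ length xs"
      using corank_lreg[OF zeroideal homog_zero zM xs(1,3)] unfolding corank_zero I_def .
    \<comment> \<open>Otherwise the Hilbert series of R/I is a polynomial q, and p = q (1 - t)^(d -
      r) with r = \<open>length xs\<close> < d vanishes at 1.\<close>
    have unb: "\<exists>m \<ge> n. \<not> G m \<subseteq> I" for n
    proof (rule ccontr)
      assume "\<not> ?thesis"
      hence all: "\<And>m. n \<le> m \<Longrightarrow> G m \<subseteq> I" by blast
      have c0: "corank I m = 0" if "n \<le> m" for m
      proof -
        have "I \<inter> G m = G m" using all[OF that] by blast
        thus ?thesis unfolding corank_def by simp
      qed
      define q where "q = Poly (map (corank I) [0..<n])"
      have "Abs_fps (corank I) = fps_of_poly q"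
      proof (rule fps_ext)
        fix m show "fps_nth (Abs_fps (corank I)) m = fps_nth (fps_of_poly q) m"
          using c0[of m] unfolding q_def by (simp add: nth_default_def)
      qed
      moreover have "d = length xs + (d - length xs)" using lt xs(2) by simp
      ultimately have "fps_of_poly p = fps_of_poly q * (1 - fps_X) ^ (d - length xs)"
        using H cr by (metis mult.assoc power_add)
      also have "(1 - fps_X :: int fps) = fps_of_poly [:1, -1:]"
        by (simp add: fps_of_poly_simps)
      finally have "p = q * [:1, -1:] ^ (d - length xs)"
        by (simp add: fps_of_poly_mult[symmetric] fps_of_poly_power[symmetric] fps_of_poly_eq_iff)
      hence "poly p 1 = 0" using lt xs(2) by simp
      thus False using p by simp
    qed
    obtain Q where Q: "primeideal Q R" "I \<subseteq> Q" "Q \<subset> M"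
      by (rule exists_lower_prime[OF us(1,2) I Ih unb])
    have QM: "Q \<subseteq> M" using Q(3) by blast
    obtain P where P: "\<And>i. i \<le> length xs \<Longrightarrow> primeideal (P i) R"
      "\<And>i. i < length xs \<Longrightarrow> P i \<subset> P (Suc i)" "P (length xs) = Q"
      using lreg_prime_chain[OF M_prime zeroideal xc Q(1) QM _ xs(3)] Q(2) unfolding I_def by metis
    \<comment> \<open>The chain of length r ending in Q, extended by M, has length r + 1, one more
      than \<open>chain\<close> permits.\<close>
    define P' where "P' i = (if i \<le> length xs then P i else M)" for i
    have "Suc (length xs) \<le> length ys"
    proof (rule chain[OF lt, of _ P'])
      show "primeideal (P' i) R" for i using P(1) M_prime unfolding P'_def by simp
      show "P' i \<subset> P' (Suc i)" if "i < Suc (length xs)" for i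
        using that P(2,3) Q(3) unfolding P'_def by (cases "i = length xs") auto
      show "P' (Suc (length xs)) \<subseteq> M" unfolding P'_def by simp
    qed
    thus False using xs(2) by simp
  qed
  thus thesis using that xs by simp
qed

lemma standard_graded_of_h_vector:
  assumes inf: "infinite (G 0)" and ss: "semi_standard_graded R G" and cm: "cohen_macaulay R"
    and hv: "has_h_vector R G [h0, h1, h2]" and le: "h2 \<le> h1"
  shows "standard_graded R G"
proof -
  define p where "p = Poly [h0, h1, h2]"
  obtain d where d: "hilbert_series R G * (1 - fps_X) ^ d = fps_of_poly p"
    using hv unfolding has_h_vector_def p_def by blast
  have "poly p 1 \<noteq> 0" using hv unfolding has_h_vector_def p_def by (simp add: add.assoc)
  then obtain xs where xs: "set xs \<subseteq> G 1" "length xs = d" "lreg M {\<zero>} xs"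
    by (rule exists_linear_lreg[OF inf ss cm d])
  have xc: "set xs \<subseteq> carrier R" using xs(1) G_closed(1) by blast
  define I where "I = adjoins {\<zero>} xs"
  have I: "ideal I R" unfolding I_def by (rule adjoins_ideal[OF zeroideal xc])
  have zM: "{\<zero>} \<subseteq> M" using ideal_closed(2)[OF primeideal.axioms(1)[OF M_prime]] by simp
  have "Abs_fps (corank I) = fps_of_poly p"
    using corank_lreg[OF zeroideal homog_zero zM xs(1,3)] d xs(2) unfolding corank_zero I_def by simp
  \<comment> \<open>Dividing by the whole sequence cancels the denominator: the h-vector is the
    Hilbert function of R/I.\<close>
  hence cr: "corank I m = Polynomial.coeff p m" for m by (metis fps_nth_Abs_fps fps_of_poly_nth)
  have cp: "Polynomial.coeff p 0 = h0" "Polynomial.coeff p 1 = h1" "Polynomial.coeff p 2 = h2"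
    "\<And>m. 3 \<le> m \<Longrightarrow> Polynomial.coeff p m = 0"
    unfolding p_def by (auto simp: nth_default_def numeral_2_eq_2 simp del: Poly.simps)
  have IG: "I \<inter> G (Suc m) = forms xs (Suc 0) (G m)" for m unfolding I_def by (rule adjoins_inter_G[OF xs(1)])
  have up: "vd (I \<inter> G m) \<le> vd (G m)" for m by (rule vd_mono[OF fd_G sub_inter[OF I]]) auto
  \<comment> \<open>As values of a Hilbert function h1 and h2 are nonnegative, which follows from
    \<open>up\<close>; so \<open>nat\<close> loses nothing.\<close>
  define k1 where "k1 = nat h1"
  define k2 where "k2 = nat h2"
  have c1: "vd (G 1) = vd (forms xs (Suc 0) (G 0)) + k1" "int k1 = h1"
    using cr[of 1] cp(2) up[of 1] IG[of 0] unfolding corank_def k1_def by auto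
  have c2: "vd (G 2) = vd (forms xs (Suc 0) (G 1)) + k2" "int k2 = h2"
    using cr[of 2] cp(3) up[of 2] IG[of 1] unfolding corank_def k2_def by (auto simp: numeral_2_eq_2)
  \<comment> \<open>The h-vector ends in degree two, so R/I vanishes from degree three on.\<close>
  have gen: "G (Suc m) \<subseteq> forms xs (Suc 0) (G m)" if "2 \<le> m" for m
  proof -
    have "G (Suc m) \<subseteq> I" using cr[of "Suc m"] cp(4)[of "Suc m"] that by (intro corank_eq_0[OF I]) simp
    thus ?thesis using IG[of m] by blast
  qed
  have H: "hilbert_series R G = fps_of_poly p * Abs_fps (\<lambda>m. int (hilb d m))"
    unfolding d[symmetric] using Abs_fps_hilb[of d] by (simp add: mult.assoc mult.commute[of "(1 - fps_X) ^ d"])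
  have h0: "h0 = 1"
  proof -
    have "fps_nth (hilbert_series R G) 0 = h0" unfolding H using cp(1) by (simp add: hilb_zero)
    thus ?thesis using vd_K(2) unfolding hilbert_series_def by simp
  qed
  have tot: "vd (G (m + 2)) = hilb d (m + 2) + k1 * hilb d (m + 1) + k2 * hilb d m" for m
  proof -
    have "fps_of_poly p = fps_const h0 + fps_const h1 * fps_X + fps_const h2 * fps_X ^ 2"
    proof (rule fps_ext)
      fix n :: nat
      consider "n = 0" | "n = 1" | "n = 2" | "3 \<le> n" by linarith
      thus "fps_nth (fps_of_poly p) n = fps_nth (fps_const h0 + fps_const h1 * fps_X + fps_const h2 * fps_X ^ 2) n"
        using cp by cases (auto simp: fps_X_power_nth)
    qed
    hence "int (vd (G (m + 2))) = fps_nth ((fps_const h0 + fps_const h1 * fps_X + fps_const h2 * fps_X ^ 2) * Abs_fps (\<lambda>m. int (hilb d m))) (m + 2)"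
      using H unfolding hilbert_series_def by (metis fps_nth_Abs_fps)
    also have "\<dots> = h0 * int (hilb d (m + 2)) + h1 * int (hilb d (m + 1)) + h2 * int (hilb d m)"
      by (simp add: distrib_right mult.assoc fps_X_power_mult_nth)
    also have "\<dots> = int (hilb d (m + 2) + k1 * hilb d (m + 1) + k2 * hilb d m)"
      unfolding h0 c1(2)[symmetric] c2(2)[symmetric] by simp
    finally show ?thesis by (simp only: of_nat_eq_iff)
  qed
  define A where "A = degree_one_subalgebra R G"
  have Gc: "G 0 \<union> G 1 \<subseteq> carrier R" using G_closed(1) by blast
  have A: "subring A R" unfolding A_def degree_one_subalgebra_def by (rule generate_ring_is_subring[OF Gc])
  have AG: "G 0 \<subseteq> A" "G 1 \<subseteq> A" unfolding A_def degree_one_subalgebra_def by (auto intro: generate_ring.incl)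
  have sA: "sub A"
    using subringE[OF A] AG by (intro subI) auto
  \<comment> \<open>The space D of the counting lemma is the degree two part of the degree one
    subalgebra.\<close>
  have "A \<inter> G 2 = G 2"
  proof (rule degree_one_products_span[OF fd_G component_mult refl xs(1) gen c1(1) c2(1)])
    show "k2 \<le> k1" using le c1(2) c2(2) by simp
    show "vd (G (m + 2)) = hilb (length xs) (m + 2) + k1 * hilb (length xs) (m + 1) + k2 * hilb (length xs) m" for m
      using tot xs(2) by simp
    show "sub (A \<inter> G 2)" by (rule subalgebra_inter[OF sA sub_G])
    show "x \<otimes> y \<in> A \<inter> G 2" if "x \<in> G 1" "y \<in> G 1" for x y
      using subringE(6)[OF A] AG(2) that component_mult[OF that] by (auto simp: numeral_2_eq_2)
  qed auto
  hence A2: "G (Suc (Suc 0)) \<subseteq> A" by (auto simp: numeral_2_eq_2)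
  \<comment> \<open>Only degree two was in doubt: from degree three on each component is generated
    by linear forms and the component below.\<close>
  have GA: "G m \<subseteq> A" for m
  proof (induction m)
    case (Suc m)
    show ?case
    proof (cases "2 \<le> m")
      case True
      have "forms xs (Suc 0) (G m) \<subseteq> A"
      proof (rule forms_one_least[OF xc sA])
        fix x assume "x \<in> set xs"
        hence "x \<in> A" using xs(1) AG(2) by blast
        thus "smul x (G m) \<subseteq> A" unfolding smul_subset_iff using Suc subringE(6)[OF A] by blast
      qed
      thus ?thesis using gen[OF True] by blast
    next
      case False
      hence "m = 0 \<or> m = 1" by linarith
      thus ?thesis using AG A2 by auto
    qed
  qed (rule AG)
  have "carrier R \<subseteq> A"
  proof
    fix x assume x: "x \<in> carrier R"
    show "x \<in> A"
      using GA cmp_props(1)[OF x] subD[OF sA] by (intro mem_of_cmp[OF x]) auto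
  qed
  thus ?thesis unfolding standard_graded_def A_def using subringE(1)[OF A] A_def by auto
qed

end

theorem theorem1p1:
  fixes R :: "('a, 'b) ring_scheme"
    and G :: "nat \<Rightarrow> 'a set"
    and K :: "'a set"
    and h0 h1 h2 :: int
  assumes "subfield K R"
    and "algebraically_closed (R \<lparr> carrier := K \<rparr>)"
    and "noetherian_ring R"
    and "graded_cring R G"
    and "G 0 = K"
    and "semi_standard_graded R G"
    and "cohen_macaulay R"
    and "domain R"
    and "has_h_vector R G [h0, h1, h2]"
    and "h2 \<le> h1"
  shows "standard_graded R G"
proof -
  interpret graded_domain R G
    using assms(1,5) by (intro graded_domain.intro graded_domain_axioms.intro assms) auto
  have "infinite (carrier (R \<lparr> carrier := K \<rparr>))"
    using field.algebraically_closed_infinite[OF algebraically_closed.axioms(1)[OF assms(2)] assms(2)] .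
  hence "infinite (G 0)" using assms(5) by simp
  thus ?thesis by (rule standard_graded_of_h_vector[OF _ assms(6,7,9,10)])
qed

end
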